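(* Let $\Lambda=\Lambda_0\oplus\Lambda_1$ be a finite-dimensional real commutative superalgebra such that $\Lambda_0$ satisfies condition $(A_0)$ and $\Lambda_1$ satisfies condition $(A_1)$, and let $n,m\in\mathbb N$. Let $D$ be a bounded open subset of $\Lambda_0^n\times\Lambda_1^m$ with $C^1$ boundary, and let $f:\overline D\to\Lambda$ be a function which is of class $C^1$ (in the Fréchet sense) in $D$ and which, together with $df$, is continuous on $\overline D$. Then for every $x\in D$, $$f(x)=\int_{\partial D} f(u)\,K(u,x)\;-\;\int_D d''f(u)\wedge K(u,x),$$ where $K$ is the explicit kernel defined in the context.
   Context: Superalgebras. A real commutative superalgebra (CSA) is an associative unital real algebra with a grading $\Lambda=\Lambda_0\oplus\Lambda_1$, $\Lambda_i\Lambda_j\subset\Lambda_{i+j \bmod 2}$, such that $ab=(-1)^{\sigma(a)\sigma(b)}ba$ for homogeneous $a,b$, where $\sigma(a)=i$ for $a\in\Lambda_i$. In particular $\Lambda_0$ is contained in the centre. Condition $(A_0)$: there is a basis $(e_0=1,e_1,\dots,e_p)$ of $\Lambda_0$ with $\sum_{k=0}^p e_k^2=0$. Condition $(A_1)$: there are a basis $(\varepsilon_1,\dots,\varepsilon_q)$ of $\Lambda_1$, integers $1=s_1<s_2<\dots<s_r<s_{r+1}=q+1$ and elements $a_1,\dots,a_q\in\Lambda_0$ such that $\varepsilon_j=a_j\varepsilon_{s_k}$ whenever $s_k\le j<s_{k+1}$, $a_{s_1}=\dots=a_{s_r}=e_0$, and $\sum_{j=s_k}^{s_{k+1}-1}a_j^2=0$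 for every $k=1,\dots,r$. Such bases and elements are fixed. Coordinates. A point of $\Lambda_0^n\times\Lambda_1^m$ is written $x=(y_1,\dots,y_n,\theta_1,\dots,\theta_m)$ with $y_i=\sum_{k=0}^p y_i^k e_k$, $\theta_i=\sum_{l=1}^q\theta_i^l\varepsilon_l$, where the $y_i^k,\theta_i^l$ are real coordinates. Put $N=n(p+1)+mq$; $\|\cdot\|$ is the Euclidean norm in these $N$ real coordinates, and $\mathrm{Vol}(B(0,1))$ is the volume of the unit ball of $\mathbb R^N$. The space is oriented by the coordinates in the order $y_1^0,\dots,y_1^p,\dots,y_n^0,\dots,y_n^p,\theta_1^1,\dots,\theta_1^q,\dots,\theta_m^1,\dots,\theta_m^q$, and $\partial D$ has the boundary orientation. All differential forms are forms in the real coordinates with coefficients in $\Lambda$. Operator $d''$ (derivatives act on coefficients): $$d''\omega=\sum_{i=1}^n\sum_{j=1}^p dy_i^j\wedge\Big(\frac{\partial\omega}{\partial y_i^j}-e_j\frac{\partial\omega}{\partial y_i^0}\Big)+\sum_{i=1}^m\sum_{k=1}^r\sum_{t=s_k+1}^{s_{k+1}-1}d\theta_i^t\wedge\Big(\frac{\partial\omega}{\partial\theta_i^t}-a_t\frac{\partial\omega}{\partial\theta_i^{s_k}}\Big).$$ Kernel. Let $dY_i=\sum_{k=0}^p e_k\,dy_i^k$ and $dZ_k(\theta_i)=\sum_{\ell=s_k}^{s_{k+1}-1}a_\ell\,d\theta_i^\ell$. Let $\widehat{dy_i^0dy_i^j}$ (resp. $\widehat{d\theta_i^{s_k}d\theta_i^\ell}$)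 be the wedge product, taken in the order $y_1^0,\dots,y_1^p,\dots,y_n^0,\dots,y_n^p,\theta_1^1,\dots,\theta_1^q,\dots,\theta_m^1,\dots,\theta_m^q$ of the coordinates, of the differentials of all $N$ real coordinates except $y_i^0,y_i^j$ (resp. except $\theta_i^{s_k},\theta_i^\ell$). Define on $(\Lambda_0^n\times\Lambda_1^m)\setminus\{0\}$ the $(N-1)$-form $$\Omega(x)=\frac{1}{N\,\mathrm{Vol}(B(0,1))\,\|x\|^N}\Big(\sum_{i=1}^n dY_i\wedge\sum_{j=1}^p(-1)^j(y_i^je_0+y_i^0e_j)\,\widehat{dy_i^0dy_i^j}+\sum_{i=1}^m\sum_{k=1}^r dZ_k(\theta_i)\wedge\sum_{\ell=s_k+1}^{s_{k+1}-1}(-1)^{\ell-1}(\theta_i^\ell e_0+\theta_i^{s_k}a_\ell)\,\widehat{d\theta_i^{s_k}d\theta_i^\ell}\Big).$$ For $x$ fixed, $K(u,x)$ is the $(N-1)$-form in $u$ obtained by pulling back $\Omega$ by the map $u\mapsto u-x$.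
   Formalization: In the odd part of the kernel the sign (-1)^{l-1} is corrected to (-1)^{l-s_k}; the two agree when every s_k is odd, and with the printed sign the formula already fails for f = 1 on a ball when m >= 1 and some s_k is even. *)

theory Defs
  imports "HOL-Analysis.Analysis"
begin

section \<open>Real commutative superalgebras\<close>

text \<open>
  The algebra is a whole type of sort \<open>{euclidean_space, real_algebra_1}\<close>: a finite-dimensional
  associative unital real algebra together with an arbitrary auxiliary inner product (no
  compatibility of the norm with the product is assumed), which only serves to provide the usual
  topology. \<open>\<Lambda> 0\<close> and \<open>\<Lambda> 1\<close> are the even and the odd part.
\<close>

definition comm_superalgebra :: "(nat \<Rightarrow> 'a::real_algebra_1 set) \<Rightarrow> bool" where
  "comm_superalgebra \<Lambda> \<longleftrightarrow>
     subspace (\<Lambda> 0) \<and> subspace (\<Lambda> 1) \<and> \<Lambda> 0 \<inter> \<Lambda> 1 = {0} \<and>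
     (\<forall>c. \<exists>a\<in>\<Lambda> 0. \<exists>b\<in>\<Lambda> 1. c = a + b) \<and>
     (\<forall>i\<in>{0, 1}. \<forall>j\<in>{0, 1}. \<forall>a\<in>\<Lambda> i. \<forall>b\<in>\<Lambda> j.
        a * b \<in> \<Lambda> ((i + j) mod 2) \<and> a * b = (- 1) ^ (i * j) * (b * a))"

definition is_basis :: "'a::real_vector set \<Rightarrow> nat set \<Rightarrow> (nat \<Rightarrow> 'a) \<Rightarrow> bool" where
  "is_basis V I b \<longleftrightarrow> inj_on b I \<and> independent (b ` I) \<and> span (b ` I) = V"

definition condition_A0 :: "(nat \<Rightarrow> 'a::real_algebra_1 set) \<Rightarrow> nat \<Rightarrow> (nat \<Rightarrow> 'a) \<Rightarrow> bool" where
  "condition_A0 \<Lambda> p e \<longleftrightarrow>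
     is_basis (\<Lambda> 0) {0..p} e \<and> e 0 = 1 \<and> (\<Sum>k=0..p. (e k)\<^sup>2) = 0"

definition condition_A1 ::
  "(nat \<Rightarrow> 'a::real_algebra_1 set) \<Rightarrow> nat \<Rightarrow> (nat \<Rightarrow> 'a) \<Rightarrow> nat \<Rightarrow> (nat \<Rightarrow> nat) \<Rightarrow> (nat \<Rightarrow> 'a) \<Rightarrow> bool" where
  "condition_A1 \<Lambda> q \<epsilon> r s a \<longleftrightarrow>
     is_basis (\<Lambda> 1) {1..q} \<epsilon> \<and>
     s 1 = 1 \<and> (\<forall>k\<in>{1..r}. s k < s (k + 1)) \<and> s (r + 1) = q + 1 \<and>
     (\<forall>j\<in>{1..q}. a j \<in> \<Lambda> 0) \<and>
     (\<forall>k\<in>{1..r}. \<forall>j\<in>{s k..<s (k + 1)}. \<epsilon> j = a j * \<epsilon> (s k)) \<and>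
     (\<forall>k\<in>{1..r}. a (s k) = 1) \<and>
     (\<forall>k\<in>{1..r}. (\<Sum>j=s k..<s (k + 1). (a j)\<^sup>2) = 0)"


section \<open>The superspace and its real coordinates\<close>

text \<open>
  The real coordinates live in \<open>real ^ 'N\<close> with \<open>CARD('N) = n * (p + 1) + m * q\<close>. The order of
  the index type \<open>'N\<close> is the order of the coordinates
  \<open>y\<^sub>1\<^sup>0, \<dots>, y\<^sub>1\<^sup>p, \<dots>, y\<^sub>n\<^sup>0, \<dots>, y\<^sub>n\<^sup>p, \<theta>\<^sub>1\<^sup>1, \<dots>, \<theta>\<^sub>1\<^sup>q, \<dots>, \<theta>\<^sub>m\<^sup>1, \<dots>, \<theta>\<^sub>m\<^sup>q\<close>;
  \<open>ycoord\<close> and \<open>tcoord\<close> give the index of \<open>y\<^sub>i\<^sup>k\<close> and of \<open>\<theta>\<^sub>i\<^sup>l\<close>.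
\<close>

type_synonym 'a spoint = "(nat \<Rightarrow> 'a) \<times> (nat \<Rightarrow> 'a)"

definition superspace :: "(nat \<Rightarrow> 'a set) \<Rightarrow> nat \<Rightarrow> nat \<Rightarrow> 'a spoint set" where
  "superspace \<Lambda> n m = ({1..n} \<rightarrow>\<^sub>E \<Lambda> 0) \<times> ({1..m} \<rightarrow>\<^sub>E \<Lambda> 1)"

definition nth_index :: "nat \<Rightarrow> 'N::{finite,wellorder}" where
  "nth_index k = sorted_list_of_set UNIV ! k"

definition ycoord :: "nat \<Rightarrow> nat \<Rightarrow> nat \<Rightarrow> 'N::{finite,wellorder}" where
  "ycoord p i k = nth_index ((i - 1) * (p + 1) + k)"

definition tcoord :: "nat \<Rightarrow> nat \<Rightarrow> nat \<Rightarrow> nat \<Rightarrow> nat \<Rightarrow> 'N::{finite,wellorder}" where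
  "tcoord n p q i l = nth_index (n * (p + 1) + (i - 1) * q + (l - 1))"

text \<open>
  The point of the superspace with given real coordinates; for bases \<open>e\<close> and \<open>\<epsilon>\<close> this is a
  linear isomorphism from \<open>real ^ 'N\<close> onto \<open>superspace \<Lambda> n m\<close>.
\<close>

definition of_coords ::
  "nat \<Rightarrow> nat \<Rightarrow> nat \<Rightarrow> nat \<Rightarrow> (nat \<Rightarrow> 'a) \<Rightarrow> (nat \<Rightarrow> 'a) \<Rightarrow> real ^ 'N::{finite,wellorder} \<Rightarrow> 'a::real_vector spoint" where
  "of_coords n m p q e \<epsilon> u =
     ((\<lambda>i\<in>{1..n}. \<Sum>k=0..p. (u $ ycoord p i k) *\<^sub>R e k),
      (\<lambda>i\<in>{1..m}. \<Sum>l=1..q. (u $ tcoord n p q i l) *\<^sub>R \<epsilon> l))"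


section \<open>Differential forms with coefficients in an algebra\<close>

text \<open>
  An algebra-valued form at a point is the family of its coefficients: \<open>\<alpha> S\<close> is the coefficient
  of the wedge product, in increasing order, of the \<open>dx\<^sub>c\<close> with \<open>c \<in> S\<close>. Differentials of
  coordinates commute with coefficients.
\<close>

type_synonym ('N, 'a) form = "'N set \<Rightarrow> 'a"
type_synonym ('N, 'a) form_field = "real ^ 'N::finite \<Rightarrow> ('N, 'a) form"

definition basis_form :: "'N set \<Rightarrow> ('N, 'a::zero_neq_one) form" where
  "basis_form T = (\<lambda>S. if S = T then 1 else 0)"

abbreviation dx :: "'N \<Rightarrow> ('N, 'a::zero_neq_one) form" where
  "dx c \<equiv> basis_form {c}"

text \<open>The sign is that of the shuffle putting \<open>T\<close> followed by \<open>S - T\<close> in increasing order.\<close>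

definition wedge ::
  "('N::{finite,wellorder}, 'a::ring_1) form \<Rightarrow> ('N, 'a) form \<Rightarrow> ('N, 'a) form" where
  "wedge \<alpha> \<beta> = (\<lambda>S. \<Sum>T\<in>Pow S.
     (- 1) ^ card {(t, u). t \<in> T \<and> u \<in> S - T \<and> u < t} * \<alpha> T * \<beta> (S - T))"

definition partial ::
  "'N::finite \<Rightarrow> (real ^ 'N \<Rightarrow> 'b::real_normed_vector) \<Rightarrow> real ^ 'N \<Rightarrow> 'b" where
  "partial c h u = vector_derivative (\<lambda>t. h (u + t *\<^sub>R axis c 1)) (at 0)"

definition differential ::
  "(real ^ 'N::finite \<Rightarrow> real) \<Rightarrow> ('N, 'a::real_algebra_1) form_field" where
  "differential h u = (\<lambda>S. \<Sum>c\<in>UNIV. of_real (partial c h u) * dx c S)"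

text \<open>Pullback substitutes \<open>\<Gamma>\<close> in the coefficients and \<open>d(\<Gamma>\<^sub>c)\<close> for \<open>dx\<^sub>c\<close>.\<close>

definition pullback ::
  "(real ^ 'N::{finite,wellorder} \<Rightarrow> real ^ 'N::_) \<Rightarrow> ('N, 'a::real_algebra_1) form_field \<Rightarrow> ('N, 'a) form_field" where
  "pullback \<Gamma> \<omega> u = (\<lambda>S. \<Sum>T\<in>UNIV. \<omega> (\<Gamma> u) T *
     foldr wedge (map (\<lambda>c. differential (\<lambda>v. \<Gamma> v $ c) u) (sorted_list_of_set T)) (basis_form {}) S)"

definition mult_form ::
  "(real ^ 'N::finite \<Rightarrow> 'a) \<Rightarrow> ('N, 'a) form_field \<Rightarrow> ('N, 'a::times) form_field" where
  "mult_form F \<omega> = (\<lambda>u S. F u * \<omega> u S)"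

definition zero_form :: "(real ^ 'N::finite \<Rightarrow> 'a) \<Rightarrow> ('N, 'a::ring_1) form_field" where
  "zero_form F = mult_form F (\<lambda>_. basis_form {})"


section \<open>Domains with \<open>C\<^sup>1\<close> boundary and integration\<close>

definition C1 :: "(real ^ 'N::finite \<Rightarrow> real) \<Rightarrow> bool" where
  "C1 h \<longleftrightarrow> (\<exists>h'. (\<forall>u. (h has_derivative blinfun_apply (h' u)) (at u)) \<and> continuous_on UNIV h')"

text \<open>\<open>F\<close> is \<open>C\<^sup>1\<close> in the open set \<open>G\<close>, and \<open>F\<close> and \<open>dF\<close> are continuous on \<open>closure G\<close>.\<close>

definition C1_closure :: "'v::real_normed_vector set \<Rightarrow> ('v \<Rightarrow> 'a::real_normed_vector) \<Rightarrow> bool" where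
  "C1_closure G F \<longleftrightarrow> continuous_on (closure G) F \<and>
     (\<exists>F'. (\<forall>u\<in>G. (F has_derivative blinfun_apply (F' u)) (at u)) \<and> continuous_on (closure G) F')"

text \<open>
  Inside \<open>U\<close>, the set \<open>G\<close> is the part below (\<open>\<sigma> = 1\<close>) or above (\<open>\<sigma> = -1\<close>) the graph, over the
  other coordinates, of the coordinate \<open>j\<close> as a \<open>C\<^sup>1\<close> function \<open>g\<close>.
\<close>

definition graph_chart ::
  "(real ^ 'N::finite) set \<Rightarrow> (real ^ 'N) set \<Rightarrow> 'N \<Rightarrow> real \<Rightarrow> (real ^ 'N \<Rightarrow> real) \<Rightarrow> bool" where
  "graph_chart G U j \<sigma> g \<longleftrightarrow>
     open U \<and> \<sigma> \<in> {1, - 1} \<and> C1 g \<and>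
     (\<forall>u v. (\<forall>c. c \<noteq> j \<longrightarrow> u $ c = v $ c) \<longrightarrow> g u = g v) \<and>
     G \<inter> U = {u \<in> U. \<sigma> * (u $ j - g u) < 0}"

definition C1_boundary :: "(real ^ 'N::finite) set \<Rightarrow> bool" where
  "C1_boundary G \<longleftrightarrow> (\<forall>b\<in>frontier G. \<exists>U j \<sigma> g. b \<in> U \<and> graph_chart G U j \<sigma> g)"

definition graph_map :: "'N::finite \<Rightarrow> (real ^ 'N \<Rightarrow> real) \<Rightarrow> real ^ 'N \<Rightarrow> real ^ 'N" where
  "graph_map j g u = (\<chi> c. if c = j then g u else u $ c)"

text \<open>
  The parameters of a graph are the coordinates other than \<open>j\<close>, a point of \<open>\<real>\<^sup>N\<^sup>-\<^sup>1\<close> realised as a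
  function on \<open>- {j}\<close>; \<open>insert_zero\<close> completes it by \<open>0\<close>, a value on which \<open>graph_map\<close> does not
  depend.
\<close>

definition insert_zero :: "'N::finite \<Rightarrow> ('N \<Rightarrow> real) \<Rightarrow> real ^ 'N" where
  "insert_zero j t = (\<chi> c. if c = j then 0 else t c)"

text \<open>
  Boundary orientation (outward normal first): \<open>\<sigma> \<partial>/\<partial>x\<^sub>j\<close> points outward along the graph, and
  \<open>dx\<^sub>j \<and> (\<And>\<^bsub>c \<noteq> j\<^esub> dx\<^sub>c)\<close> is \<open>(-1)\<close> to the number of \<open>c < j\<close> times the volume form.
\<close>

definition graph_sign :: "'N::{finite,wellorder} \<Rightarrow> real \<Rightarrow> real" where
  "graph_sign j \<sigma> = \<sigma> * (- 1) ^ card {c. c < j}"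

definition graph_integrand ::
  "'N::{finite,wellorder} \<Rightarrow> (real ^ 'N::_ \<Rightarrow> real) \<Rightarrow> (real ^ 'N::_ \<Rightarrow> real) \<Rightarrow>
     ('N, 'a::{euclidean_space,real_algebra_1}) form_field \<Rightarrow> ('N \<Rightarrow> real) \<Rightarrow> 'a" where
  "graph_integrand j g \<rho> \<omega> t =
     \<rho> (graph_map j g (insert_zero j t)) *\<^sub>R pullback (graph_map j g) \<omega> (insert_zero j t) (- {j})"

text \<open>
  Integral over the oriented boundary of a form of degree \<open>CARD('N) - 1\<close>: by a finite family of
  oriented graph charts and a subordinate \<open>C\<^sup>1\<close> partition of unity on the boundary.
\<close>

definition has_boundary_integral ::
  "(real ^ 'N::{finite,wellorder}) set \<Rightarrow> ('N, 'a::{euclidean_space,real_algebra_1}) form_field \<Rightarrow> 'a \<Rightarrow> bool" where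
  "has_boundary_integral G \<omega> I \<longleftrightarrow>
     (\<exists>(M::nat) U j \<sigma> g \<rho>.
        (\<forall>i<M. graph_chart G (U i) (j i) (\<sigma> i) (g i) \<and>
               C1 (\<rho> i) \<and> (\<forall>u. 0 \<le> \<rho> i u) \<and>
               compact (closure {u. \<rho> i u \<noteq> 0}) \<and> closure {u. \<rho> i u \<noteq> 0} \<subseteq> U i \<and>
               integrable (\<Pi>\<^sub>M c\<in>- {j i}. lborel) (graph_integrand (j i) (g i) (\<rho> i) \<omega>)) \<and>
        (\<forall>u\<in>frontier G. (\<Sum>i<M. \<rho> i u) = 1) \<and>
        I = (\<Sum>i<M. graph_sign (j i) (\<sigma> i) *\<^sub>R
               (\<integral>t. graph_integrand (j i) (g i) (\<rho> i) \<omega> t \<partial>(\<Pi>\<^sub>M c\<in>- {j i}. lborel))))"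

text \<open>Integrability includes independence of the charts and of the partition of unity.\<close>

definition boundary_integrable ::
  "(real ^ 'N::{finite,wellorder}) set \<Rightarrow> ('N, 'a::{euclidean_space,real_algebra_1}) form_field \<Rightarrow> bool" where
  "boundary_integrable G \<omega> \<longleftrightarrow> (\<exists>!I. has_boundary_integral G \<omega> I)"

definition boundary_integral ::
  "(real ^ 'N::{finite,wellorder}) set \<Rightarrow> ('N, 'a::{euclidean_space,real_algebra_1}) form_field \<Rightarrow> 'a" where
  "boundary_integral G \<omega> = (THE I. has_boundary_integral G \<omega> I)"

definition domain_integrable ::
  "(real ^ 'N::finite) set \<Rightarrow> ('N, 'a::euclidean_space) form_field \<Rightarrow> bool" where
  "domain_integrable G \<eta> \<longleftrightarrow> set_integrable lborel G (\<lambda>u. \<eta> u UNIV)"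

definition domain_integral ::
  "(real ^ 'N::finite) set \<Rightarrow> ('N, 'a::euclidean_space) form_field \<Rightarrow> 'a" where
  "domain_integral G \<eta> = set_lebesgue_integral lborel G (\<lambda>u. \<eta> u UNIV)"


section \<open>The operator \<open>d''\<close> and the kernel\<close>

definition d'' ::
  "nat \<Rightarrow> nat \<Rightarrow> nat \<Rightarrow> nat \<Rightarrow> nat \<Rightarrow> (nat \<Rightarrow> 'a) \<Rightarrow> (nat \<Rightarrow> nat) \<Rightarrow> (nat \<Rightarrow> 'a) \<Rightarrow>
     ('N::{finite,wellorder}, 'a::{euclidean_space,real_algebra_1}) form_field \<Rightarrow> ('N, 'a) form_field" where
  "d'' n m p q r e s a \<omega> u = (\<lambda>S.
     (\<Sum>i=1..n. \<Sum>j=1..p.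
        wedge (dx (ycoord p i j))
          (\<lambda>T. partial (ycoord p i j) (\<lambda>v. \<omega> v T) u
               - e j * partial (ycoord p i 0) (\<lambda>v. \<omega> v T) u) S) +
     (\<Sum>i=1..m. \<Sum>k=1..r. \<Sum>t=s k + 1..<s (k + 1).
        wedge (dx (tcoord n p q i t))
          (\<lambda>T. partial (tcoord n p q i t) (\<lambda>v. \<omega> v T) u
               - a t * partial (tcoord n p q i (s k)) (\<lambda>v. \<omega> v T) u) S))"

definition dY :: "nat \<Rightarrow> (nat \<Rightarrow> 'a) \<Rightarrow> nat \<Rightarrow> ('N::{finite,wellorder}, 'a::ring_1) form" where
  "dY p e i = (\<lambda>S. \<Sum>k=0..p. e k * dx (ycoord p i k) S)"

definition dZ ::
  "nat \<Rightarrow> nat \<Rightarrow> nat \<Rightarrow> (nat \<Rightarrow> nat) \<Rightarrow> (nat \<Rightarrow> 'a) \<Rightarrow> nat \<Rightarrow> nat \<Rightarrow> ('N::{finite,wellorder}, 'a::ring_1) form" where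
  "dZ n p q s a k i = (\<lambda>S. \<Sum>l=s k..<s (k + 1). a l * dx (tcoord n p q i l) S)"

abbreviation omit2 :: "'N \<Rightarrow> 'N \<Rightarrow> ('N, 'a::zero_neq_one) form" where
  "omit2 c d \<equiv> basis_form (UNIV - {c, d})"

text \<open>
  In the odd part the sign is \<open>(-1)^(l - s k)\<close>: the exponent is the distance, in the order of
  the coordinates, between the two omitted ones, exactly as \<open>j\<close> is in the even part. It coincides
  with the sign \<open>(-1)^(l - 1)\<close> if and only if \<open>s k\<close> is odd. When \<open>s k\<close> is even (blocks of odd
  length), the latter would give the whole \<open>k\<close>-th block the wrong sign, and the
  integral of the kernel over a sphere around its pole would not be \<open>1\<close>.
\<close>

definition Omega ::
  "nat \<Rightarrow> nat \<Rightarrow> nat \<Rightarrow> nat \<Rightarrow> nat \<Rightarrow> (nat \<Rightarrow> 'a) \<Rightarrow> (nat \<Rightarrow> nat) \<Rightarrow> (nat \<Rightarrow> 'a) \<Rightarrow>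
     ('N::{finite,wellorder}, 'a::{euclidean_space,real_algebra_1}) form_field" where
  "Omega n m p q r e s a x = (\<lambda>S.
     (1 / (real CARD('N) * measure lborel (ball (0 :: real ^ 'N::_) 1) * norm x ^ CARD('N))) *\<^sub>R
     ((\<Sum>i=1..n. wedge (dY p e i)
         (\<lambda>T. \<Sum>j=1..p. (- 1) ^ j *
            ((x $ ycoord p i j) *\<^sub>R e 0 + (x $ ycoord p i 0) *\<^sub>R e j) *
            omit2 (ycoord p i 0) (ycoord p i j) T) S) +
      (\<Sum>i=1..m. \<Sum>k=1..r. wedge (dZ n p q s a k i)
         (\<lambda>T. \<Sum>l=s k + 1..<s (k + 1). (- 1) ^ (l - s k) *
            ((x $ tcoord n p q i l) *\<^sub>R e 0 + (x $ tcoord n p q i (s k)) *\<^sub>R a l) *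
            omit2 (tcoord n p q i (s k)) (tcoord n p q i l) T) S)))"

definition super_kernel ::
  "nat \<Rightarrow> nat \<Rightarrow> nat \<Rightarrow> nat \<Rightarrow> nat \<Rightarrow> (nat \<Rightarrow> 'a) \<Rightarrow> (nat \<Rightarrow> nat) \<Rightarrow> (nat \<Rightarrow> 'a) \<Rightarrow>
     real ^ 'N::{finite,wellorder} \<Rightarrow> ('N, 'a::{euclidean_space,real_algebra_1}) form_field" where
  "super_kernel n m p q r e s a x = pullback (\<lambda>u. u - x) (Omega n m p q r e s a)"

end

theory Submission
  imports Defs
begin

text \<open>
  In real coordinates the kernel is \<open>K(u, x) = \<Sum>\<^sub>c W\<^sub>c(u - x) / (N Vol \<parallel>u - x\<parallel>\<^sup>N) n\<^sub>c\<close>, where \<open>n\<^sub>c\<close> is the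
  contraction of the volume form with \<open>\<partial>/\<partial>x\<^sub>c\<close> and \<open>W(v) = v + A v\<close> with an antisymmetric matrix \<open>A\<close> over
  the even part. By antisymmetry \<open>\<Sum>\<^sub>c v\<^sub>c W\<^sub>c(v) = \<parallel>v\<parallel>\<^sup>2\<close> and \<open>\<partial>\<^sub>c W\<^sub>c = 1\<close>, so \<open>W / \<parallel>v\<parallel>\<^sup>N\<close> is divergence free
  with the flux of \<open>v / \<parallel>v\<parallel>\<^sup>N\<close>. Conditions \<open>(A\<^sub>0)\<close> and \<open>(A\<^sub>1)\<close> say exactly that the first component of
  \<open>W\<close> in each block is determined by the others in such a way that \<open>d''f \<and> K = df \<and> K\<close>. Replacing \<open>\<parallel>v\<parallel>\<close> by
  \<open>max \<parallel>v\<parallel> \<epsilon>\<close>, the divergence theorem applied to \<open>f W(u - x) / (N Vol max(\<parallel>u - x\<parallel>, \<epsilon>)\<^sup>N)\<close> yields the boundary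
  integral as the integral of \<open>df \<and> K\<close> (truncated) plus the mean of \<open>f\<close> over the ball of radius \<open>\<epsilon>\<close>
  around \<open>x\<close>; then \<open>\<epsilon>\<close> tends to \<open>0\<close>.

  The divergence theorem itself is proved in a graph chart by multiplying the field with a cutoff that
  vanishes near the graph: the cut field has compact support, so its divergence integrates to \<open>0\<close>,
  and the gradient of the cutoff concentrates on the graph. Since the integral of the divergence
  does not refer to charts, this also gives independence of the charts and of the partition of unity.
\<close>

section \<open>Lebesgue measure on \<open>real ^ 'N\<close> and one distinguished coordinate\<close>

text \<open>Cutting out a ball around the pole would add a sphere to the boundary, with charts of
  its own. Truncating the scale leaves the domain and its charts unchanged, and since the ball lies
  in the domain, truncated and true kernel agree on the boundary. The price is a field that is
  merely Lipschitz across one sphere. Hence all derivatives are taken along coordinate lines, and an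
  exceptional set is allowed that meets each such line in finitely many points; continuity carries
  the fundamental theorem of calculus through these points. At the boundary itself
  \<open>C1_closure\<close> provides continuity but no derivative, so fields are cut off before they
  are differentiated there. \<open>boundary_integrable\<close> asks for a unique value, so every
  admissible family must give the same number, including partitions that sum to 1 on the frontier
  but nowhere near it. An auxiliary partition with sum 1 on a neighbourhood mediates between them.
  The norm of the algebra is unrelated to its product; estimates of products use the constant of the
  bounded bilinear map instead.\<close>

interpretation lborel_product: product_sigma_finite "\<lambda>_::'N::finite. lborel :: real measure"
  by standard

lemma borel_measurable_vec:
  fixes f :: "'c \<Rightarrow> real ^ 'N::finite"
  assumes "\<And>i. (\<lambda>w. f w $ i) \<in> borel_measurable M"
  shows "f \<in> borel_measurable M"
  using assms by (subst borel_measurable_euclidean_space) (auto simp: Basis_vec_def inner_axis)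

lemma has_vector_derivative_shift_0:
  "((\<lambda>h. f (y + h)) has_vector_derivative D) (at 0) \<longleftrightarrow> (f has_vector_derivative D) (at (y::real))"
proof
  assume "((\<lambda>h. f (y + h)) has_vector_derivative D) (at 0)"
  then have "(((\<lambda>h. f (y + h)) \<circ> (\<lambda>h. h - y)) has_vector_derivative 1 *\<^sub>R D) (at y)"
    by (intro vector_diff_chain_at) (auto intro!: derivative_eq_intros)
  then show "(f has_vector_derivative D) (at y)" by (simp add: o_def)
next
  assume "(f has_vector_derivative D) (at y)"
  then have "((f \<circ> (\<lambda>h. y + h)) has_vector_derivative 1 *\<^sub>R D) (at 0)"
    by (intro vector_diff_chain_at) (auto intro!: derivative_eq_intros)
  then show "((\<lambda>h. f (y + h)) has_vector_derivative D) (at 0)" by (simp add: o_def)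
qed

text \<open>Lebesgue measure is determined by its values on boxes, and on a box the product measure
  also gives the product of the side lengths.\<close>

lemma lborel_vec_conv_PiM:
  "(lborel :: (real ^ 'N::finite) measure) = distr (\<Pi>\<^sub>M i\<in>UNIV. lborel) borel vec_lambda"
proof (rule lborel_eqI)
  have meas: "vec_lambda \<in> (\<Pi>\<^sub>M i\<in>(UNIV::'N set). lborel) \<rightarrow>\<^sub>M (borel :: (real^'N) measure)"
    by (rule borel_measurable_vec) auto
  fix l u :: "real^'N" assume lu: "\<And>b. b \<in> Basis \<Longrightarrow> l \<bullet> b \<le> u \<bullet> b"
  have le: "l $ i \<le> u $ i" for i
    using lu[of "axis i 1"] by (simp add: axis_in_Basis_iff inner_axis)
  have "emeasure (distr (\<Pi>\<^sub>M i\<in>UNIV. lborel) borel vec_lambda) (box l u) =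
      emeasure (\<Pi>\<^sub>M i\<in>(UNIV::'N set). lborel) (\<Pi>\<^sub>E i\<in>UNIV. {l$i<..<u$i})"
    by (subst emeasure_distr[OF meas])
      (auto intro!: arg_cong2[where f=emeasure] simp: space_PiM mem_box_cart PiE_iff)
  also have "\<dots> = (\<Prod>i\<in>UNIV. ennreal (u$i - l$i))"
    by (subst lborel_product.emeasure_PiM) (use le in \<open>auto\<close>)
  also have "\<dots> = ennreal (\<Prod>i\<in>UNIV. u$i - l$i)"
    by (rule prod_ennreal) (use le in auto)
  also have "(\<Prod>i\<in>UNIV. u$i - l$i) = (\<Prod>b\<in>Basis. (u - l) \<bullet> b)"
  proof -
    have "Basis = (\<lambda>i. axis i 1 :: real^'N) ` UNIV" by (auto simp: Basis_vec_def)
    moreover have "inj (\<lambda>i. axis i 1 :: real^'N)" by (auto simp: inj_on_def axis_eq_axis)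
    ultimately have "(\<Prod>b\<in>Basis. (u - l) \<bullet> b) = (\<Prod>i\<in>UNIV. (u - l) \<bullet> axis i 1)"
      by (metis (no_types, lifting) prod.reindex_cong)
    then show ?thesis by (simp add: inner_axis)
  qed
  finally show "emeasure (distr (\<Pi>\<^sub>M i\<in>UNIV. lborel) borel vec_lambda) (box l u) =
    ennreal (\<Prod>b\<in>Basis. (u - l) \<bullet> b)" .
qed auto

definition insert_coord :: "'N::finite \<Rightarrow> ('N \<Rightarrow> real) \<Rightarrow> real \<Rightarrow> real ^ 'N" where
  "insert_coord j t y = (\<chi> c. if c = j then y else t c)"

lemma insert_coord_nth: "insert_coord j t y $ c = (if c = j then y else t c)"
  by (simp add: insert_coord_def)

lemma insert_coord_shift: "insert_coord j t y + h *\<^sub>R axis j 1 = insert_coord j t (y + h)"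
  by (simp add: insert_coord_def vec_eq_iff axis_def)

lemma continuous_insert_coord: "continuous_on UNIV (insert_coord j t)"
proof -
  have "insert_coord j t = (\<lambda>y. insert_coord j t 0 + y *\<^sub>R axis j 1)"
    by (rule ext) (simp only: insert_coord_shift add_0)
  moreover have "continuous_on UNIV (\<lambda>y. insert_coord j t 0 + y *\<^sub>R axis j 1)"
    by (intro continuous_intros)
  ultimately show ?thesis by (simp only:)
qed

lemma measurable_insert_coord:
  "(\<lambda>(t, y). insert_coord j t y) \<in> (\<Pi>\<^sub>M c\<in>-{j}. lborel) \<Otimes>\<^sub>M lborel \<rightarrow>\<^sub>M (borel :: (real^'N::finite) measure)"
proof (rule borel_measurable_vec)
  fix i
  show "(\<lambda>w. (case w of (t, y) \<Rightarrow> insert_coord j t y) $ i) \<in> borel_measurable ((\<Pi>\<^sub>M c\<in>-{j}. lborel) \<Otimes>\<^sub>M lborel)"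
  proof (cases "i = j")
    case False
    then have "(\<lambda>t. t i) \<in> (\<Pi>\<^sub>M c\<in>-{j}. lborel) \<rightarrow>\<^sub>M (lborel :: real measure)"
      by (intro measurable_component_singleton) auto
    then show ?thesis using False by (simp add: split_beta insert_coord_nth)
  qed (simp add: split_beta insert_coord_nth)
qed

lemma measurable_insert_coord' [measurable (raw)]:
  assumes "g \<in> M \<rightarrow>\<^sub>M (\<Pi>\<^sub>M c\<in>-{j}. lborel)" "h \<in> M \<rightarrow>\<^sub>M borel"
  shows "(\<lambda>w. insert_coord j (g w) (h w)) \<in> M \<rightarrow>\<^sub>M (borel :: (real^'N::finite) measure)"
proof -
  have "(\<lambda>w. (g w, h w)) \<in> M \<rightarrow>\<^sub>M (\<Pi>\<^sub>M c\<in>-{j}. lborel) \<Otimes>\<^sub>M lborel"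
    using assms by simp
  from measurable_compose[OF this measurable_insert_coord] show ?thesis by simp
qed

text \<open>Fubini with the coordinate \<open>j\<close> innermost. Writing the index set as
  \<open>insert j (-{j})\<close> makes the one-coordinate splitting of product measures
  applicable.\<close>

lemma integral_insert_coord:
  fixes f :: "real ^ 'N::finite \<Rightarrow> 'b::euclidean_space"
  assumes f: "integrable lborel f"
  shows "integral\<^sup>L lborel f =
    (\<integral>t. (\<integral>y. f (insert_coord j t y) \<partial>lborel) \<partial>(\<Pi>\<^sub>M c\<in>-{j}. lborel))"
proof -
  have meas: "vec_lambda \<in> (\<Pi>\<^sub>M i\<in>(UNIV::'N set). lborel) \<rightarrow>\<^sub>M (borel :: (real^'N) measure)"
    by (rule borel_measurable_vec) auto
  have fm: "f \<in> borel_measurable borel" using f by auto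
  have ins: "insert j (-{j}) = UNIV" by auto
  have int: "integrable (\<Pi>\<^sub>M i\<in>insert j (-{j}). lborel) (\<lambda>t. f (vec_lambda t))"
    using f unfolding ins by (subst (asm) lborel_vec_conv_PiM) (simp add: integrable_distr_eq[OF meas fm])
  have "integral\<^sup>L lborel f = (\<integral>t. f (vec_lambda t) \<partial>(\<Pi>\<^sub>M i\<in>insert j (-{j}). lborel))"
    unfolding ins by (subst lborel_vec_conv_PiM) (simp add: integral_distr[OF meas fm])
  also have "\<dots> = (\<integral>t. (\<integral>y. f (vec_lambda (t(j := y))) \<partial>lborel) \<partial>(\<Pi>\<^sub>M c\<in>-{j}. lborel))"
    by (rule lborel_product.product_integral_insert[OF _ _ int]) auto
  also have "\<dots> = (\<integral>t. (\<integral>y. f (insert_coord j t y) \<partial>lborel) \<partial>(\<Pi>\<^sub>M c\<in>-{j}. lborel))"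
    unfolding insert_coord_def fun_upd_def ..
  finally show ?thesis .
qed

section \<open>Integrability of bounded functions on bounded sets\<close>

lemma integrable_PiM_box:
  "integrable (\<Pi>\<^sub>M c\<in>I. lborel) (\<lambda>t. indicator (\<Pi>\<^sub>E c\<in>(I::'N::finite set). {-R..R::real}) t * (C::real))"
proof -
  let ?B = "\<Pi>\<^sub>E c\<in>I. {-R..R::real}"
  have B: "?B \<in> sets (\<Pi>\<^sub>M c\<in>I. (lborel :: real measure))"
    by (rule sets_PiM_I_finite) auto
  have "emeasure (\<Pi>\<^sub>M c\<in>I. (lborel :: real measure)) ?B < \<infinity>"
  proof (subst lborel_product.emeasure_PiM)
    \<comment> \<open>For negative \<open>R\<close> the interval is empty, whence the
      \<open>max\<close>.\<close>
    have "emeasure lborel {-R..R} = ennreal (max 0 (2 * R))"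
      by (auto simp: emeasure_lborel_Icc_eq max_def)
    then show "(\<Prod>c\<in>I. emeasure lborel {-R..R}) < \<infinity>" by (simp add: ennreal_power)
  qed auto
  then show ?thesis using B by (intro integrable_mult_left) auto
qed

lemma integrable_lborel_bounded:
  fixes f :: "'c::euclidean_space \<Rightarrow> 'b::{banach,second_countable_topology}"
  assumes f: "f \<in> borel_measurable borel"
    and bnd: "\<And>u. norm (f u) \<le> C"
    and supp: "\<And>u. f u \<noteq> 0 \<Longrightarrow> u \<in> S" and S: "bounded S"
  shows "integrable lborel f"
proof -
  obtain R where R: "S \<subseteq> cball 0 R" using bounded_subset_ballD[OF S] ball_subset_cball by (metis order_trans)
  have "integrable lborel (\<lambda>u. indicator (cball 0 R :: 'c set) u *\<^sub>R C)"
    using emeasure_compact_finite[of "cball 0 R :: 'c set"]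
    by (intro integrable_scaleR_left) auto
  then show ?thesis
  proof (rule Bochner_Integration.integrable_bound)
    show "AE u in lborel. norm (f u) \<le> norm (indicator (cball 0 R) u *\<^sub>R C)"
    proof (rule AE_I2)
      fix u show "norm (f u) \<le> norm (indicator (cball 0 R) u *\<^sub>R C)"
      proof (cases "f u = 0")
        case False
        then have "u \<in> cball 0 R" using supp R by blast
        then show ?thesis using bnd[of u] by (auto simp: abs_if)
      qed simp
    qed
  qed (use f in auto)
qed

text \<open>The exceptional set will be a sphere, across which a field is only Lipschitz.\<close>

lemma integral_partial_compact_support:
  fixes f f' :: "real ^ 'N::finite \<Rightarrow> 'b::euclidean_space"
  assumes cont: "continuous_on UNIV f"
    and f': "f' \<in> borel_measurable borel"
    and bnd: "\<And>u. norm (f' u) \<le> C"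
    and supp: "\<And>u. u \<notin> S \<Longrightarrow> f u = 0 \<and> f' u = 0" and S: "bounded S"
    and E: "\<And>u. finite {t. u + t *\<^sub>R axis c 1 \<in> E}"
    and deriv: "\<And>u. u \<notin> E \<Longrightarrow> ((\<lambda>t. f (u + t *\<^sub>R axis c 1)) has_vector_derivative f' u) (at 0)"
  shows "integral\<^sup>L lborel f' = 0"
proof -
  obtain R where R: "S \<subseteq> cball 0 R" "R > 0"
    using bounded_subset_ballD[OF S, of 0] ball_subset_cball by (metis order_trans)
  have int: "integrable lborel f'"
    by (rule integrable_lborel_bounded[OF f' bnd _ S]) (use supp in auto)
  have "(\<integral>y. f' (insert_coord c t y) \<partial>lborel) = 0" for t
  proof -
    let ?i = "insert_coord c t"
    have im: "?i \<in> borel_measurable borel"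
      using continuous_insert_coord by (rule borel_measurable_continuous_onI)
    have out: "f (?i y) = 0 \<and> f' (?i y) = 0" if "\<bar>y\<bar> > R" for y
    proof -
      have "norm (?i y) \<ge> \<bar>y\<bar>"
        using component_le_norm_cart[of "?i y" c] by (simp add: insert_coord_nth)
      then have "?i y \<notin> S" using that R by auto
      then show ?thesis using supp by blast
    qed
    have "integrable lborel (\<lambda>y. f' (?i y))"
    proof (rule integrable_lborel_bounded[OF measurable_compose[OF im f'] bnd])
      show "y \<in> {-R..R}" if "f' (?i y) \<noteq> 0" for y
        using out[of y] that by (cases "\<bar>y\<bar> > R") auto
    qed simp
    then have 1: "((\<lambda>y. f' (?i y)) has_integral (\<integral>y. f' (?i y) \<partial>lborel)) UNIV"
      by (rule has_integral_integral_lborel)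
    have fin: "finite {y. ?i y \<in> E}"
      using E[of "?i 0"] by (simp add: insert_coord_shift)
    \<comment> \<open>One unit of slack on either side puts the endpoints outside the support, so
      both boundary values vanish.\<close>
    have "((\<lambda>y. f' (?i y)) has_integral (f (?i (R+1)) - f (?i (-R-1)))) {-R-1..R+1}"
    proof (rule fundamental_theorem_of_calculus_interior_strong[OF fin])
      show "continuous_on {-R-1..R+1} (\<lambda>y. f (?i y))"
        by (rule continuous_on_compose2[OF cont continuous_on_subset[OF continuous_insert_coord]]) auto
      fix y assume "y \<in> {-R-1<..<R+1} - {y. ?i y \<in> E}"
      then have "((\<lambda>h. f (?i (y + h))) has_vector_derivative f' (?i y)) (at 0)"
        using deriv[of "?i y"] by (simp add: insert_coord_shift)
      then show "((\<lambda>h. f (?i h)) has_vector_derivative f' (?i y)) (at y)"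
        by (simp add: has_vector_derivative_shift_0[of "\<lambda>h. f (?i h)"])
    qed (use R in auto)
    then have "((\<lambda>y. f' (?i y)) has_integral 0) {-R-1..R+1}"
      using out[of "R+1"] out[of "-R-1"] R by simp
    then have "((\<lambda>y. f' (?i y)) has_integral 0) UNIV"
    proof (rule has_integral_on_superset)
      show "f' (?i y) = 0" if "y \<notin> {-R-1..R+1}" for y
      proof -
        have "\<bar>y\<bar> > R" using that by auto
        then show ?thesis using out by blast
      qed
    qed auto
    with 1 show ?thesis by (rule has_integral_unique)
  qed
  then show ?thesis using integral_insert_coord[OF int, of c] by simp
qed

section \<open>\<open>C\<^sup>1\<close> functions and cutoffs\<close>

lemma has_derivative_imp_line_derivative:
  assumes "(F has_derivative F') (at u)"
  shows "((\<lambda>t. F (u + t *\<^sub>R a)) has_vector_derivative F' a) (at 0)"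
proof -
  have lin: "((\<lambda>t. u + t *\<^sub>R a) has_derivative (\<lambda>t. t *\<^sub>R a)) (at 0)"
    by (auto intro!: derivative_eq_intros)
  have "((\<lambda>t. F (u + t *\<^sub>R a)) has_derivative (\<lambda>t. F' (t *\<^sub>R a))) (at 0)"
    using has_derivative_compose[OF lin, of F F'] assms by simp
  then show ?thesis
    unfolding has_vector_derivative_def
    using linear_scale[OF has_derivative_linear[OF assms]] by simp
qed

lemma has_derivative_imp_partial:
  "(F has_derivative F') (at u) \<Longrightarrow> partial c F u = F' (axis c 1)"
  unfolding partial_def by (intro vector_derivative_at has_derivative_imp_line_derivative)

lemma C1_partial:
  assumes "C1 h"
  shows C1_imp_continuous: "continuous_on UNIV h"
    and C1_imp_continuous_partial: "continuous_on UNIV (partial c h)"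
    and C1_imp_line_derivative:
      "((\<lambda>t. h (u + t *\<^sub>R axis c 1)) has_vector_derivative partial c h u) (at 0)"
    and C1_imp_line_real_derivative:
      "((\<lambda>t. h (u + t *\<^sub>R axis c 1)) has_real_derivative partial c h u) (at 0)"
proof -
  obtain h' where "(\<forall>u. (h has_derivative blinfun_apply (h' u)) (at u)) \<and> continuous_on UNIV h'"
    using assms unfolding C1_def ..
  then have h': "\<And>u. (h has_derivative blinfun_apply (h' u)) (at u)" "continuous_on UNIV h'"
    by simp_all
  show "continuous_on UNIV h"
    by (intro continuous_at_imp_continuous_on ballI has_derivative_continuous[OF h'(1)])
  have p: "partial c h = (\<lambda>u. blinfun_apply (h' u) (axis c 1))"
    using has_derivative_imp_partial[OF h'(1)] by auto
  show "continuous_on UNIV (partial c h)"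
    unfolding p by (rule bounded_linear.continuous_on[OF blinfun.bounded_linear_left h'(2)])
  show 1: "((\<lambda>t. h (u + t *\<^sub>R axis c 1)) has_vector_derivative partial c h u) (at 0)"
    unfolding p by (rule has_derivative_imp_line_derivative[OF h'(1)])
  then show "((\<lambda>t. h (u + t *\<^sub>R axis c 1)) has_real_derivative partial c h u) (at 0)"
    by (simp add: has_real_derivative_iff_has_vector_derivative)
qed

text \<open>\<open>C1\<close> asks for a continuous map into the space of bounded linear
  functionals; representing functionals by gradients reduces this to the continuity of a vector
  field.\<close>

lemma C1_gradientI:
  assumes "\<And>u. (h has_derivative (\<lambda>v. D u \<bullet> v)) (at u)" "continuous_on UNIV D"
  shows "C1 h"
  unfolding C1_def
proof (intro exI conjI allI)
  show "(h has_derivative blinfun_apply (blinfun_inner_left (D u))) (at u)" for u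
    using assms(1)[of u] by (simp add: inner_commute)
  show "continuous_on UNIV (\<lambda>u. blinfun_inner_left (D u))"
    by (rule bounded_linear.continuous_on[OF bounded_linear_blinfun_inner_left assms(2)])
qed

lemma partial_eq_0_of_indep:
  assumes "\<And>u v. (\<And>c. c \<noteq> j \<Longrightarrow> u $ c = v $ c) \<Longrightarrow> g u = g v"
  shows "partial j g u = 0"
proof -
  have "(\<lambda>t. g (u + t *\<^sub>R axis j 1)) = (\<lambda>t. g u)"
    by (rule ext, rule assms) (auto simp: axis_def)
  then show ?thesis unfolding partial_def by simp
qed

section \<open>A piecewise quadratic cutoff\<close>

definition pos_square :: "real \<Rightarrow> real" where
  "pos_square s = (max 0 s)\<^sup>2"

lemma has_derivative_pos_square: "(pos_square has_real_derivative 2 * max 0 s) (at s)"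
proof (cases s "0::real" rule: linorder_cases)
  case less
  have "((\<lambda>s. 0) has_real_derivative 2 * max 0 s) (at s)" using less by (simp add: max_def)
  then show ?thesis
    by (rule DERIV_cong_ev[THEN iffD1, OF refl _ refl, rotated])
      (use less in \<open>auto simp: pos_square_def max_def eventually_nhds intro!: exI[of _ "{..<0}"]\<close>)
next
  case greater
  have "((\<lambda>s. s\<^sup>2) has_real_derivative 2 * max 0 s) (at s)"
    using greater by (auto intro!: derivative_eq_intros simp: max_def)
  then show ?thesis
    by (rule DERIV_cong_ev[THEN iffD1, OF refl _ refl, rotated])
      (use greater in \<open>auto simp: pos_square_def max_def eventually_nhds intro!: exI[of _ "{0<..}"]\<close>)
next
  case equal
  have "((\<lambda>h. pos_square h / h) \<longlongrightarrow> 0) (at 0)"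
  proof (rule Lim_null_comparison)
    show "\<forall>\<^sub>F h in at 0. norm (pos_square h / h) \<le> \<bar>h\<bar>"
      by (rule eventually_at_ball'[of 1, THEN eventually_mono])
        (auto simp: pos_square_def max_def power2_eq_square)
    show "((\<lambda>h::real. \<bar>h\<bar>) \<longlongrightarrow> 0) (at 0)"
      by (rule tendsto_rabs_zero[OF tendsto_ident_at])
  qed
  then show ?thesis using equal by (simp add: has_field_derivative_iff pos_square_def)
qed

text \<open>Half the second difference of \<open>pos_square\<close>. Its derivative is the hat
  function \<open>tent\<close> supported in [1, 3], so it climbs from 0 to 1 in a C1 way between 1
  and 3. It starts to grow at 1 and not at 0, so that a field cut off at a small scale vanishes on a
  whole neighbourhood of the graph.\<close>

definition cutoff :: "real \<Rightarrow> real" where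
  "cutoff s = (pos_square (s - 1) - 2 * pos_square (s - 2) + pos_square (s - 3)) / 2"

definition tent :: "real \<Rightarrow> real" where
  "tent s = max 0 (s - 1) - 2 * max 0 (s - 2) + max 0 (s - 3)"

lemma DERIV_cutoff: "(cutoff has_real_derivative tent s) (at s)"
  unfolding cutoff_def[abs_def] tent_def
  by (rule derivative_eq_intros DERIV_chain2[OF has_derivative_pos_square] refl | simp)+

lemma cutoff_eq_0: "s \<le> 1 \<Longrightarrow> cutoff s = 0"
  by (simp add: cutoff_def pos_square_def max_def)

lemma cutoff_eq_1: "s \<ge> 3 \<Longrightarrow> cutoff s = 1"
  by (simp add: cutoff_def pos_square_def max_def) (simp add: power2_eq_square algebra_simps)

lemma continuous_tent: "continuous_on UNIV tent"
  unfolding tent_def[abs_def] by (intro continuous_intros)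

lemma continuous_cutoff: "continuous_on UNIV cutoff"
  by (intro continuous_at_imp_continuous_on ballI DERIV_isCont[OF DERIV_cutoff])

lemma tent_bounds: "0 \<le> tent s" "tent s \<le> 1" "tent s \<noteq> 0 \<Longrightarrow> 1 < s \<and> s < 3"
  by (auto simp: tent_def max_def split: if_splits)

lemma cutoff_bounds: "0 \<le> cutoff s" "cutoff s \<le> 1"
proof -
  have mono: "cutoff a \<le> cutoff b" if "a \<le> b" for a b
    by (rule DERIV_nonneg_imp_nondecreasing[OF that]) (use DERIV_cutoff tent_bounds in blast)
  show "0 \<le> cutoff s" using mono[of "min s 1" s] cutoff_eq_0[of "min s 1"] by auto
  show "cutoff s \<le> 1" using mono[of s "max s 3"] cutoff_eq_1[of "max s 3"] by auto
qed

text \<open>The unit mass of the hat is the reason why the gradient of the cutoff reproduces the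
  flux through the graph without a constant factor.\<close>

lemma integral_tent:
  shows integrable_tent: "integrable lborel tent" and "integral\<^sup>L lborel tent = 1"
proof -
  show int: "integrable lborel tent"
    by (rule integrable_lborel_bounded[of _ 1 "{1..3}"])
      (use continuous_tent tent_bounds in \<open>auto intro: borel_measurable_continuous_onI simp: less_imp_le\<close>)
  have "(tent has_integral (cutoff 4 - cutoff 0)) {0..4}"
    by (rule fundamental_theorem_of_calculus)
      (use DERIV_cutoff in \<open>auto simp: has_real_derivative_iff_has_vector_derivative
        intro: has_vector_derivative_at_within\<close>)
  then have "(tent has_integral 1) UNIV"
    by (simp add: cutoff_eq_0 cutoff_eq_1, elim has_integral_on_superset)
      (use tent_bounds in \<open>fastforce+\<close>)
  then show "integral\<^sup>L lborel tent = 1"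
    using has_integral_unique has_integral_integral_lborel[OF int] by blast
qed

section \<open>The divergence theorem in a graph chart\<close>

text \<open>The divergence theorem is proved for pairs of this kind. \<open>w' c\<close> is the
  derivative of \<open>w c\<close> in the direction \<open>c\<close> only, inside \<open>G\<close>
  and off \<open>E\<close>; it is required to be bounded and measurable rather than continuous,
  since the fields with truncated scale have derivatives that jump across a sphere.\<close>

definition stokes_field ::
  "(real ^ 'N::finite) set \<Rightarrow> (real ^ 'N) set \<Rightarrow> ('N \<Rightarrow> real ^ 'N \<Rightarrow> 'b::euclidean_space) \<Rightarrow>
     ('N \<Rightarrow> real ^ 'N \<Rightarrow> 'b) \<Rightarrow> bool" where
  "stokes_field G E w w' \<longleftrightarrow> (\<forall>c. continuous_on (closure G) (w c) \<and>
     (\<lambda>u. indicator G u *\<^sub>R w' c u) \<in> borel_measurable borel \<and> bounded (w' c ` G) \<and>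
     (\<forall>u. finite {t. u + t *\<^sub>R axis c 1 \<in> E}) \<and>
     (\<forall>u\<in>G - E. ((\<lambda>t. w c (u + t *\<^sub>R axis c 1)) has_vector_derivative w' c u) (at 0)))"

lemma insert_zero_eq: "insert_zero j t = insert_coord j t 0"
  by (simp add: insert_zero_def insert_coord_def)

lemma graph_map_insert_zero:
  "graph_map j g (insert_zero j t) = insert_coord j t (g (insert_zero j t))"
  by (simp add: graph_map_def insert_zero_def insert_coord_def vec_eq_iff)

lemma locally_zero_line:
  fixes f :: "real ^ 'N::finite \<Rightarrow> 'b::real_normed_vector"
  assumes "open N" "u \<in> N" "\<And>v. v \<in> N \<Longrightarrow> f v = 0"
  shows "isCont f u" "((\<lambda>t. f (u + t *\<^sub>R a)) has_vector_derivative 0) (at 0)"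
proof -
  have "continuous_on N f" using assms(3) by (simp add: continuous_on_cong)
  then show "isCont f u" using assms(1,2) continuous_on_eq_continuous_at by blast
  have "open ((\<lambda>t. u + t *\<^sub>R a) -` N)"
    by (rule continuous_open_vimage[rotated]) (use assms in \<open>auto intro!: continuous_intros\<close>)
  then show "((\<lambda>t. f (u + t *\<^sub>R a)) has_vector_derivative 0) (at 0)"
    by (rule has_vector_derivative_transform_within_open[OF has_vector_derivative_const, of _ _ 0])
      (use assms in auto)
qed

lemma has_vector_derivative_line_cong:
  fixes f g :: "'c::real_normed_vector \<Rightarrow> 'd::real_normed_vector"
  assumes "((\<lambda>t. f (u + t *\<^sub>R a)) has_vector_derivative D) (at 0)"
    and "open N" "u \<in> N" "\<And>v. v \<in> N \<Longrightarrow> f v = g v"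
  shows "((\<lambda>t. g (u + t *\<^sub>R a)) has_vector_derivative D) (at (0::real))"
proof -
  have "open ((\<lambda>t. u + t *\<^sub>R a) -` N)"
    by (rule continuous_open_vimage[rotated]) (use assms in \<open>auto intro!: continuous_intros\<close>)
  from has_vector_derivative_transform_within_open[OF assms(1) this] show ?thesis
    using assms by auto
qed

text \<open>\<open>K\<close> is a closed set inside the chart that carries the field. Points outside
  \<open>U\<close> have the neighbourhood \<open>- K\<close>, on which the field vanishes, so the
  shape of \<open>G\<close> has to be known only in \<open>U\<close>.\<close>

locale chart_field =
  fixes G U :: "(real ^ 'N::finite) set" and j :: 'N and \<sigma> :: real and g :: "real ^ 'N \<Rightarrow> real"
    and E K :: "(real ^ 'N) set" and h h' :: "'N \<Rightarrow> real ^ 'N \<Rightarrow> 'b::euclidean_space"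
  assumes G: "open G" "bounded G" and chart: "graph_chart G U j \<sigma> g"
    and field: "stokes_field G E h h'"
    and K: "closed K" "K \<subseteq> U"
    and supp: "\<And>c u. u \<notin> K \<Longrightarrow> h c u = 0" "\<And>c u. u \<in> G - K \<Longrightarrow> h' c u = 0"
begin

lemma U: "open U" and \<sigma>: "\<sigma> = 1 \<or> \<sigma> = -1" and g: "C1 g"
  and g_indep: "\<And>u v. (\<And>c. c \<noteq> j \<Longrightarrow> u $ c = v $ c) \<Longrightarrow> g u = g v"
  and GU: "u \<in> U \<Longrightarrow> u \<in> G \<longleftrightarrow> 0 < \<sigma> * (g u - u $ j)"
  using chart unfolding graph_chart_def by (auto simp: algebra_simps)

lemma \<sigma>_square: "\<sigma> * \<sigma> = 1" "\<bar>\<sigma>\<bar> = 1"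
  using \<sigma> by auto

lemma h_cont: "continuous_on (closure G) (h c)"
  and h'_meas: "(\<lambda>u. indicator G u *\<^sub>R h' c u) \<in> borel_measurable borel"
  and h'_bounded: "bounded (h' c ` G)"
  and E_finite: "finite {t. u + t *\<^sub>R axis c 1 \<in> E}"
  and h_deriv: "u \<in> G - E \<Longrightarrow> ((\<lambda>t. h c (u + t *\<^sub>R axis c 1)) has_vector_derivative h' c u) (at 0)"
  using field unfolding stokes_field_def by blast+

lemma compact_closure_G: "compact (closure G)"
  using G by (simp add: compact_closure)

lemma uniform_bound:
  obtains B where "B \<ge> 0" "\<And>c u. u \<in> closure G \<Longrightarrow> norm (h c u) \<le> B"
    "\<And>c u. u \<in> G \<Longrightarrow> norm (h' c u) \<le> B" "\<And>c u. u \<in> closure G \<Longrightarrow> \<bar>partial c g u\<bar> \<le> B"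
proof -
  have "bounded (\<Union>c. h c ` closure G)"
    by (intro bounded_UN) (auto intro!: compact_imp_bounded compact_continuous_image h_cont compact_closure_G)
  moreover have "bounded (\<Union>c. h' c ` G)"
    by (intro bounded_UN) (auto intro: h'_bounded)
  moreover have "bounded (\<Union>c. partial c g ` closure G)"
    by (intro bounded_UN) (auto intro!: compact_imp_bounded compact_continuous_image compact_closure_G
        continuous_on_subset[OF C1_imp_continuous_partial[OF g]])
  ultimately obtain B1 B2 B3 where
    "\<forall>x\<in>(\<Union>c. h c ` closure G). norm x \<le> B1" "\<forall>x\<in>(\<Union>c. h' c ` G). norm x \<le> B2"
    "\<forall>x\<in>(\<Union>c. partial c g ` closure G). norm x \<le> B3"
    unfolding bounded_iff by metis
  then show ?thesis
    by (intro that[of "max 0 (max B1 (max B2 B3))"]) (fastforce simp: le_max_iff_disj)+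
qed

text \<open>Positive exactly on \<open>G\<close> within \<open>U\<close>. It measures the distance
  to the graph along the coordinate \<open>j\<close>, not the Euclidean one, so it is affine on the
  lines over which Fubini integrates.\<close>

definition depth :: "real ^ 'N \<Rightarrow> real" where
  "depth u = \<sigma> * (g u - u $ j)"

text \<open>The field paired with the outward normal \<sigma> (e_j - grad g) of the graph. The
  normal is left unnormalised: its length is the area density over the parameters, so no square root
  appears.\<close>

definition flux :: "real ^ 'N \<Rightarrow> 'b" where
  "flux u = \<sigma> *\<^sub>R (h j u - (\<Sum>c\<in>-{j}. partial c g u *\<^sub>R h c u))"

lemma continuous_depth: "continuous_on UNIV depth"
  unfolding depth_def[abs_def] by (intro continuous_intros C1_imp_continuous g)

lemma depth_line:
  "((\<lambda>t. depth (u + t *\<^sub>R axis c 1)) has_real_derivative \<sigma> * (partial c g u - of_bool (c = j))) (at 0)"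
proof -
  have "(\<lambda>t. (u + t *\<^sub>R axis c 1) $ j) = (\<lambda>t. u $ j + t * of_bool (c = j))"
    by (auto simp: axis_def fun_eq_iff)
  then have "((\<lambda>t. (u + t *\<^sub>R axis c 1) $ j) has_real_derivative of_bool (c = j)) (at 0)"
    by (auto intro!: derivative_eq_intros)
  from DERIV_cmult[OF DERIV_diff[OF C1_imp_line_real_derivative[OF g] this]] show ?thesis
    unfolding depth_def .
qed

section \<open>The field cut off near the graph\<close>

definition cut_field :: "real \<Rightarrow> 'N \<Rightarrow> real ^ 'N \<Rightarrow> 'b" where
  "cut_field \<delta> c u = (if u \<in> G then cutoff (depth u / \<delta>) *\<^sub>R h c u else 0)"

definition cut_field' :: "real \<Rightarrow> 'N \<Rightarrow> real ^ 'N \<Rightarrow> 'b" where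
  "cut_field' \<delta> c u = indicator G u *\<^sub>R (cutoff (depth u / \<delta>) *\<^sub>R h' c u +
     (tent (depth u / \<delta>) / \<delta> * (\<sigma> * (partial c g u - of_bool (c = j)))) *\<^sub>R h c u)"

text \<open>Outside \<open>G\<close> there are two reasons to vanish. In \<open>U\<close> the depth
  is at most 0, while the cutoff vanishes up to depth \<delta>, which leaves an open neighbourhood;
  outside \<open>U\<close> the complement of \<open>K\<close> serves. The extension by 0 is
  therefore as regular as the field inside.\<close>

lemma cut_field_locally_zero:
  assumes "u \<notin> G" "\<delta> > 0"
  obtains N where "open N" "u \<in> N" "\<And>v. v \<in> N \<Longrightarrow> cut_field \<delta> c v = 0"
proof (cases "u \<in> U")
  case True
  have "depth u \<le> 0" using GU[OF True] assms by (simp add: depth_def)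
  moreover have "open {v. depth v < \<delta>}"
    using continuous_depth by (intro open_Collect_less) auto
  ultimately show ?thesis
    by (intro that[of "{v. depth v < \<delta>}"])
      (use assms in \<open>auto simp: cut_field_def cutoff_eq_0\<close>)
next
  case False
  then show ?thesis
    by (intro that[of "- K"]) (use K supp in \<open>auto simp: cut_field_def\<close>)
qed

lemma cut_field_continuous:
  assumes "\<delta> > 0"
  shows "continuous_on UNIV (cut_field \<delta> c)"
proof (intro continuous_at_imp_continuous_on ballI)
  fix u show "isCont (cut_field \<delta> c) u"
  proof (cases "u \<in> G")
    case True
    have "continuous_on G (\<lambda>u. cutoff (depth u / \<delta>) *\<^sub>R h c u)"
      by (intro continuous_intros continuous_on_compose2[OF continuous_cutoff]
          continuous_on_subset[OF continuous_depth] continuous_on_subset[OF h_cont])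
        (use assms closure_subset in auto)
    then have "continuous_on G (cut_field \<delta> c)"
      by (rule continuous_on_eq) (simp add: cut_field_def)
    then show ?thesis using True G(1) continuous_on_eq_continuous_at by blast
  next
    case False
    from cut_field_locally_zero[OF this assms, of c] locally_zero_line(1) show ?thesis by metis
  qed
qed

lemma cut_field_deriv:
  assumes "\<delta> > 0" "u \<notin> E"
  shows "((\<lambda>t. cut_field \<delta> c (u + t *\<^sub>R axis c 1)) has_vector_derivative cut_field' \<delta> c u) (at 0)"
proof (cases "u \<in> G")
  case True
  have "((\<lambda>t. cutoff (depth (u + t *\<^sub>R axis c 1) / \<delta>)) has_real_derivative
      tent (depth u / \<delta>) * (\<sigma> * (partial c g u - of_bool (c = j)) / \<delta>)) (at 0)"
  proof (rule DERIV_chain2[of cutoff])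
    show "(cutoff has_real_derivative tent (depth u / \<delta>)) (at (depth (u + 0 *\<^sub>R axis c 1) / \<delta>))"
      using DERIV_cutoff by simp
    show "((\<lambda>t. depth (u + t *\<^sub>R axis c 1) / \<delta>) has_real_derivative
      \<sigma> * (partial c g u - of_bool (c = j)) / \<delta>) (at 0)"
      by (rule DERIV_cdivide[OF depth_line])
  qed
  from has_vector_derivative_scaleR[OF this h_deriv[of u c]] assms True
  have "((\<lambda>t. cutoff (depth (u + t *\<^sub>R axis c 1) / \<delta>) *\<^sub>R h c (u + t *\<^sub>R axis c 1))
      has_vector_derivative cut_field' \<delta> c u) (at 0)"
    by (simp add: cut_field'_def)
  then show ?thesis
    by (rule has_vector_derivative_line_cong[of "\<lambda>v. cutoff (depth v / \<delta>) *\<^sub>R h c v", OF _ G(1) True])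
      (simp add: cut_field_def)
next
  case False
  from cut_field_locally_zero[OF this assms(1), of c] obtain N where
    "open N" "u \<in> N" "\<And>v. v \<in> N \<Longrightarrow> cut_field \<delta> c v = 0" by blast
  from locally_zero_line(2)[OF this] show ?thesis using False by (simp add: cut_field'_def)
qed

lemma G_borel: "G \<in> sets borel" "closure G \<in> sets borel"
  using G by auto

lemma measurable_on_G:
  assumes "continuous_on (closure G) (f :: real ^ 'N \<Rightarrow> 'c::{real_normed_vector,second_countable_topology})"
  shows "(\<lambda>u. indicator G u *\<^sub>R f u) \<in> borel_measurable borel"
  using G_borel(1) continuous_on_subset[OF assms closure_subset]
  by (rule borel_measurable_continuous_on_indicator)

lemma depth_meas: "depth \<in> borel_measurable borel"
  using continuous_depth by (rule borel_measurable_continuous_onI)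

lemma cutoff_meas: "cutoff \<in> borel_measurable borel" "tent \<in> borel_measurable borel"
  using continuous_cutoff continuous_tent by (auto intro: borel_measurable_continuous_onI)

lemma flux_cont: "continuous_on (closure G) flux"
  unfolding flux_def[abs_def]
  by (intro continuous_intros h_cont continuous_on_subset[OF C1_imp_continuous_partial[OF g]]) auto

lemma integral_cut_field':
  assumes "\<delta> > 0"
  shows "integrable lborel (cut_field' \<delta> c) \<and> integral\<^sup>L lborel (cut_field' \<delta> c) = 0"
proof -
  obtain B where B: "B \<ge> 0" "\<And>c u. u \<in> closure G \<Longrightarrow> norm (h c u) \<le> B"
    "\<And>c u. u \<in> G \<Longrightarrow> norm (h' c u) \<le> B" "\<And>c u. u \<in> closure G \<Longrightarrow> \<bar>partial c g u\<bar> \<le> B"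
    using uniform_bound by blast
  note [measurable] = cutoff_meas depth_meas h'_meas
  have [measurable]: "partial c g \<in> borel_measurable borel"
    by (rule borel_measurable_continuous_onI[OF C1_imp_continuous_partial[OF g]])
  have [measurable]: "(\<lambda>u. indicator G u *\<^sub>R h c u) \<in> borel_measurable borel"
    by (rule measurable_on_G[OF h_cont])
  have eq: "cut_field' \<delta> c = (\<lambda>u. cutoff (depth u / \<delta>) *\<^sub>R (indicator G u *\<^sub>R h' c u) +
     (tent (depth u / \<delta>) / \<delta> * (\<sigma> * (partial c g u - of_bool (c = j)))) *\<^sub>R (indicator G u *\<^sub>R h c u))"
    by (auto simp: cut_field'_def fun_eq_iff indicator_def)
  have meas: "cut_field' \<delta> c \<in> borel_measurable borel"
    unfolding eq by measurable
  \<comment> \<open>The bound degenerates as \<delta> tends to 0; it only has to hold for each fixed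
    \<delta>.\<close>
  have bnd: "norm (cut_field' \<delta> c u) \<le> B + 1 / \<delta> * (B + 1) * B" for u
  proof (cases "u \<in> G")
    case True
    then have u: "u \<in> closure G" using closure_subset by blast
    have 1: "norm (cutoff (depth u / \<delta>) *\<^sub>R h' c u) \<le> 1 * B"
      unfolding norm_scaleR by (intro mult_mono B True) (use cutoff_bounds in auto)
    have "\<bar>partial c g u - of_bool (c = j)\<bar> \<le> B + 1"
      using B(4)[OF u, of c] by (auto simp: abs_if split: if_splits)
    then have "\<bar>tent (depth u / \<delta>) / \<delta> * (\<sigma> * (partial c g u - of_bool (c = j)))\<bar> \<le> 1 / \<delta> * (B + 1)"
      unfolding abs_mult \<sigma>_square using assms tent_bounds[of "depth u / \<delta>"] B(1)
      by (intro mult_mono) (auto simp: divide_right_mono)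
    then have 2: "norm ((tent (depth u / \<delta>) / \<delta> * (\<sigma> * (partial c g u - of_bool (c = j)))) *\<^sub>R h c u)
        \<le> 1 / \<delta> * (B + 1) * B"
      unfolding norm_scaleR using B assms u by (intro mult_mono) auto
    show ?thesis using norm_triangle_mono[OF 1 2] True by (simp add: cut_field'_def)
  qed (use B assms in \<open>simp add: cut_field'_def\<close>)
  have "integrable lborel (cut_field' \<delta> c)"
    by (rule integrable_lborel_bounded[OF meas bnd _ G(2)]) (auto simp: cut_field'_def indicator_def split: if_splits)
  moreover have "integral\<^sup>L lborel (cut_field' \<delta> c) = 0"
    by (rule integral_partial_compact_support[OF cut_field_continuous[OF assms] meas bnd _ G(2) E_finite cut_field_deriv])
      (auto simp: cut_field_def cut_field'_def assms)
  ultimately show ?thesis ..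
qed

lemma partial_j_g: "partial j g u = 0"
  by (rule partial_eq_0_of_indep) (rule g_indep)

text \<open>The gradient of the depth is minus the outward normal, so the extra terms of the product
  rule add up to minus the flux, weighted by a hat of width proportional to \<delta>. In the
  direction \<open>j\<close> only the coordinate itself counts, because \<open>g\<close> does not
  depend on it.\<close>

lemma sum_cut_field':
  "(\<Sum>c\<in>UNIV. cut_field' \<delta> c u) = cutoff (depth u / \<delta>) *\<^sub>R (indicator G u *\<^sub>R (\<Sum>c\<in>UNIV. h' c u)) -
     (tent (depth u / \<delta>) / \<delta>) *\<^sub>R (indicator G u *\<^sub>R flux u)"
proof -
  let ?t = "tent (depth u / \<delta>) / \<delta>"
  have "(\<Sum>c\<in>UNIV. (?t * (\<sigma> * (partial c g u - of_bool (c = j)))) *\<^sub>R h c u) =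
      (?t * (\<sigma> * (partial j g u - 1))) *\<^sub>R h j u +
      (\<Sum>c\<in>UNIV - {j}. (?t * (\<sigma> * (partial c g u - of_bool (c = j)))) *\<^sub>R h c u)"
    by (subst sum.remove[of UNIV j]) auto
  also have "(\<Sum>c\<in>UNIV - {j}. (?t * (\<sigma> * (partial c g u - of_bool (c = j)))) *\<^sub>R h c u) =
      (?t * \<sigma>) *\<^sub>R (\<Sum>c\<in>-{j}. partial c g u *\<^sub>R h c u)"
    unfolding scaleR_sum_right by (rule sum.cong) (auto simp: mult.assoc)
  also have "(?t * (\<sigma> * (partial j g u - 1))) *\<^sub>R h j u + \<dots> = - (?t *\<^sub>R flux u)"
    by (simp add: partial_j_g flux_def scaleR_right_diff_distrib)
  finally have *: "(\<Sum>c\<in>UNIV. (?t * (\<sigma> * (partial c g u - of_bool (c = j)))) *\<^sub>R h c u) = - (?t *\<^sub>R flux u)" .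
  have "(\<Sum>c\<in>UNIV. cut_field' \<delta> c u) = indicator G u *\<^sub>R (cutoff (depth u / \<delta>) *\<^sub>R (\<Sum>c\<in>UNIV. h' c u) +
     (\<Sum>c\<in>UNIV. (?t * (\<sigma> * (partial c g u - of_bool (c = j)))) *\<^sub>R h c u))"
    unfolding cut_field'_def by (simp only: scaleR_sum_right sum.distrib scaleR_add_right)
  then show ?thesis unfolding * by (simp add: scaleR_right_diff_distrib algebra_simps)
qed

lemma flux_bounded:
  obtains C where "C \<ge> 0" "\<And>u. u \<in> closure G \<Longrightarrow> norm (flux u) \<le> C"
proof -
  have "bounded (flux ` closure G)"
    by (intro compact_imp_bounded compact_continuous_image flux_cont compact_closure_G)
  then obtain C where "\<forall>u\<in>closure G. norm (flux u) \<le> C" unfolding bounded_iff by auto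
  then show ?thesis by (intro that[of "max 0 C"]) (auto simp: le_max_iff_disj)
qed

section \<open>The layer next to the graph and its limit\<close>

definition graph_point :: "('N \<Rightarrow> real) \<Rightarrow> real ^ 'N" where
  "graph_point t = insert_coord j t (g (insert_zero j t))"

text \<open>The integrand on a line after the substitution y = g - \<sigma> \<delta> \<tau>. The
  depth becomes \<delta> \<tau>, so the profile \<open>tent \<tau>\<close> no longer depends on
  \<delta>, and \<delta> survives only in the point where the flux is evaluated.\<close>

definition graph_flux :: "real \<Rightarrow> ('N \<Rightarrow> real) \<Rightarrow> real \<Rightarrow> 'b" where
  "graph_flux \<delta> t \<tau> = tent \<tau> *\<^sub>R (let u = insert_coord j t (g (insert_zero j t) - \<sigma> * \<delta> * \<tau>)
     in indicator G u *\<^sub>R flux u)"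

lemma depth_graph: "depth (insert_coord j t (g (insert_zero j t) - \<sigma> * \<delta> * \<tau>)) = \<delta> * \<tau>"
proof -
  have "g (insert_coord j t (g (insert_zero j t) - \<sigma> * \<delta> * \<tau>)) = g (insert_zero j t)"
    by (rule g_indep) (simp add: insert_zero_eq insert_coord_nth)
  then show ?thesis using \<sigma>_square by (simp add: depth_def insert_coord_nth mult.assoc[symmetric])
qed

text \<open>Where \<open>tent\<close> is non-zero, \<tau> is positive, so a graph point in the chart
  is approached from inside \<open>G\<close>. That is why continuity of the flux on the closure of
  \<open>G\<close> suffices for the limit.\<close>

lemma graph_flux_tendsto: "(\<lambda>n. graph_flux (1 / Suc n) t \<tau>) \<longlonglongrightarrow> tent \<tau> *\<^sub>R flux (graph_point t)"
proof (cases "tent \<tau> = 0")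
  case True then show ?thesis by (simp add: graph_flux_def)
next
  case False
  then have \<tau>: "\<tau> > 0" using tent_bounds(3)[of \<tau>] by simp
  define v where "v n = insert_coord j t (g (insert_zero j t) - \<sigma> * (1 / Suc n) * \<tau>)" for n
  have "(\<lambda>n. g (insert_zero j t) - \<sigma> * (1 / Suc n) * \<tau>) \<longlonglongrightarrow> g (insert_zero j t) - \<sigma> * 0 * \<tau>"
    by (intro tendsto_intros LIMSEQ_Suc[OF lim_1_over_n])
  then have "(\<lambda>n. g (insert_zero j t) - \<sigma> * (1 / Suc n) * \<tau>) \<longlonglongrightarrow> g (insert_zero j t)" by simp
  then have lim: "v \<longlonglongrightarrow> graph_point t"
    unfolding v_def[abs_def] graph_point_def
    by (rule continuous_on_tendsto_compose[OF continuous_insert_coord]) auto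
  have "(\<lambda>n. indicator G (v n) *\<^sub>R flux (v n)) \<longlonglongrightarrow> flux (graph_point t)"
  proof (cases "graph_point t \<in> K")
    case True
    then have "graph_point t \<in> U" using K by auto
    then have "\<forall>\<^sub>F n in sequentially. v n \<in> U" using topological_tendstoD[OF lim U] by blast
    then have ev: "\<forall>\<^sub>F n in sequentially. v n \<in> G"
    proof eventually_elim
      case (elim n)
      then show ?case using GU[OF elim] depth_graph[of t "1 / Suc n" \<tau>] \<tau>
        by (simp add: v_def depth_def)
    qed
    then have ev': "\<forall>\<^sub>F n in sequentially. v n \<in> closure G"
      by eventually_elim (use closure_subset in blast)
    have cl: "graph_point t \<in> closure G"
      by (rule Lim_in_closed_set[OF closed_closure ev' _ lim]) simp
    have "(\<lambda>n. flux (v n)) \<longlonglongrightarrow> flux (graph_point t)"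
      by (rule continuous_on_tendsto_compose[OF flux_cont lim cl ev'])
    then show ?thesis
      by (rule Lim_transform_eventually) (use ev in \<open>eventually_elim, simp\<close>)
  next
    case False
    \<comment> \<open>Here the approximating points may leave \<open>U\<close>, where depth says
      nothing about \<open>G\<close>; but the flux vanishes at all of them.\<close>
    then have "\<forall>\<^sub>F n in sequentially. v n \<in> - K"
      using topological_tendstoD[OF lim, of "- K"] K by auto
    then have ev: "\<forall>\<^sub>F n in sequentially. 0 = indicator G (v n) *\<^sub>R flux (v n)"
      by eventually_elim (simp add: flux_def supp)
    have "flux (graph_point t) = 0" using False by (simp add: flux_def supp)
    then show ?thesis using Lim_transform_eventually[OF tendsto_const ev] by simp
  qed
  then show ?thesis
    unfolding graph_flux_def Let_def v_def[symmetric] by (intro tendsto_scaleR tendsto_const)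
qed

lemma graph_flux_bound:
  assumes "\<And>u. u \<in> closure G \<Longrightarrow> norm (flux u) \<le> C" "C \<ge> 0"
  shows "norm (graph_flux \<delta> t \<tau>) \<le> tent \<tau> * C"
proof -
  have "norm (indicator G u *\<^sub>R flux u) \<le> C" for u
    using assms(1)[of u] assms(2) closure_subset[of G] by (auto simp: indicator_def)
  then show ?thesis unfolding graph_flux_def Let_def norm_scaleR
    by (intro mult_mono) (use tent_bounds in auto)
qed

lemma graph_flux_meas:
  "(\<lambda>(t, \<tau>). graph_flux \<delta> t \<tau>) \<in> borel_measurable ((\<Pi>\<^sub>M c\<in>-{j}. lborel) \<Otimes>\<^sub>M lborel)"
proof -
  note [measurable] = cutoff_meas
  have [measurable]: "(\<lambda>u. indicator G u *\<^sub>R flux u) \<in> borel_measurable borel"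
    by (rule measurable_on_G[OF flux_cont])
  have [measurable]: "g \<in> borel_measurable borel"
    by (rule borel_measurable_continuous_onI[OF C1_imp_continuous[OF g]])
  show ?thesis unfolding graph_flux_def Let_def insert_zero_eq by measurable
qed

lemma integral_tent_flux:
  assumes "\<delta> > 0"
  defines "F \<equiv> \<lambda>u. (tent (depth u / \<delta>) / \<delta>) *\<^sub>R (indicator G u *\<^sub>R flux u)"
  shows "integrable lborel F"
    and "integral\<^sup>L lborel F = (\<integral>t. (\<integral>\<tau>. graph_flux \<delta> t \<tau> \<partial>lborel) \<partial>(\<Pi>\<^sub>M c\<in>-{j}. lborel))"
proof -
  note [measurable] = cutoff_meas depth_meas
  have [measurable]: "(\<lambda>u. indicator G u *\<^sub>R flux u) \<in> borel_measurable borel"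
    by (rule measurable_on_G[OF flux_cont])
  obtain C where C: "C \<ge> 0" "\<And>u. u \<in> closure G \<Longrightarrow> norm (flux u) \<le> C"
    using flux_bounded by blast
  have bnd: "norm (F u) \<le> (1 / \<delta>) * C" for u
  proof -
    have "norm (indicator G u *\<^sub>R flux u) \<le> C"
      using C(2)[of u] C(1) closure_subset[of G] by (auto simp: indicator_def)
    moreover have "\<bar>tent (depth u / \<delta>) / \<delta>\<bar> \<le> 1 / \<delta>"
      using assms tent_bounds by (simp add: divide_right_mono)
    ultimately show ?thesis
      unfolding F_def norm_scaleR[of "_ / _"] using assms by (intro mult_mono) auto
  qed
  have "F \<in> borel_measurable borel" unfolding F_def by measurable
  then show int: "integrable lborel F"
    by (rule integrable_lborel_bounded[OF _ bnd _ G(2)])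
      (auto simp: F_def indicator_def split: if_splits)
  have "(\<integral>y. F (insert_coord j t y) \<partial>lborel) = (\<integral>\<tau>. graph_flux \<delta> t \<tau> \<partial>lborel)" for t
  proof -
    have nz: "- \<sigma> * \<delta> \<noteq> 0" and abs: "\<bar>- \<sigma> * \<delta>\<bar> = \<delta>" using assms \<sigma> by auto
    have "(\<integral>y. F (insert_coord j t y) \<partial>lborel) =
        \<bar>- \<sigma> * \<delta>\<bar> *\<^sub>R (\<integral>\<tau>. F (insert_coord j t (g (insert_zero j t) + (- \<sigma> * \<delta>) * \<tau>)) \<partial>lborel)"
      by (rule lborel_integral_real_affine[OF nz])
    also have "\<dots> = (\<integral>\<tau>. \<bar>- \<sigma> * \<delta>\<bar> *\<^sub>R F (insert_coord j t (g (insert_zero j t) + (- \<sigma> * \<delta>) * \<tau>)) \<partial>lborel)"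
      by simp
    \<comment> \<open>The Jacobian equals \<delta> and cancels the factor 1 / \<delta> in
      \<open>F\<close>.\<close>
    also have "\<dots> = (\<integral>\<tau>. graph_flux \<delta> t \<tau> \<partial>lborel)"
      unfolding abs F_def graph_flux_def Let_def using assms depth_graph[of t \<delta>]
      by (intro Bochner_Integration.integral_cong) auto
    finally show ?thesis .
  qed
  then show "integral\<^sup>L lborel F = (\<integral>t. (\<integral>\<tau>. graph_flux \<delta> t \<tau> \<partial>lborel) \<partial>(\<Pi>\<^sub>M c\<in>-{j}. lborel))"
    using integral_insert_coord[OF int, of j] by simp
qed

lemma integral_graph_flux_tendsto:
  "(\<lambda>n. \<integral>\<tau>. graph_flux (1 / Suc n) t \<tau> \<partial>lborel) \<longlonglongrightarrow> flux (graph_point t)"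
proof -
  obtain C where C: "C \<ge> 0" "\<And>u. u \<in> closure G \<Longrightarrow> norm (flux u) \<le> C"
    using flux_bounded by blast
  have meas: "(\<lambda>\<tau>. graph_flux \<delta> t \<tau>) \<in> borel_measurable lborel" for \<delta>
  proof -
    note [measurable] = cutoff_meas
    have [measurable]: "(\<lambda>u. indicator G u *\<^sub>R flux u) \<in> borel_measurable borel"
      by (rule measurable_on_G[OF flux_cont])
    have "insert_coord j t \<in> borel_measurable borel"
      by (rule borel_measurable_continuous_onI[OF continuous_insert_coord])
    then show ?thesis unfolding graph_flux_def Let_def by measurable
  qed
  have "(\<lambda>n. \<integral>\<tau>. graph_flux (1 / Suc n) t \<tau> \<partial>lborel) \<longlonglongrightarrow>
      (\<integral>\<tau>. tent \<tau> *\<^sub>R flux (graph_point t) \<partial>lborel)"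
  proof (rule integral_dominated_convergence)
    show "integrable lborel (\<lambda>\<tau>. tent \<tau> * C)" using integrable_tent by simp
    show "(\<lambda>\<tau>. tent \<tau> *\<^sub>R flux (graph_point t)) \<in> borel_measurable lborel"
      using cutoff_meas by simp
    show "AE \<tau> in lborel. norm (graph_flux (1 / Suc n) t \<tau>) \<le> tent \<tau> * C" for n
      using graph_flux_bound[OF C(2,1)] by simp
  qed (use meas graph_flux_tendsto in auto)
  also have "(\<integral>\<tau>. tent \<tau> *\<^sub>R flux (graph_point t) \<partial>lborel) = flux (graph_point t)"
    using integral_tent by simp
  finally show ?thesis .
qed

text \<open>For each \<delta> the cut-off divergence and the flux through the layer have the same
  integral. Both sides converge by dominated convergence: the layer to the graph, and the cutoff to
  1 at every point of \<open>G\<close> inside \<open>K\<close>, where the depth is positive.\<close>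

theorem chart_divergence:
  shows "integrable (\<Pi>\<^sub>M c\<in>-{j}. lborel) (\<lambda>t. flux (graph_point t))"
    and "(\<integral>t. flux (graph_point t) \<partial>(\<Pi>\<^sub>M c\<in>-{j}. lborel)) =
      (\<integral>u. indicator G u *\<^sub>R (\<Sum>c\<in>UNIV. h' c u) \<partial>lborel)"
proof -
  let ?M = "\<Pi>\<^sub>M c\<in>-{j}. (lborel :: real measure)"
  interpret pair: pair_sigma_finite ?M "lborel :: real measure"
    by (intro pair_sigma_finite.intro lborel_product.sigma_finite) (auto intro: lborel.sigma_finite_measure_axioms)
  obtain C where C: "C \<ge> 0" "\<And>u. u \<in> closure G \<Longrightarrow> norm (flux u) \<le> C"
    using flux_bounded by blast
  obtain R where R: "G \<subseteq> ball 0 R" using bounded_subset_ballD[OF G(2), of 0] by blast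
  let ?I = "\<lambda>n t. \<integral>\<tau>. graph_flux (1 / Suc n) t \<tau> \<partial>lborel"
  let ?B = "\<Pi>\<^sub>E c\<in>-{j}. {-R..R}"
  have Imeas: "?I n \<in> borel_measurable ?M" for n
    using graph_flux_meas by (intro lborel.borel_measurable_lebesgue_integral)
  have lim_meas: "(\<lambda>t. flux (graph_point t)) \<in> borel_measurable ?M"
    by (rule borel_measurable_LIMSEQ_metric[OF Imeas]) (rule integral_graph_flux_tendsto)
  have bound: "norm (?I n t) \<le> indicator ?B t * C" if tM: "t \<in> space ?M" for n t
  proof (cases "t \<in> ?B")
    case True
    have "norm (?I n t) \<le> (\<integral>\<tau>. tent \<tau> * C \<partial>lborel)"
      by (rule order_trans[OF integral_norm_bound integral_mono'])
        (use integrable_tent graph_flux_bound[OF C(2,1)] tent_bounds C(1) in auto)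
    then show ?thesis using True integral_tent by simp
  next
    case False
    \<comment> \<open>Since \<open>t\<close> is extensional, leaving the box means that some
      coordinate is too large; then the whole line over \<open>t\<close> misses
      \<open>G\<close>.\<close>
    then obtain c where c: "c \<noteq> j" "\<not> \<bar>t c\<bar> \<le> R"
      using tM by (auto simp: space_PiM PiE_iff abs_le_iff) (meson minus_le_iff)
    have "insert_coord j t y \<notin> G" for y
    proof
      assume "insert_coord j t y \<in> G"
      then have "norm (insert_coord j t y) < R" using R by auto
      then show False using component_le_norm_cart[of "insert_coord j t y" c] c
        by (simp add: insert_coord_nth)
    qed
    then have "graph_flux \<delta> t \<tau> = 0" for \<delta> \<tau> by (simp add: graph_flux_def Let_def)
    then show ?thesis using False by simp
  qed
  have dom: "integrable ?M (\<lambda>t. indicator ?B t * C)"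
    by (rule integrable_PiM_box)
  note dc = Imeas lim_meas dom AE_I2[OF integral_graph_flux_tendsto] AE_I2[OF bound]
  show "integrable ?M (\<lambda>t. flux (graph_point t))"
    by (rule integrable_dominated_convergence[where s = ?I and w = "\<lambda>t. indicator ?B t * C"])
      (use dc in auto)
  have lim1: "(\<lambda>n. integral\<^sup>L ?M (?I n)) \<longlonglongrightarrow> (\<integral>t. flux (graph_point t) \<partial>?M)"
    by (rule integral_dominated_convergence[where w = "\<lambda>t. indicator ?B t * C"])
      (use dc in auto)
  let ?S = "\<lambda>u. indicator G u *\<^sub>R (\<Sum>c\<in>UNIV. h' c u)"
  let ?A = "\<lambda>n u. cutoff (depth u / (1 / Suc n)) *\<^sub>R ?S u"
  have S_meas: "?S \<in> borel_measurable borel"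
    unfolding scaleR_sum_right by (intro borel_measurable_sum h'_meas)
  obtain B where B: "B \<ge> 0" "\<And>c u. u \<in> closure G \<Longrightarrow> norm (h c u) \<le> B"
    "\<And>c u. u \<in> G \<Longrightarrow> norm (h' c u) \<le> B" "\<And>c u. u \<in> closure G \<Longrightarrow> \<bar>partial c g u\<bar> \<le> B"
    using uniform_bound by blast
  have S_int: "integrable lborel ?S"
  proof (rule integrable_lborel_bounded[OF S_meas _ _ G(2)])
    show "norm (?S u) \<le> real CARD('N) * B" for u
      using sum_norm_bound[of UNIV "\<lambda>c. h' c u" B] B(1) B(3)[of u] by (cases "u \<in> G") auto
  qed (auto simp: indicator_def split: if_splits)
  have A_eq: "integral\<^sup>L lborel (?A n) = integral\<^sup>L ?M (?I n)" for n
  proof -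
    let ?\<delta> = "1 / real (Suc n)"
    have pos: "?\<delta> > 0" by simp
    let ?F = "\<lambda>u. (tent (depth u / ?\<delta>) / ?\<delta>) *\<^sub>R (indicator G u *\<^sub>R flux u)"
    have sum0: "integrable lborel (\<lambda>u. \<Sum>c\<in>UNIV. cut_field' ?\<delta> c u)"
      "(\<integral>u. (\<Sum>c\<in>UNIV. cut_field' ?\<delta> c u) \<partial>lborel) = 0"
      using integral_cut_field'[OF pos] by (auto simp: Bochner_Integration.integral_sum)
    have "?A n = (\<lambda>u. (\<Sum>c\<in>UNIV. cut_field' ?\<delta> c u) + ?F u)"
      unfolding sum_cut_field' by simp
    then have "integral\<^sup>L lborel (?A n) = integral\<^sup>L lborel ?F"
      using Bochner_Integration.integral_add[OF sum0(1) integral_tent_flux(1)[OF pos]] sum0(2) by simp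
    then show ?thesis using integral_tent_flux(2)[OF pos] by simp
  qed
  have "(\<lambda>n. integral\<^sup>L lborel (?A n)) \<longlonglongrightarrow> integral\<^sup>L lborel ?S"
  proof (rule integral_dominated_convergence[where w = "\<lambda>u. norm (?S u)"])
    show "?A n \<in> borel_measurable lborel" for n
      using S_meas cutoff_meas depth_meas by measurable
    show "AE u in lborel. norm (?A n u) \<le> norm (?S u)" for n
    proof (rule AE_I2)
      fix u
      have "\<bar>cutoff (depth u / (1 / Suc n))\<bar> * norm (?S u) \<le> 1 * norm (?S u)"
        using cutoff_bounds by (intro mult_right_mono) auto
      then show "norm (?A n u) \<le> norm (?S u)" unfolding norm_scaleR by simp
    qed
    show "AE u in lborel. (\<lambda>n. ?A n u) \<longlonglongrightarrow> ?S u"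
    proof (rule AE_I2)
      fix u show "(\<lambda>n. ?A n u) \<longlonglongrightarrow> ?S u"
      proof (cases "u \<in> G \<inter> K")
        case True
        then have pos: "depth u > 0" using GU K by (auto simp: depth_def)
        \<comment> \<open>The cutoff equals 1 from depth 3 \<delta> on, that is, as soon as n + 1 is
          at least 3 / depth.\<close>
        obtain n0 :: nat where n0: "3 / depth u < n0" using reals_Archimedean2 by blast
        have "\<forall>\<^sub>F n in sequentially. ?S u = ?A n u"
        proof (rule eventually_sequentiallyI[of n0])
          fix n assume "n0 \<le> n"
          then have "3 / depth u \<le> real (Suc n)" using n0 by simp
          then have "3 \<le> depth u / (1 / Suc n)" using pos by (simp add: field_simps)
          then show "?S u = ?A n u" by (simp add: cutoff_eq_1)
        qed
        then show ?thesis by (rule Lim_transform_eventually[OF tendsto_const])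
      next
        case False
        then have "?S u = 0" using supp(2) by (cases "u \<in> G") auto
        then show ?thesis by (simp only: scaleR_zero_right tendsto_const)
      qed
    qed
    show "integrable lborel (\<lambda>u. norm (?S u))" by (rule integrable_norm[OF S_int])
  qed (use S_meas in auto)
  then show "(\<integral>t. flux (graph_point t) \<partial>?M) = integral\<^sup>L lborel ?S"
    unfolding A_eq using lim1 LIMSEQ_unique by blast
qed

end

section \<open>Partitions of unity and the divergence theorem\<close>

lemma C1_gradientE:
  assumes "C1 h"
  obtains D where "\<And>u. (h has_derivative (\<lambda>v. D u \<bullet> v)) (at u)" "continuous_on UNIV D"
proof -
  obtain h' where "(\<forall>u. (h has_derivative blinfun_apply (h' u)) (at u)) \<and> continuous_on UNIV h'"
    using assms unfolding C1_def ..
  then have h': "\<And>u. (h has_derivative blinfun_apply (h' u)) (at u)" "continuous_on UNIV h'"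
    by simp_all
  have eq: "blinfun_apply (h' u) = (\<lambda>v. (\<Sum>b\<in>Basis. blinfun_apply (h' u) b *\<^sub>R b) \<bullet> v)" for u
  proof
    fix v
    have "blinfun_apply (h' u) v = blinfun_apply (h' u) (\<Sum>b\<in>Basis. (v \<bullet> b) *\<^sub>R b)"
      by (simp add: euclidean_representation)
    also have "\<dots> = (\<Sum>b\<in>Basis. (v \<bullet> b) * blinfun_apply (h' u) b)"
      by (simp add: blinfun.sum_right blinfun.scaleR_right)
    finally show "blinfun_apply (h' u) v = (\<Sum>b\<in>Basis. blinfun_apply (h' u) b *\<^sub>R b) \<bullet> v"
      by (simp only: inner_sum_left inner_scaleR_left) (simp add: inner_commute mult.commute)
  qed
  show ?thesis
  proof (rule that)
    show "(h has_derivative (\<lambda>v. (\<Sum>b\<in>Basis. blinfun_apply (h' u) b *\<^sub>R b) \<bullet> v)) (at u)" for u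
      using h'(1)[of u] eq[of u] by simp
    show "continuous_on UNIV (\<lambda>u. \<Sum>b\<in>Basis. blinfun_apply (h' u) b *\<^sub>R b)"
      by (intro continuous_on_sum continuous_on_scaleR continuous_on_const
          bounded_linear.continuous_on[OF blinfun.bounded_linear_left h'(2)])
  qed
qed

lemma C1_const: "C1 (\<lambda>_. c)"
  by (rule C1_gradientI[of _ "\<lambda>_. 0"]) auto

lemma C1_add: assumes "C1 f" "C1 g" shows "C1 (\<lambda>u. f u + g u)"
proof -
  obtain D where D: "\<And>u. (f has_derivative (\<lambda>v. D u \<bullet> v)) (at u)" "continuous_on UNIV D"
    using C1_gradientE[OF assms(1)] by blast
  obtain D' where D': "\<And>u. (g has_derivative (\<lambda>v. D' u \<bullet> v)) (at u)" "continuous_on UNIV D'"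
    using C1_gradientE[OF assms(2)] by blast
  show ?thesis
    by (rule C1_gradientI[of _ "\<lambda>u. D u + D' u"])
      (use has_derivative_add[OF D(1) D'(1)] D(2) D'(2) in \<open>auto intro!: continuous_intros simp: inner_add_left\<close>)
qed

lemma C1_mult: assumes "C1 f" "C1 g" shows "C1 (\<lambda>u. f u * g u)"
proof -
  obtain D where D: "\<And>u. (f has_derivative (\<lambda>v. D u \<bullet> v)) (at u)" "continuous_on UNIV D"
    using C1_gradientE[OF assms(1)] by blast
  obtain D' where D': "\<And>u. (g has_derivative (\<lambda>v. D' u \<bullet> v)) (at u)" "continuous_on UNIV D'"
    using C1_gradientE[OF assms(2)] by blast
  show ?thesis
  proof (rule C1_gradientI[of _ "\<lambda>u. f u *\<^sub>R D' u + g u *\<^sub>R D u"])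
    show "((\<lambda>u. f u * g u) has_derivative (\<lambda>v. (f u *\<^sub>R D' u + g u *\<^sub>R D u) \<bullet> v)) (at u)" for u
      using has_derivative_mult[OF D(1)[of u] D'(1)[of u]] by (simp add: inner_add_left mult.commute)
    show "continuous_on UNIV (\<lambda>u. f u *\<^sub>R D' u + g u *\<^sub>R D u)"
      by (intro continuous_on_add continuous_on_scaleR C1_imp_continuous assms D(2) D'(2))
  qed
qed

lemma C1_compose:
  assumes "C1 h" "\<And>u. (\<phi> has_real_derivative \<phi>' (h u)) (at (h u))" "continuous_on UNIV (\<lambda>u. \<phi>' (h u))"
  shows "C1 (\<lambda>u. \<phi> (h u))"
proof -
  obtain D where D: "\<And>u. (h has_derivative (\<lambda>v. D u \<bullet> v)) (at u)" "continuous_on UNIV D"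
    using C1_gradientE[OF assms(1)] by blast
  show ?thesis
  proof (rule C1_gradientI[of _ "\<lambda>u. \<phi>' (h u) *\<^sub>R D u"])
    show "((\<lambda>u. \<phi> (h u)) has_derivative (\<lambda>v. (\<phi>' (h u) *\<^sub>R D u) \<bullet> v)) (at u)" for u
      using has_derivative_compose[OF D(1)[of u] assms(2)[of u, unfolded has_field_derivative_def]]
      by simp
    show "continuous_on UNIV (\<lambda>u. \<phi>' (h u) *\<^sub>R D u)"
      by (intro continuous_on_scaleR assms D)
  qed
qed

lemma C1_diff: assumes "C1 f" "C1 g" shows "C1 (\<lambda>u. f u - g u)"
  using C1_add[OF assms(1) C1_mult[OF C1_const[of "-1"] assms(2)]] by simp

lemma C1_sum: "(\<And>i. i \<in> I \<Longrightarrow> C1 (f i)) \<Longrightarrow> C1 (\<lambda>u. \<Sum>i\<in>I. f i u)"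
  by (induction I rule: infinite_finite_induct) (auto intro: C1_const C1_add)

lemma C1_pos_square: assumes "C1 h" shows "C1 (\<lambda>u. pos_square (h u))"
  by (rule C1_compose[OF assms has_derivative_pos_square]) (intro continuous_intros C1_imp_continuous assms)

lemma C1_inverse: assumes "C1 h" "\<And>u. h u \<noteq> 0" shows "C1 (\<lambda>u. inverse (h u))"
proof (rule C1_compose[OF assms(1)])
  show "(inverse has_real_derivative - (inverse (h u) ^ Suc (Suc 0))) (at (h u))" for u
    by (rule DERIV_inverse[OF assms(2)])
  show "continuous_on UNIV (\<lambda>u. - (inverse (h u) ^ Suc (Suc 0)))"
    by (intro continuous_intros C1_imp_continuous assms) (use assms in auto)
qed

lemma C1_dist_square: "C1 (\<lambda>u. (u - b) \<bullet> (u - b))"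
proof (rule C1_gradientI)
  show "((\<lambda>u. (u - b) \<bullet> (u - b)) has_derivative (\<lambda>v. (2 *\<^sub>R (u - b)) \<bullet> v)) (at u)" for u
    by (auto intro!: derivative_eq_intros simp: inner_commute algebra_simps)
  show "continuous_on UNIV (\<lambda>u. 2 *\<^sub>R (u - b))" by (intro continuous_intros)
qed

section \<open>Partitions of unity on the boundary\<close>

definition oriented_chart ::
  "(real ^ 'N::finite) set \<Rightarrow> (real ^ 'N) set \<Rightarrow> 'N \<Rightarrow> real \<Rightarrow> (real ^ 'N \<Rightarrow> real) \<Rightarrow> (real ^ 'N \<Rightarrow> real) \<Rightarrow> bool" where
  "oriented_chart G U j \<sigma> g \<rho> \<longleftrightarrow> graph_chart G U j \<sigma> g \<and> C1 \<rho> \<and> (\<forall>u. 0 \<le> \<rho> u) \<and>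
     compact (closure {u. \<rho> u \<noteq> 0}) \<and> closure {u. \<rho> u \<noteq> 0} \<subseteq> U"

text \<open>The sum is 1 on a neighbourhood \<open>V\<close> of the frontier, more than
  \<open>has_boundary_integral\<close> asks: one minus the sum then vanishes near the frontier,
  which the divergence argument exploits. The bumps are squared positive parts of r^2 - |u - b|^2
  and hence C1.\<close>

lemma exists_partition_of_unity:
  fixes G :: "(real ^ 'N::finite) set"
  assumes "bounded G" "C1_boundary G"
  obtains M :: nat and U j \<sigma> g \<rho> V where
    "\<And>i. i < M \<Longrightarrow> oriented_chart G (U i) (j i) (\<sigma> i) (g i) (\<rho> i)"
    "open V" "frontier G \<subseteq> V" "\<And>u. u \<in> V \<Longrightarrow> (\<Sum>i<M. \<rho> i u) = 1"
proof (cases "frontier G = {}")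
  case True
  then show ?thesis by (intro that[of 0 _ _ _ _ _ "{}"]) auto
next
  case False
  have comp: "compact (frontier G)" using assms by (simp add: compact_frontier_bounded)
  have "\<forall>b\<in>frontier G. \<exists>U j \<sigma> g r. graph_chart G U j \<sigma> g \<and> 0 < r \<and> cball b r \<subseteq> U"
  proof
    fix b assume "b \<in> frontier G"
    then obtain U j \<sigma> g where *: "b \<in> U" "graph_chart G U j \<sigma> g"
      using assms unfolding C1_boundary_def by blast
    then have "open U" unfolding graph_chart_def by blast
    then obtain r where "0 < r" "cball b r \<subseteq> U" using * open_contains_cball by metis
    with * show "\<exists>U j \<sigma> g r. graph_chart G U j \<sigma> g \<and> 0 < r \<and> cball b r \<subseteq> U" by blast
  qed
  then obtain U j \<sigma> g r where ch: "\<And>b. b \<in> frontier G \<Longrightarrow> graph_chart G (U b) (j b) (\<sigma> b) (g b)"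
    "\<And>b. b \<in> frontier G \<Longrightarrow> 0 < r b" "\<And>b. b \<in> frontier G \<Longrightarrow> cball b (r b) \<subseteq> U b"
    by metis
  have "frontier G \<subseteq> (\<Union>b\<in>frontier G. ball b (r b))" using ch(2) by auto
  then obtain T where T: "T \<subseteq> frontier G" "finite T" "frontier G \<subseteq> (\<Union>b\<in>T. ball b (r b))"
    by (rule compactE_image[OF comp, rotated]) auto
  define bump where "bump b u = pos_square ((r b)\<^sup>2 - (u - b) \<bullet> (u - b))" for b u :: "real ^ 'N"
  define \<Phi> where "\<Phi> u = (\<Sum>b\<in>T. bump b u)" for u
  have bump_nonneg: "0 \<le> bump b u" for b u by (simp add: bump_def pos_square_def)
  have bump_pos: "bump b u \<noteq> 0 \<longleftrightarrow> u \<in> ball b (r b)" if "b \<in> T" for b u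
  proof -
    have "r b > 0" using that T ch by blast
    then have "(norm (u - b))\<^sup>2 < (r b)\<^sup>2 \<longleftrightarrow> norm (u - b) < r b"
      by (metis abs_norm_cancel less_le_not_le norm_ge_zero power2_less_imp_less power_strict_mono zero_less_numeral less_imp_le)
    then show ?thesis
      by (auto simp: bump_def pos_square_def max_def dist_norm norm_minus_commute power2_norm_eq_inner[symmetric])
  qed
  have C1_bump: "C1 (bump b)" for b
    unfolding bump_def by (intro C1_pos_square C1_diff C1_const C1_dist_square)
  have C1_\<Phi>: "C1 \<Phi>" unfolding \<Phi>_def[abs_def] by (intro C1_sum C1_bump)
  have \<Phi>_nonneg: "0 \<le> \<Phi> u" for u unfolding \<Phi>_def by (intro sum_nonneg bump_nonneg)
  have \<Phi>_pos: "0 < \<Phi> u" if fr: "u \<in> frontier G" for u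
  proof -
    obtain b where b: "b \<in> T" "u \<in> ball b (r b)" using fr T by blast
    then have "0 < bump b u" using bump_pos[OF b(1), of u] bump_nonneg[of b u] by auto
    then show ?thesis unfolding \<Phi>_def using b T bump_nonneg by (intro sum_pos2[of T b]) auto
  qed
  obtain u0 where u0: "u0 \<in> frontier G" "\<And>u. u \<in> frontier G \<Longrightarrow> \<Phi> u0 \<le> \<Phi> u"
    using continuous_attains_inf[OF comp False continuous_on_subset[OF C1_imp_continuous[OF C1_\<Phi>]]] by auto
  \<comment> \<open>Half the minimum over the compact frontier, so that the condition \<Phi> >
    \<delta> defines an open set containing the frontier.\<close>
  define \<delta> where "\<delta> = \<Phi> u0 / 2"
  have \<delta>: "\<delta> > 0" using \<Phi>_pos[OF u0(1)] by (simp add: \<delta>_def)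
  \<comment> \<open>The added term vanishes where \<Phi> is at least \<delta> and keeps the
    denominator positive where \<Phi> is 0, so the quotients are C1 on the whole space and sum to 1
    near the frontier.\<close>
  define \<Psi> where "\<Psi> u = \<Phi> u + pos_square (\<delta> - \<Phi> u)" for u
  have \<Psi>_pos: "0 < \<Psi> u" for u
    using \<Phi>_nonneg[of u] \<delta> by (cases "\<Phi> u = 0") (auto simp: \<Psi>_def pos_square_def add_pos_nonneg)
  have C1_\<Psi>: "C1 \<Psi>" unfolding \<Psi>_def[abs_def] by (intro C1_add C1_pos_square C1_diff C1_const C1_\<Phi>)
  define \<rho> where "\<rho> b u = bump b u * inverse (\<Psi> u)" for b u
  obtain e where e: "bij_betw e {0..<card T} T" using ex_bij_betw_nat_finite[OF T(2)] by blast
  show ?thesis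
  proof (rule that[of "card T" "U \<circ> e" "j \<circ> e" "\<sigma> \<circ> e" "g \<circ> e" "\<rho> \<circ> e" "{u. \<delta> < \<Phi> u}"])
    fix i assume "i < card T"
    then have b: "e i \<in> T" using e by (auto simp: bij_betw_def)
    have C1: "C1 (\<rho> (e i))"
      unfolding \<rho>_def[abs_def] by (intro C1_mult C1_bump C1_inverse C1_\<Psi> less_imp_neq[OF \<Psi>_pos, symmetric])
    have "{u. \<rho> (e i) u \<noteq> 0} \<subseteq> ball (e i) (r (e i))"
    proof
      fix u assume "u \<in> {u. \<rho> (e i) u \<noteq> 0}"
      then have "bump (e i) u \<noteq> 0" by (auto simp: \<rho>_def)
      then show "u \<in> ball (e i) (r (e i))" using bump_pos[OF b] by simp
    qed
    then have cl: "closure {u. \<rho> (e i) u \<noteq> 0} \<subseteq> cball (e i) (r (e i))"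
      using ball_subset_cball by (intro closure_minimal) auto
    have "bounded (closure {u. \<rho> (e i) u \<noteq> 0})"
      using cl bounded_cball by (rule bounded_subset[rotated])
    then have cp: "compact (closure {u. \<rho> (e i) u \<noteq> 0})"
      by (simp add: compact_eq_bounded_closed)
    have fr: "e i \<in> frontier G" using b T by blast
    have nn: "\<forall>u. 0 \<le> \<rho> (e i) u"
      unfolding \<rho>_def using bump_nonneg \<Psi>_pos by (simp add: less_imp_le)
    show "oriented_chart G ((U \<circ> e) i) ((j \<circ> e) i) ((\<sigma> \<circ> e) i) ((g \<circ> e) i) ((\<rho> \<circ> e) i)"
      unfolding oriented_chart_def o_def using ch(1)[OF fr] C1 nn cp order_trans[OF cl ch(3)[OF fr]] by blast
  next
    show "open {u. \<delta> < \<Phi> u}"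
      by (intro open_Collect_less continuous_on_const C1_imp_continuous C1_\<Phi>)
    show "frontier G \<subseteq> {u. \<delta> < \<Phi> u}"
      using u0 \<delta> by (fastforce simp: \<delta>_def)
    fix u assume "u \<in> {u. \<delta> < \<Phi> u}"
    then have u: "\<Psi> u = \<Phi> u" "\<Phi> u \<noteq> 0" using \<delta> by (auto simp: \<Psi>_def pos_square_def)
    have "(\<Sum>i<card T. (\<rho> \<circ> e) i u) = (\<Sum>b\<in>T. \<rho> b u)"
      using sum.reindex_bij_betw[OF e, of "\<lambda>b. \<rho> b u"] by (simp add: lessThan_atLeast0)
    also have "\<dots> = \<Phi> u * inverse (\<Psi> u)"
      unfolding \<rho>_def \<Phi>_def sum_distrib_right ..
    finally show "(\<Sum>i<card T. (\<rho> \<circ> e) i u) = 1" using u by simp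
  qed
qed

lemma stokes_field_scaleR:
  fixes w w' :: "'N::finite \<Rightarrow> real ^ 'N \<Rightarrow> 'b::euclidean_space"
  assumes G: "open G" "bounded G" and \<rho>: "C1 \<rho>" and w: "stokes_field G E w w'"
  shows "stokes_field G E (\<lambda>c u. \<rho> u *\<^sub>R w c u) (\<lambda>c u. partial c \<rho> u *\<^sub>R w c u + \<rho> u *\<^sub>R w' c u)"
  unfolding stokes_field_def
proof (intro allI conjI ballI)
  fix c
  have w: "continuous_on (closure G) (w c)"
    "(\<lambda>u. indicator G u *\<^sub>R w' c u) \<in> borel_measurable borel" "bounded (w' c ` G)"
    "\<And>u. finite {t. u + t *\<^sub>R axis c 1 \<in> E}"
    "\<And>u. u \<in> G - E \<Longrightarrow> ((\<lambda>t. w c (u + t *\<^sub>R axis c 1)) has_vector_derivative w' c u) (at 0)"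
    using w unfolding stokes_field_def by blast+
  note \<rho>_cont = C1_imp_continuous[OF \<rho>] and p_cont = C1_imp_continuous_partial[OF \<rho>, of c]
  show "continuous_on (closure G) (\<lambda>u. \<rho> u *\<^sub>R w c u)"
    by (intro continuous_on_scaleR w continuous_on_subset[OF \<rho>_cont]) simp
  have 1: "(\<lambda>u. indicator G u *\<^sub>R w c u) \<in> borel_measurable borel"
    using G continuous_on_subset[OF w(1) closure_subset]
    by (intro borel_measurable_continuous_on_indicator) auto
  have "(\<lambda>u. partial c \<rho> u *\<^sub>R (indicator G u *\<^sub>R w c u) + \<rho> u *\<^sub>R (indicator G u *\<^sub>R w' c u)) \<in> borel_measurable borel"
    by (intro borel_measurable_add borel_measurable_scaleR 1 w borel_measurable_continuous_onI \<rho>_cont p_cont)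
  then show "(\<lambda>u. indicator G u *\<^sub>R (partial c \<rho> u *\<^sub>R w c u + \<rho> u *\<^sub>R w' c u)) \<in> borel_measurable borel"
    by (simp add: scaleR_add_right mult.commute)
  have cmp: "compact (closure G)" using G by (simp add: compact_closure)
  have "bounded (w c ` closure G)" "bounded (\<rho> ` closure G)" "bounded (partial c \<rho> ` closure G)"
    by (intro compact_imp_bounded compact_continuous_image w cmp
        continuous_on_subset[OF \<rho>_cont] continuous_on_subset[OF p_cont] subset_UNIV)+
  then obtain B1 B2 B3 B4 where B: "\<forall>u\<in>closure G. norm (w c u) \<le> B1" "\<forall>u\<in>closure G. \<bar>\<rho> u\<bar> \<le> B2"
    "\<forall>u\<in>closure G. \<bar>partial c \<rho> u\<bar> \<le> B3" "\<forall>u\<in>G. norm (w' c u) \<le> B4"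
    using w(3) unfolding bounded_iff by auto
  show "bounded ((\<lambda>u. partial c \<rho> u *\<^sub>R w c u + \<rho> u *\<^sub>R w' c u) ` G)"
    unfolding bounded_iff
  proof (intro exI ballI, elim imageE, clarify)
    fix u assume u: "u \<in> G"
    then have u': "u \<in> closure G" using closure_subset by blast
    have b: "norm (w c u) \<le> B1" "\<bar>\<rho> u\<bar> \<le> B2" "\<bar>partial c \<rho> u\<bar> \<le> B3" "norm (w' c u) \<le> B4"
      using B u u' by auto
    have "norm (partial c \<rho> u *\<^sub>R w c u) \<le> B3 * B1" "norm (\<rho> u *\<^sub>R w' c u) \<le> B2 * B4"
      unfolding norm_scaleR
      using mult_mono[OF b(3,1) order_trans[OF abs_ge_zero b(3)] norm_ge_zero]
        mult_mono[OF b(2,4) order_trans[OF abs_ge_zero b(2)] norm_ge_zero] .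
    then show "norm (partial c \<rho> u *\<^sub>R w c u + \<rho> u *\<^sub>R w' c u) \<le> B3 * B1 + B2 * B4"
      by (rule norm_triangle_mono)
  qed
  show "finite {t. u + t *\<^sub>R axis c 1 \<in> E}" for u by (rule w)
  fix u assume "u \<in> G - E"
  from has_vector_derivative_scaleR[OF C1_imp_line_real_derivative[OF \<rho>, of u c] w(5)[OF this]]
  show "((\<lambda>t. \<rho> (u + t *\<^sub>R axis c 1) *\<^sub>R w c (u + t *\<^sub>R axis c 1)) has_vector_derivative
      partial c \<rho> u *\<^sub>R w c u + \<rho> u *\<^sub>R w' c u) (at 0)" by (simp add: add.commute)
qed

lemma partial_locally_zero:
  assumes "open N" "u \<in> N" "\<And>v. v \<in> N \<Longrightarrow> f v = 0"
  shows "partial c f u = 0"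
  unfolding partial_def by (rule vector_derivative_at[OF locally_zero_line(2)[OF assms]])

section \<open>Flux through a family of charts\<close>

definition chart_flux ::
  "'N::finite \<Rightarrow> real \<Rightarrow> (real ^ 'N \<Rightarrow> real) \<Rightarrow> (real ^ 'N \<Rightarrow> real) \<Rightarrow> ('N \<Rightarrow> real ^ 'N \<Rightarrow> 'b) \<Rightarrow>
     ('N \<Rightarrow> real) \<Rightarrow> 'b::real_vector" where
  "chart_flux j \<sigma> g \<rho> w t = (let u = graph_map j g (insert_zero j t)
     in \<rho> u *\<^sub>R \<sigma> *\<^sub>R (w j u - (\<Sum>c\<in>-{j}. partial c g u *\<^sub>R w c u)))"

abbreviation charts_flux ::
  "nat \<Rightarrow> (nat \<Rightarrow> 'N::finite) \<Rightarrow> (nat \<Rightarrow> real) \<Rightarrow> (nat \<Rightarrow> real ^ 'N \<Rightarrow> real) \<Rightarrow> (nat \<Rightarrow> real ^ 'N \<Rightarrow> real) \<Rightarrow>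
     ('N \<Rightarrow> real ^ 'N \<Rightarrow> 'b) \<Rightarrow> 'b::euclidean_space" where
  "charts_flux M j \<sigma> g \<rho> w \<equiv>
     (\<Sum>i<M. \<integral>t. chart_flux (j i) (\<sigma> i) (g i) (\<rho> i) w t \<partial>(\<Pi>\<^sub>M c\<in>-{j i}. lborel))"

text \<open>Multiplication by \<rho> confines the field to the chart; the closed support of \<rho>
  takes the place of \<open>K\<close> in \<open>chart_field\<close>.\<close>

lemma chart_flux_divergence:
  fixes w w' :: "'N::finite \<Rightarrow> real ^ 'N \<Rightarrow> 'b::euclidean_space"
  assumes G: "open G" "bounded G" and ch: "oriented_chart G U j \<sigma> g \<rho>" and w: "stokes_field G E w w'"
  shows "integrable (\<Pi>\<^sub>M c\<in>-{j}. lborel) (chart_flux j \<sigma> g \<rho> w)"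
    and "(\<integral>t. chart_flux j \<sigma> g \<rho> w t \<partial>(\<Pi>\<^sub>M c\<in>-{j}. lborel)) =
      (\<integral>u. indicator G u *\<^sub>R (\<Sum>c\<in>UNIV. partial c \<rho> u *\<^sub>R w c u + \<rho> u *\<^sub>R w' c u) \<partial>lborel)"
proof -
  let ?K = "closure {u. \<rho> u \<noteq> 0}"
  have ch: "graph_chart G U j \<sigma> g" "C1 \<rho>" "?K \<subseteq> U" using ch unfolding oriented_chart_def by auto
  have 0: "\<rho> u = 0" if "u \<notin> ?K" for u using that closure_subset[of "{u. \<rho> u \<noteq> 0}"] by blast
  have p0: "partial c \<rho> u = 0" if "u \<notin> ?K" for c u
  proof (rule partial_locally_zero[of "- ?K"])
    show "u \<in> - ?K" using that unfolding Compl_iff .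
    show "\<rho> v = 0" if "v \<in> - ?K" for v using that unfolding Compl_iff by (rule 0)
  qed (rule open_Compl[OF closed_closure])
  interpret chart_field G U j \<sigma> g E ?K "\<lambda>c u. \<rho> u *\<^sub>R w c u" "\<lambda>c u. partial c \<rho> u *\<^sub>R w c u + \<rho> u *\<^sub>R w' c u"
  proof
    show "stokes_field G E (\<lambda>c u. \<rho> u *\<^sub>R w c u) (\<lambda>c u. partial c \<rho> u *\<^sub>R w c u + \<rho> u *\<^sub>R w' c u)"
      by (rule stokes_field_scaleR[OF G ch(2) w])
    show "\<rho> u *\<^sub>R w c u = 0" if "u \<notin> ?K" for c u using 0[OF that] by simp
    show "partial c \<rho> u *\<^sub>R w c u + \<rho> u *\<^sub>R w' c u = 0" if u: "u \<in> G - ?K" for c u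
    proof -
      have "u \<notin> ?K" using u by blast
      from 0[OF this] p0[OF this] show ?thesis by simp
    qed
  qed (rule G ch closed_closure)+
  have eq: "chart_flux j \<sigma> g \<rho> w = (\<lambda>t. flux (graph_point t))"
    unfolding chart_flux_def[abs_def] Let_def flux_def graph_point_def graph_map_insert_zero
    by (simp add: scaleR_right_diff_distrib scaleR_sum_right mult.commute mult.left_commute)
  show "integrable (\<Pi>\<^sub>M c\<in>-{j}. lborel) (chart_flux j \<sigma> g \<rho> w)"
    unfolding eq by (rule chart_divergence)
  show "(\<integral>t. chart_flux j \<sigma> g \<rho> w t \<partial>(\<Pi>\<^sub>M c\<in>-{j}. lborel)) =
      (\<integral>u. indicator G u *\<^sub>R (\<Sum>c\<in>UNIV. partial c \<rho> u *\<^sub>R w c u + \<rho> u *\<^sub>R w' c u) \<partial>lborel)"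
    unfolding eq by (rule chart_divergence)
qed

lemma stokes_field_integrable:
  fixes w w' :: "'N::finite \<Rightarrow> real ^ 'N \<Rightarrow> 'b::euclidean_space"
  assumes G: "bounded G" and w: "stokes_field G E w w'"
  shows "integrable lborel (\<lambda>u. indicator G u *\<^sub>R w' c u)"
proof -
  have "bounded (w' c ` G)" using w unfolding stokes_field_def by blast
  then obtain B where "\<forall>u\<in>G. norm (w' c u) \<le> B" unfolding bounded_iff by auto
  moreover have "(\<lambda>u. indicator G u *\<^sub>R w' c u) \<in> borel_measurable borel"
    using w unfolding stokes_field_def by blast
  ultimately show ?thesis
    by (intro integrable_lborel_bounded[OF _ _ _ G, of _ "max 0 B"])
      (auto simp: indicator_def le_max_iff_disj split: if_splits)
qed

text \<open>A component that vanishes near the frontier can be extended by 0 to the whole space, so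
  its line derivative integrates to 0 without any chart.\<close>

lemma integral_divergence_interior:
  fixes w w' :: "'N::finite \<Rightarrow> real ^ 'N \<Rightarrow> 'b::euclidean_space"
  assumes G: "open G" "bounded G" and w: "stokes_field G E w w'"
    and V: "open V" "frontier G \<subseteq> V" "\<And>u. u \<in> V \<Longrightarrow> w c u = 0"
  shows "(\<integral>u. indicator G u *\<^sub>R w' c u \<partial>lborel) = 0"
proof -
  let ?f = "\<lambda>u. if u \<in> G then w c u else 0"
  let ?f' = "\<lambda>u. indicator G u *\<^sub>R w' c u"
  have "bounded (w' c ` G)" using w unfolding stokes_field_def by blast
  then obtain B where B: "\<forall>u\<in>G. norm (w' c u) \<le> B" unfolding bounded_iff by auto
  have wc: "continuous_on (closure G) (w c)" "?f' \<in> borel_measurable borel"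
    "\<And>u. finite {t. u + t *\<^sub>R axis c 1 \<in> E}"
    "\<And>u. u \<in> G - E \<Longrightarrow> ((\<lambda>t. w c (u + t *\<^sub>R axis c 1)) has_vector_derivative w' c u) (at 0)"
    using w unfolding stokes_field_def by blast+
  have zero: "\<exists>N. open N \<and> u \<in> N \<and> (\<forall>v\<in>N. ?f v = 0)" if "u \<notin> G" for u
  proof (cases "u \<in> V")
    case True then show ?thesis using V by (intro exI[of _ V]) auto
  next
    case False
    then have "u \<notin> closure G" using V that G by (auto simp: frontier_def interior_open)
    then show ?thesis using closure_subset[of G] by (intro exI[of _ "- closure G"]) auto
  qed
  show ?thesis
  proof (rule integral_partial_compact_support[of ?f ?f' "max 0 B" G c E])
    show "continuous_on UNIV ?f"
    proof (intro continuous_at_imp_continuous_on ballI)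
      fix u show "isCont ?f u"
      proof (cases "u \<in> G")
        case True
        have "continuous_on G (w c)" using wc(1) closure_subset by (rule continuous_on_subset)
        then have "continuous_on G ?f" by (rule continuous_on_eq) simp
        then show ?thesis using True G(1) continuous_on_eq_continuous_at by blast
      next
        case False
        then show ?thesis using zero[OF False] locally_zero_line(1)[of _ u ?f] by blast
      qed
    qed
    fix u assume u: "u \<notin> E"
    show "((\<lambda>t. ?f (u + t *\<^sub>R axis c 1)) has_vector_derivative ?f' u) (at 0)"
    proof (cases "u \<in> G")
      case True
      show ?thesis
        by (rule has_vector_derivative_line_cong[of "w c", OF _ G(1) True]) (use True u wc(4) in auto)
    next
      case False
      then show ?thesis using zero[OF False] locally_zero_line(2)[of _ u ?f] by auto
    qed
  qed (use wc B G in \<open>auto simp: indicator_def le_max_iff_disj\<close>)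
qed

text \<open>A graph point in \<open>U\<close> has depth 0 and is not in \<open>G\<close>, but a
  shift by -\<sigma> / (n + 1) along \<open>j\<close> leads into \<open>G\<close>. Conditions
  imposed on \<open>frontier G\<close> thereby hold at every parameter where a chart integrand is
  non-zero.\<close>

lemma graph_point_in_frontier:
  assumes G: "open G" and ch: "graph_chart G U j \<sigma> g" and u: "graph_map j g v \<in> U"
  shows "graph_map j g v \<in> frontier G"
proof -
  let ?u = "graph_map j g v"
  have U: "open U" "\<And>u. u \<in> U \<Longrightarrow> u \<in> G \<longleftrightarrow> \<sigma> * (u $ j - g u) < 0" and \<sigma>: "\<sigma> = 1 \<or> \<sigma> = -1"
    and indep: "\<And>u v. \<forall>c. c \<noteq> j \<longrightarrow> u $ c = v $ c \<Longrightarrow> g u = g v"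
    using ch unfolding graph_chart_def by auto
  have gu: "g (?u + t *\<^sub>R axis j 1) = g v" for t
    by (rule indep) (simp add: graph_map_def axis_def)
  have "?u \<notin> G" using U(2)[OF u] gu[of 0] by (simp add: graph_map_def)
  moreover have "?u \<in> closure G"
  proof -
    let ?p = "\<lambda>n. ?u + (- \<sigma> * (1 / Suc n)) *\<^sub>R axis j 1"
    have "?p \<longlonglongrightarrow> ?u + (- \<sigma> * 0) *\<^sub>R axis j 1"
      by (intro tendsto_intros LIMSEQ_Suc[OF lim_1_over_n])
    then have lim: "?p \<longlonglongrightarrow> ?u" by simp
    have "\<forall>\<^sub>F n in sequentially. ?p n \<in> U" using topological_tendstoD[OF lim U(1) u] .
    then have "\<forall>\<^sub>F n in sequentially. ?p n \<in> closure G"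
    proof eventually_elim
      case (elim n)
      have "\<sigma> * (?p n $ j - g (?p n)) = - (1 / Suc n)"
        unfolding gu using \<sigma> by (auto simp: graph_map_def)
      then have "?p n \<in> G" using U(2)[OF elim] by simp
      then show ?case using closure_subset by blast
    qed
    then show ?thesis by (rule Lim_in_closed_set[OF closed_closure _ _ lim]) simp
  qed
  ultimately show ?thesis using G by (simp add: frontier_def interior_open)
qed

section \<open>Independence of the charts and of the partition\<close>

lemma partial_sum_C1:
  assumes "\<And>i. i \<in> I \<Longrightarrow> C1 (\<rho> i)"
  shows "partial c (\<lambda>u. \<Sum>i\<in>I. \<rho> i u) u = (\<Sum>i\<in>I. partial c (\<rho> i) u)"
  unfolding partial_def[of c "\<lambda>u. \<Sum>i\<in>I. \<rho> i u"]
  by (intro vector_derivative_at has_vector_derivative_sum C1_imp_line_derivative assms)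

lemma partial_one_minus_C1:
  assumes "C1 P" shows "partial c (\<lambda>u. 1 - P u) u = - partial c P u"
  unfolding partial_def[of c "\<lambda>u. 1 - P u"]
  using has_vector_derivative_diff[OF has_vector_derivative_const[of 1] C1_imp_line_derivative[OF assms, of u c]]
  by (intro vector_derivative_at) simp

text \<open>The chart fluxes depend on the family only through the sum \<open>P\<close> of the
  partition functions: together they give the integral of the divergence of P w.\<close>

lemma sum_chart_flux:
  fixes w w' :: "'N::finite \<Rightarrow> real ^ 'N \<Rightarrow> 'b::euclidean_space" and M :: nat
  assumes G: "open G" "bounded G" and w: "stokes_field G E w w'"
    and ch: "\<And>i. i < M \<Longrightarrow> oriented_chart G (U i) (j i) (\<sigma> i) (g i) (\<rho> i)"
  defines "P \<equiv> \<lambda>u. \<Sum>i<M. \<rho> i u"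
  shows "charts_flux M j \<sigma> g \<rho> w =
    (\<integral>u. indicator G u *\<^sub>R (\<Sum>c\<in>UNIV. partial c P u *\<^sub>R w c u + P u *\<^sub>R w' c u) \<partial>lborel)"
proof -
  have C1: "C1 (\<rho> i)" if "i < M" for i using ch[OF that] unfolding oriented_chart_def by blast
  have int: "integrable lborel (\<lambda>u. indicator G u *\<^sub>R (\<Sum>c\<in>UNIV. partial c (\<rho> i) u *\<^sub>R w c u + \<rho> i u *\<^sub>R w' c u))"
    if "i < M" for i
    unfolding scaleR_sum_right
    by (intro Bochner_Integration.integrable_sum
        stokes_field_integrable[OF G(2) stokes_field_scaleR[OF G C1[OF that] w]])
  have "charts_flux M j \<sigma> g \<rho> w =
    (\<Sum>i<M. \<integral>u. indicator G u *\<^sub>R (\<Sum>c\<in>UNIV. partial c (\<rho> i) u *\<^sub>R w c u + \<rho> i u *\<^sub>R w' c u) \<partial>lborel)"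
    using chart_flux_divergence(2)[OF G ch w] by (intro sum.cong) auto
  also have "\<dots> = (\<integral>u. (\<Sum>i<M. indicator G u *\<^sub>R (\<Sum>c\<in>UNIV. partial c (\<rho> i) u *\<^sub>R w c u + \<rho> i u *\<^sub>R w' c u)) \<partial>lborel)"
    using int by (subst Bochner_Integration.integral_sum) auto
  also have "\<dots> = (\<integral>u. indicator G u *\<^sub>R (\<Sum>c\<in>UNIV. partial c P u *\<^sub>R w c u + P u *\<^sub>R w' c u) \<partial>lborel)"
  proof (intro Bochner_Integration.integral_cong refl)
    fix u
    have "(\<Sum>i<M. \<Sum>c\<in>UNIV. partial c (\<rho> i) u *\<^sub>R w c u + \<rho> i u *\<^sub>R w' c u) =
      (\<Sum>c\<in>UNIV. \<Sum>i<M. partial c (\<rho> i) u *\<^sub>R w c u + \<rho> i u *\<^sub>R w' c u)" by (rule sum.swap)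
    also have "\<dots> = (\<Sum>c\<in>UNIV. partial c P u *\<^sub>R w c u + P u *\<^sub>R w' c u)"
      unfolding P_def by (subst partial_sum_C1) (auto simp: C1 sum.distrib scaleR_sum_left)
    finally show "(\<Sum>i<M. indicator G u *\<^sub>R (\<Sum>c\<in>UNIV. partial c (\<rho> i) u *\<^sub>R w c u + \<rho> i u *\<^sub>R w' c u)) =
      indicator G u *\<^sub>R (\<Sum>c\<in>UNIV. partial c P u *\<^sub>R w c u + P u *\<^sub>R w' c u)"
      by (simp only: scaleR_sum_right[symmetric])
  qed
  finally show ?thesis .
qed

text \<open>The field (1 - P) w vanishes near the frontier, so its divergence integrates to 0 and P
  w may be replaced by w.\<close>

lemma sum_chart_flux_near_frontier:
  fixes w w' :: "'N::finite \<Rightarrow> real ^ 'N \<Rightarrow> 'b::euclidean_space" and M :: nat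
  assumes G: "open G" "bounded G" and w: "stokes_field G E w w'"
    and ch: "\<And>i. i < M \<Longrightarrow> oriented_chart G (U i) (j i) (\<sigma> i) (g i) (\<rho> i)"
    and V: "open V" "frontier G \<subseteq> V" "\<And>u. u \<in> V \<Longrightarrow> (\<Sum>i<M. \<rho> i u) = 1"
  shows "charts_flux M j \<sigma> g \<rho> w =
    (\<integral>u. indicator G u *\<^sub>R (\<Sum>c\<in>UNIV. w' c u) \<partial>lborel)"
proof -
  define P where "P u = (\<Sum>i<M. \<rho> i u)" for u
  have C1_P: "C1 P" unfolding P_def[abs_def]
    by (intro C1_sum) (use ch in \<open>auto simp: oriented_chart_def\<close>)
  let ?Q = "\<lambda>c u. partial c P u *\<^sub>R w c u + P u *\<^sub>R w' c u"
  note fP = stokes_field_scaleR[OF G C1_P w]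
  note fQ = stokes_field_scaleR[OF G C1_diff[OF C1_const[of 1] C1_P] w]
  have "(\<integral>u. indicator G u *\<^sub>R w' c u \<partial>lborel) = (\<integral>u. indicator G u *\<^sub>R ?Q c u \<partial>lborel)" for c
  proof -
    have "0 = (\<integral>u. indicator G u *\<^sub>R (partial c (\<lambda>u. 1 - P u) u *\<^sub>R w c u + (1 - P u) *\<^sub>R w' c u) \<partial>lborel)"
      by (rule integral_divergence_interior[OF G fQ V(1,2), symmetric]) (simp add: V(3) P_def)
    also have "\<dots> = (\<integral>u. indicator G u *\<^sub>R w' c u - indicator G u *\<^sub>R ?Q c u \<partial>lborel)"
      unfolding partial_one_minus_C1[OF C1_P]
      by (intro Bochner_Integration.integral_cong refl) (simp add: algebra_simps)
    also have "\<dots> = (\<integral>u. indicator G u *\<^sub>R w' c u \<partial>lborel) - (\<integral>u. indicator G u *\<^sub>R ?Q c u \<partial>lborel)"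
      by (intro Bochner_Integration.integral_diff stokes_field_integrable[OF G(2) w] stokes_field_integrable[OF G(2) fP])
    finally show ?thesis by simp
  qed
  then have "(\<integral>u. indicator G u *\<^sub>R (\<Sum>c\<in>UNIV. w' c u) \<partial>lborel) = (\<integral>u. indicator G u *\<^sub>R (\<Sum>c\<in>UNIV. ?Q c u) \<partial>lborel)"
    unfolding scaleR_sum_right
    by (subst (1 2) Bochner_Integration.integral_sum)
      (auto intro!: stokes_field_integrable[OF G(2) w] stokes_field_integrable[OF G(2) fP])
  then show ?thesis using sum_chart_flux[OF G w ch] unfolding P_def[abs_def] by simp
qed

text \<open>Here \<open>P\<close> is 1 on the frontier only, and 1 - P need not vanish near it. An
  auxiliary family with sum 1 on a neighbourhood is applied to the field P w: its flux is the
  integral of the divergence of P w, and also the flux of w, because P w and w coincide on the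
  frontier.\<close>

theorem divergence_theorem:
  fixes w w' :: "'N::finite \<Rightarrow> real ^ 'N \<Rightarrow> 'b::euclidean_space" and M :: nat
  assumes G: "open G" "bounded G" "C1_boundary G" and w: "stokes_field G E w w'"
    and ch: "\<And>i. i < M \<Longrightarrow> oriented_chart G (U i) (j i) (\<sigma> i) (g i) (\<rho> i)"
    and one: "\<And>u. u \<in> frontier G \<Longrightarrow> (\<Sum>i<M. \<rho> i u) = 1"
  shows "charts_flux M j \<sigma> g \<rho> w =
    (\<integral>u. indicator G u *\<^sub>R (\<Sum>c\<in>UNIV. w' c u) \<partial>lborel)"
proof -
  obtain M' :: nat and U' j' \<sigma>' g' \<rho>' V where
    ch': "\<And>i. i < M' \<Longrightarrow> oriented_chart G (U' i) (j' i) (\<sigma>' i) (g' i) (\<rho>' i)"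
    and V: "open V" "frontier G \<subseteq> V" "\<And>u. u \<in> V \<Longrightarrow> (\<Sum>i<M'. \<rho>' i u) = 1"
    using exists_partition_of_unity[OF G(2,3)] by metis
  define P where "P u = (\<Sum>i<M. \<rho> i u)" for u
  have C1_P: "C1 P" unfolding P_def[abs_def]
    by (intro C1_sum) (use ch in \<open>auto simp: oriented_chart_def\<close>)
  have "charts_flux M j \<sigma> g \<rho> w =
    (\<integral>u. indicator G u *\<^sub>R (\<Sum>c\<in>UNIV. partial c P u *\<^sub>R w c u + P u *\<^sub>R w' c u) \<partial>lborel)"
    using sum_chart_flux[OF G(1,2) w ch] unfolding P_def[abs_def] .
  also have "\<dots> = charts_flux M' j' \<sigma>' g' \<rho>' (\<lambda>c u. P u *\<^sub>R w c u)"
    by (rule sum_chart_flux_near_frontier[OF G(1,2) stokes_field_scaleR[OF G(1,2) C1_P w] ch' V, symmetric])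
  also have "\<dots> = charts_flux M' j' \<sigma>' g' \<rho>' w"
  proof (intro sum.cong refl Bochner_Integration.integral_cong)
    fix i t assume "i \<in> {..<M'}"
    then have i: "graph_chart G (U' i) (j' i) (\<sigma>' i) (g' i)" "closure {u. \<rho>' i u \<noteq> 0} \<subseteq> U' i"
      using ch' unfolding oriented_chart_def by auto
    let ?u = "graph_map (j' i) (g' i) (insert_zero (j' i) t)"
    \<comment> \<open>Either the graph point lies outside the chart, where the partition function
      vanishes, or it lies on the frontier.\<close>
    have "\<rho>' i ?u = 0 \<or> P ?u = 1"
    proof (rule disjCI)
      assume "P ?u \<noteq> 1"
      then have "?u \<notin> U' i" using graph_point_in_frontier[OF G(1) i(1)] one by (auto simp: P_def)
      then show "\<rho>' i ?u = 0" using i(2) closure_subset[of "{u. \<rho>' i u \<noteq> 0}"] by blast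
    qed
    then show "chart_flux (j' i) (\<sigma>' i) (g' i) (\<rho>' i) (\<lambda>c u. P u *\<^sub>R w c u) t =
      chart_flux (j' i) (\<sigma>' i) (g' i) (\<rho>' i) w t"
      by (auto simp: chart_flux_def Let_def)
  qed
  also have "\<dots> = (\<integral>u. indicator G u *\<^sub>R (\<Sum>c\<in>UNIV. w' c u) \<partial>lborel)"
    by (rule sum_chart_flux_near_frontier[OF G(1,2) w ch' V])
  finally show ?thesis .
qed

section \<open>Forms of degree one and of degree \<open>N - 1\<close>\<close>

lemma minus_one_power_commute: "(- 1) ^ k * x = x * (- 1) ^ k" for x :: "'a::ring_1"
  by (cases "even k") auto

lemma minus_one_power_left_commute: "(- 1) ^ k * (x * y) = x * ((- 1) ^ k * y)" for x :: "'a::ring_1"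
  by (cases "even k") auto

lemma minus_one_power_square: "(- 1) ^ k * ((- 1) ^ k * x) = x" for x :: "'a::ring_1"
  by (cases "even k") auto

lemma wedge_sum_left: "wedge (\<lambda>T. \<Sum>i\<in>I. \<alpha> i T) \<beta> S = (\<Sum>i\<in>I. wedge (\<alpha> i) \<beta> S)"
  unfolding wedge_def by (simp add: sum_distrib_left sum_distrib_right) (rule sum.swap)

lemma wedge_mult_left: "wedge (\<lambda>T. k * \<alpha> T) \<beta> S = k * wedge \<alpha> \<beta> S"
  unfolding wedge_def sum_distrib_left
  by (intro sum.cong refl) (simp only: mult.assoc minus_one_power_left_commute)

lemma wedge_dx:
  fixes \<beta> :: "('N::{finite,wellorder}, 'a::ring_1) form"
  shows "wedge (dx c) \<beta> S = (if c \<in> S then (- 1) ^ card {u \<in> S - {c}. u < c} * \<beta> (S - {c}) else 0)"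
proof -
  have "wedge (dx c) \<beta> S = (\<Sum>T\<in>Pow S. if T = {c} then
     (- 1) ^ card {(t, u). t \<in> T \<and> u \<in> S - T \<and> u < t} * \<beta> (S - T) else 0)"
    unfolding wedge_def basis_form_def by (intro sum.cong) auto
  also have "\<dots> = (if c \<in> S then (- 1) ^ card {(t, u). t \<in> {c} \<and> u \<in> S - {c} \<and> u < t} * \<beta> (S - {c}) else 0)"
    by (subst sum.delta) auto
  also have "card {(t, u). t \<in> {c} \<and> u \<in> S - {c} \<and> u < t} = card {u \<in> S - {c}. u < c}"
  proof -
    have "{(t, u). t \<in> {c} \<and> u \<in> S - {c} \<and> u < t} = Pair c ` {u \<in> S - {c}. u < c}" by auto
    then show ?thesis by (simp add: card_image inj_on_def)
  qed
  finally show ?thesis .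
qed

text \<open>Monomials with a coefficient. Wedging with \<open>dx c\<close> on the left keeps this
  shape or gives 0, so only signs have to be tracked.\<close>

definition scaled_form :: "'a \<Rightarrow> 'N set \<Rightarrow> ('N, 'a::zero) form" where
  "scaled_form k A = (\<lambda>S. if S = A then k else 0)"

lemma basis_form_eq: "basis_form A = scaled_form 1 A"
  by (simp add: basis_form_def scaled_form_def)

lemma wedge_dx_scaled:
  "wedge (dx c) (scaled_form k A) = (if c \<in> A then (\<lambda>_. 0) else
     scaled_form ((- 1) ^ card {u \<in> A. u < c} * k) (insert c A))"
proof
  fix S :: "'a set"
  have 1: "S - {c} = A \<longleftrightarrow> S = insert c A" if "c \<in> S" "c \<notin> A" using that by auto
  have 2: "insert c A - {c} = A" if "c \<notin> A" using that by auto
  show "wedge (dx c) (scaled_form k A) S = (if c \<in> A then (\<lambda>_. 0) else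
     scaled_form ((- 1) ^ card {u \<in> A. u < c} * k) (insert c A)) S"
    unfolding wedge_dx scaled_form_def using 1 2 by auto
qed

lemma wedge_dx_basis_form:
  "c \<in> A \<Longrightarrow> wedge (dx c) (basis_form A) = (\<lambda>_. 0)"
  "c \<notin> A \<Longrightarrow> wedge (dx c) (basis_form A) = scaled_form ((- 1) ^ card {u \<in> A. u < c}) (insert c A)"
  unfolding basis_form_eq[of A] by (simp_all add: wedge_dx_scaled)

text \<open>A sorted list contributes no inversions of its own; the sign counts the pairs of an
  element of \<open>L\<close> and a smaller element of \<open>A\<close>.\<close>

lemma foldr_wedge_dx:
  assumes "sorted L" "distinct L" "A \<inter> set L = {}"
  shows "foldr wedge (map dx L) (scaled_form k A) =
    scaled_form ((- 1) ^ card {(t, u). t \<in> set L \<and> u \<in> A \<and> u < t} * k) (set L \<union> A)"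
  using assms
proof (induction L)
  case (Cons l L)
  have IH: "foldr wedge (map dx L) (scaled_form k A) =
    scaled_form ((- 1) ^ card {(t, u). t \<in> set L \<and> u \<in> A \<and> u < t} * k) (set L \<union> A)"
    using Cons by auto
  have "{u \<in> set L \<union> A. u < l} = {u \<in> A. u < l}" using Cons by auto
  moreover have "{(t, u). t \<in> set (l # L) \<and> u \<in> A \<and> u < t} =
      Pair l ` {u \<in> A. u < l} \<union> {(t, u). t \<in> set L \<and> u \<in> A \<and> u < t}" by auto
  then have "card {(t, u). t \<in> set (l # L) \<and> u \<in> A \<and> u < t} =
      card (Pair l ` {u \<in> A. u < l}) + card {(t, u). t \<in> set L \<and> u \<in> A \<and> u < t}"
    using Cons by (simp only:) (rule card_Un_disjoint, auto)
  then have "card {(t, u). t \<in> set (l # L) \<and> u \<in> A \<and> u < t} =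
      card {u \<in> A. u < l} + card {(t, u). t \<in> set L \<and> u \<in> A \<and> u < t}"
    by (simp add: card_image inj_on_def)
  ultimately show ?case
    using Cons by (simp add: IH wedge_dx_scaled power_add mult.assoc)
qed simp

lemma foldr_wedge_dx_linear:
  "foldr wedge (map dx L) (\<lambda>T. \<Sum>i\<in>I. k i * \<beta> i T) S = (\<Sum>i\<in>I. k i * foldr wedge (map dx L) (\<beta> i) S)"
proof (induction L arbitrary: S)
  case (Cons l L)
  have "foldr wedge (map dx L) (\<lambda>T. \<Sum>i\<in>I. k i * \<beta> i T) = (\<lambda>S. \<Sum>i\<in>I. k i * foldr wedge (map dx L) (\<beta> i) S)"
    using Cons by auto
  then show ?case
    by (simp add: wedge_dx sum_distrib_left mult.assoc[symmetric] minus_one_power_commute[of _ "k _"])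
qed simp

lemma foldr_wedge_sorted:
  "foldr wedge (map dx (sorted_list_of_set T)) (basis_form {}) = basis_form (T :: 'N::{finite,wellorder} set)"
  using foldr_wedge_dx[of "sorted_list_of_set T" "{}" 1]
  by (simp add: basis_form_eq[of "{}"] basis_form_eq[of T])

section \<open>Translations and contractions of the volume form\<close>

lemma partial_translated_coordinate: "partial d (\<lambda>v. (v - x) $ c) u = of_bool (d = c)"
  unfolding partial_def
proof (rule vector_derivative_at)
  have "(\<lambda>t. (u + t *\<^sub>R axis d 1 - x) $ c) = (\<lambda>t. (u $ c - x $ c) + t * of_bool (d = c))"
    by (auto simp: axis_def fun_eq_iff)
  then show "((\<lambda>t. (u + t *\<^sub>R axis d 1 - x) $ c) has_vector_derivative of_bool (d = c)) (at 0)"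
    by (auto intro!: derivative_eq_intros simp: has_vector_derivative_def)
qed

lemma differential_translated_coordinate: "differential (\<lambda>v. (v - x) $ c) u = dx c"
proof
  fix S
  have "differential (\<lambda>v. (v - x) $ c) u S = (\<Sum>d\<in>UNIV. if d = c then dx d S else (0::'b))"
    unfolding differential_def partial_translated_coordinate by (intro sum.cong) auto
  then show "differential (\<lambda>v. (v - x) $ c) u S = (dx c S :: 'b)" by simp
qed

text \<open>The differential of a translation is the identity, so only the coefficients are
  shifted.\<close>

lemma pullback_translation: "pullback (\<lambda>u. u - x) \<omega> u = \<omega> (u - x)"
  unfolding pullback_def differential_translated_coordinate foldr_wedge_sorted
  by (rule ext) (simp add: basis_form_def if_distrib cong: if_cong)

text \<open>The contraction of the volume form with the vector field \<open>w\<close>: the sign is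
  that of moving \<open>dx c\<close> to the front.\<close>

definition flux_form :: "('N::{finite,wellorder} \<Rightarrow> 'a) \<Rightarrow> ('N, 'a::ring_1) form" where
  "flux_form w = (\<lambda>S. \<Sum>c\<in>UNIV. (- 1) ^ card {d. d < c} * w c * basis_form (- {c}) S)"

lemma flux_form_Compl: "flux_form w (- {c}) = (- 1) ^ card {d. d < c} * w c"
proof -
  have "flux_form w (- {c}) = (\<Sum>d\<in>UNIV. if d = c then (- 1) ^ card {d. d < c} * w c else 0)"
    unfolding flux_form_def basis_form_def by (intro sum.cong) auto
  then show ?thesis by simp
qed

lemma flux_form_mult: "x * flux_form w S = flux_form (\<lambda>c. x * w c) S"
  unfolding flux_form_def sum_distrib_left
  by (intro sum.cong refl) (simp only: mult.assoc minus_one_power_left_commute)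

text \<open>Only \<open>dx c\<close> completes the product omitting \<open>c\<close>, and the sign
  of putting it back into place cancels the one in \<open>flux_form\<close>. The order of the
  factors is kept, since elements of the algebra need not commute.\<close>

lemma wedge_one_form_flux_form:
  "wedge (\<lambda>S. \<Sum>i\<in>I. k i * dx (f i) S) (flux_form w) UNIV = (\<Sum>i\<in>I. k i * w (f i))"
proof -
  have "wedge (dx c) (flux_form w) UNIV = w c" for c
  proof -
    have "{u. u \<noteq> c \<and> u < c} = {u. u < c}" by auto
    then show ?thesis
      unfolding wedge_dx by (simp add: Compl_eq_Diff_UNIV[symmetric] flux_form_Compl minus_one_power_square)
  qed
  then show ?thesis by (simp add: wedge_sum_left wedge_mult_left)
qed

section \<open>Pullback to a graph\<close>

lemma partial_graph_map:
  "c \<noteq> j \<Longrightarrow> partial d (\<lambda>v. graph_map j g v $ c) u = of_bool (d = c)"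
  "partial d (\<lambda>v. graph_map j g v $ j) u = partial d g u"
proof -
  show "partial d (\<lambda>v. graph_map j g v $ j) u = partial d g u"
    by (simp add: graph_map_def)
  assume "c \<noteq> j"
  then show "partial d (\<lambda>v. graph_map j g v $ c) u = of_bool (d = c)"
    using partial_translated_coordinate[of d 0 c u] by (simp add: graph_map_def)
qed

lemma differential_graph_map:
  assumes "c \<noteq> j" shows "differential (\<lambda>v. graph_map j g v $ c) u = dx c"
proof -
  have "differential (\<lambda>v. graph_map j g v $ c) u = differential (\<lambda>v. (v - 0) $ c) u"
    unfolding differential_def partial_graph_map(1)[OF assms] partial_translated_coordinate ..
  then show ?thesis by (simp only: differential_translated_coordinate)
qed

lemma card_less_between:
  fixes c d :: "'N::{finite,wellorder}"
  assumes "c < d"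
  shows "card {u. u < d} = Suc (card {u. u < c} + card {u. c < u \<and> u < d})"
proof -
  have "{u. u < d} = insert c ({u. u < c} \<union> {u. c < u \<and> u < d})" using assms by auto
  moreover have "{u. u < c} \<inter> {u. c < u \<and> u < d} = {}" by auto
  ultimately show ?thesis by (simp add: card_Un_disjoint)
qed

text \<open>\<open>P d\<close> is the coefficient at \<open>- {j}\<close> of the pullback of the
  product of all \<open>dx c\<close> with c \<noteq> d. For d \<noteq> j the factor
  \<open>dx j\<close> becomes dg, of which only the \<open>dx d\<close> term contributes: the other
  terms repeat a factor or contain \<open>dx j\<close>. Moving \<open>dx d\<close> from the place of
  \<open>j\<close> to its own crosses the coordinates strictly between the two, and this fixes the
  sign.\<close>

lemma foldr_wedge_graph:
  fixes j d :: "'N::{finite,wellorder}" and g :: "real ^ 'N::_ \<Rightarrow> real" and u :: "real ^ 'N::_"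
  defines "P \<equiv> \<lambda>d. foldr wedge (map (\<lambda>c. differential (\<lambda>v. graph_map j g v $ c) u :: ('N, 'a::real_algebra_1) form)
     (sorted_list_of_set (- {d}))) (basis_form {}) (- {j})"
  shows "P j = 1"
    and "d \<noteq> j \<Longrightarrow> (- 1) ^ card {c. c < d} * P d = - ((- 1) ^ card {c. c < j}) * of_real (partial d g u)"
proof -
  let ?D = "\<lambda>c. differential (\<lambda>v. graph_map j g v $ c) u :: ('N, 'a) form"
  have "map ?D (sorted_list_of_set (- {j})) = map dx (sorted_list_of_set (- {j}))"
    by (intro map_cong refl differential_graph_map) auto
  then show "P j = 1" unfolding P_def by (simp only: foldr_wedge_sorted) (simp add: basis_form_def)
  assume d: "d \<noteq> j"
  let ?A = "{c. c \<noteq> d \<and> c < j}" and ?B = "{c. c \<noteq> d \<and> j < c}"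
  let ?L1 = "sorted_list_of_set ?A" and ?L2 = "sorted_list_of_set ?B"
  have split: "sorted_list_of_set (- {d}) = ?L1 @ j # ?L2"
    by (rule sorted_distinct_set_unique) (use d in \<open>auto simp: sorted_append\<close>)
  have m1: "map ?D ?L1 = map dx ?L1" and m2: "map ?D ?L2 = map dx ?L2"
    by (intro map_cong refl differential_graph_map, force)+
  let ?\<gamma> = "\<lambda>c. wedge (dx c) (basis_form ?B) :: ('N, 'a) form"
  have Dj: "?D j = (\<lambda>S. \<Sum>c\<in>UNIV. of_real (partial c g u) * dx c S)"
    unfolding differential_def partial_graph_map ..
  have "foldr wedge (map ?D (sorted_list_of_set (- {d}))) (basis_form {}) =
      foldr wedge (map dx ?L1) (wedge (?D j) (basis_form ?B))"
    unfolding split by (simp add: m1 m2 foldr_wedge_sorted)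
  also have "wedge (?D j) (basis_form ?B) = (\<lambda>S. \<Sum>c\<in>UNIV. of_real (partial c g u) * ?\<gamma> c S)"
    unfolding Dj by (rule ext) (simp only: wedge_sum_left wedge_mult_left)
  finally have Pd: "P d = (\<Sum>c\<in>UNIV. of_real (partial c g u) * foldr wedge (map dx ?L1) (?\<gamma> c) (- {j}))"
    unfolding P_def by (simp only: foldr_wedge_dx_linear)
  \<comment> \<open>At most one of the two counts is non-zero, depending on the order of
    \<open>j\<close> and \<open>d\<close>; carrying both postpones the case distinction to the final
    sign.\<close>
  let ?e1 = "card {u. j < u \<and> u < d}" and ?e2 = "card {u. d < u \<and> u < j}"
  have val: "foldr wedge (map dx ?L1) (?\<gamma> c) (- {j}) = (if c = d then (- 1) ^ (?e1 + ?e2) else 0)" for c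
  proof (cases "c \<in> ?B \<or> c \<in> ?A")
    case True
    then show ?thesis
    proof
      assume B: "c \<in> ?B"
      have "foldr wedge (map dx ?L1) (\<lambda>_. 0 :: 'a) (- {j}) = 0"
        using foldr_wedge_dx_linear[of ?L1 "\<lambda>_. 0" "\<lambda>_ _. 0" "{}"] by auto
      moreover have "?\<gamma> c = (\<lambda>_. 0)"
        using B by (rule wedge_dx_basis_form)
      ultimately show ?thesis using B by simp
    next
      assume A: "c \<in> ?A"
      \<comment> \<open>Rather than moving the repeated factor next to its twin, one observes that
        \<open>d\<close> occurs nowhere in the product, whereas \<open>- {j}\<close> contains
        it.\<close>
      have ne: "foldr wedge (map dx L) (scaled_form k X) S = 0" if "j \<in> X \<or> d \<notin> X \<and> d \<notin> set L" "S = - {j}"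
        for L :: "'N list" and k :: 'a and X S
        using that
      proof (induction L arbitrary: S k X rule: rev_induct)
        case Nil
        then show ?case using d by (auto simp: scaled_form_def)
      next
        case (snoc l L)
        have z: "foldr wedge (map dx L) (\<lambda>_. 0 :: 'a) = (\<lambda>_. 0)"
          using foldr_wedge_dx_linear[of L "\<lambda>_. 0" "\<lambda>_ _. 0" "{}"] by auto
        show ?case using snoc.prems snoc.IH z by (auto simp: wedge_dx_scaled)
      qed
      have "c \<notin> ?B" using A by auto
      then have "?\<gamma> c = scaled_form ((- 1) ^ card {u \<in> ?B. u < c}) (insert c ?B)"
        by (rule wedge_dx_basis_form)
      moreover have "d \<notin> insert c ?B" "d \<notin> set ?L1" "c \<noteq> d" using A by auto
      ultimately show ?thesis by (simp only: ne simp_thms if_False)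
    qed
  next
    case False
    then have c: "c = d \<or> c = j" by (cases c j rule: linorder_cases) auto
    have "?\<gamma> c = scaled_form ((- 1) ^ card {u \<in> ?B. u < c}) (insert c ?B)"
      using False by (intro wedge_dx_basis_form) auto
    then have f1: "foldr wedge (map dx ?L1) (?\<gamma> c) =
      scaled_form ((- 1) ^ card {(t, u). t \<in> ?A \<and> u \<in> insert c ?B \<and> u < t} *
         (- 1) ^ card {u \<in> ?B. u < c}) (?A \<union> insert c ?B)"
      using False by (simp only:) (subst foldr_wedge_dx, auto)
    have f2: "- {j} = ?A \<union> insert c ?B \<longleftrightarrow> c = d"
      using c d by (auto simp: set_eq_iff)
    have f3: "card {(t, u). t \<in> ?A \<and> u \<in> insert d ?B \<and> u < t} = ?e2"
    proof -
      have "{(t, u). t \<in> ?A \<and> u \<in> insert d ?B \<and> u < t} = (\<lambda>t. (t, d)) ` {u. d < u \<and> u < j}"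
        by auto
      then show ?thesis by (simp add: card_image inj_on_def)
    qed
    have f4: "{u \<in> ?B. u < d} = {u. j < u \<and> u < d}" by auto
    show ?thesis
    proof (cases "c = d")
      case True
      then have "- {j} = ?A \<union> insert d ?B" using f2 by blast
      then show ?thesis
        unfolding True f1[unfolded True] f3 f4 scaled_form_def
        by (simp only: if_True simp_thms power_add[symmetric] add.commute[of ?e2])
    next
      case False
      then have "- {j} \<noteq> ?A \<union> insert c ?B" using f2 by blast
      then show ?thesis using False unfolding f1 scaled_form_def by (simp only: if_False simp_thms)
    qed
  qed
  have "P d = of_real (partial d g u) * (- 1) ^ (?e1 + ?e2)"
    unfolding Pd val by (simp add: if_distrib cong: if_cong)
  moreover have "(- 1) ^ card {c. c < d} * (- 1 :: 'a) ^ (?e1 + ?e2) = - ((- 1) ^ card {c. c < j})"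
  proof (cases j d rule: linorder_cases)
    case less
    then have e2: "?e2 = 0" by (auto simp: card_eq_0_iff)
    show ?thesis unfolding card_less_between[OF less] e2 add_0_right
      by (cases "even (card {u. u < j})"; cases "even ?e1") auto
  next
    case greater
    then have e1: "?e1 = 0" by (auto simp: card_eq_0_iff)
    show ?thesis unfolding card_less_between[OF greater] e1 add_0_left by (simp add: power_add)
  qed (use d in simp)
  ultimately show "(- 1) ^ card {c. c < d} * P d = - ((- 1) ^ card {c. c < j}) * of_real (partial d g u)"
    by (simp only: minus_one_power_left_commute mult_minus_right mult_minus_left)
      (rule arg_cong[of _ _ uminus], rule minus_one_power_commute[symmetric])
qed

text \<open>Up to the sign of moving \<open>dx j\<close> to the front this is the field paired with
  e_j - grad g, the density in \<open>chart_flux\<close>; it links integrals of forms with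
  fluxes.\<close>

lemma pullback_graph_flux_form:
  fixes w :: "real ^ 'N::{finite,wellorder} \<Rightarrow> 'N \<Rightarrow> 'a::real_algebra_1"
  shows "pullback (graph_map j g) (\<lambda>u. flux_form (w u)) v (- {j}) =
    (- 1) ^ card {c. c < j} * (w (graph_map j g v) j -
      (\<Sum>c\<in>-{j}. of_real (partial c g v) * w (graph_map j g v) c))"
proof -
  let ?w = "w (graph_map j g v)"
  let ?P = "\<lambda>T. foldr wedge (map (\<lambda>c. differential (\<lambda>v. graph_map j g v $ c) v) (sorted_list_of_set T))
     (basis_form {}) (- {j}) :: 'a"
  have "pullback (graph_map j g) (\<lambda>u. flux_form (w u)) v (- {j}) =
      (\<Sum>T\<in>UNIV. \<Sum>c\<in>UNIV. (- 1) ^ card {d. d < c} * ?w c * (if T = - {c} then 1 else 0) * ?P T)"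
    unfolding pullback_def flux_form_def basis_form_def[of "- {_}"] sum_distrib_right ..
  also have "\<dots> = (\<Sum>c\<in>UNIV. \<Sum>T\<in>UNIV. if T = - {c} then (- 1) ^ card {d. d < c} * ?w c * ?P T else 0)"
    by (subst sum.swap) (intro sum.cong refl, auto)
  also have "\<dots> = (\<Sum>c\<in>UNIV. (- 1) ^ card {d. d < c} * ?w c * ?P (- {c}))"
    by simp
  also have "\<dots> = (\<Sum>c\<in>UNIV. ?w c * ((- 1) ^ card {d. d < c} * ?P (- {c})))"
    by (intro sum.cong refl) (simp only: mult.assoc minus_one_power_left_commute)
  also have "\<dots> = ?w j * ((- 1) ^ card {d. d < j} * ?P (- {j})) +
      (\<Sum>c\<in>UNIV - {j}. ?w c * ((- 1) ^ card {d. d < c} * ?P (- {c})))"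
    by (rule sum.remove) auto
  also have "?w j * ((- 1) ^ card {d. d < j} * ?P (- {j})) = (- 1) ^ card {d. d < j} * ?w j"
    using foldr_wedge_graph(1)[where ?'a = 'a, of j g v]
    by (simp only: mult_1_right) (rule minus_one_power_commute[symmetric])
  also have "(\<Sum>c\<in>UNIV - {j}. ?w c * ((- 1) ^ card {d. d < c} * ?P (- {c}))) =
      (\<Sum>c\<in>-{j}. - ((- 1) ^ card {d. d < j} * (of_real (partial c g v) * ?w c)))"
  proof (rule sum.cong)
    fix c assume "c \<in> - {j}"
    then have "?w c * ((- 1) ^ card {d. d < c} * ?P (- {c})) = ?w c * (- ((- 1) ^ card {c. c < j}) * of_real (partial c g v))"
      by (subst foldr_wedge_graph(2)) auto
    also have "\<dots> = - ((- 1) ^ card {d. d < j} * (of_real (partial c g v) * ?w c))"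
      by (cases "even (card {c. c < j})") (auto simp: Reals_def of_real_def)
    finally show "?w c * ((- 1) ^ card {d. d < c} * ?P (- {c})) =
      - ((- 1) ^ card {d. d < j} * (of_real (partial c g v) * ?w c))" .
  qed auto
  finally show ?thesis by (simp add: sum_negf right_diff_distrib sum_distrib_left)
qed

section \<open>The coefficients of the kernel\<close>

lemma wedge_dx_basis_form_eq:
  "c \<notin> A \<Longrightarrow> wedge (dx c) (basis_form A) S = (- 1) ^ card {u \<in> A. u < c} * basis_form (insert c A) S"
  by (simp add: wedge_dx_basis_form scaled_form_def basis_form_def[of "insert c A"])

lemma minus_one_power_pull:
  fixes x y z :: "'a::ring_1"
  shows "z * ((- 1) ^ l * x * ((- 1) ^ m * y)) = (- 1) ^ l * ((- 1) ^ m * (z * x * y))"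
    and "(- 1) ^ l * x * ((- 1) ^ m * y) = (- 1) ^ (m + l) * x * y"
  by (cases "even l"; cases "even m"; auto simp: mult.assoc)+

lemma minus_one_power_parity:
  "even (l + m) \<longleftrightarrow> odd k \<Longrightarrow> (- 1) ^ l * ((- 1) ^ m * x) = - ((- 1) ^ k * x)" for x :: "'a::ring_1"
  by (cases "even l"; cases "even m"; cases "even k") auto

abbreviation rank :: "'N::{finite,wellorder} \<Rightarrow> nat" where
  "rank c \<equiv> card {d. d < c}"

lemma rank_diff: "d < (c :: 'N::{finite,wellorder}) \<Longrightarrow> rank c = rank d + card {u. d < u \<and> u \<le> c}"
proof -
  assume "d < c"
  then have "{u. d < u \<and> u \<le> c} = insert c {u. d < u \<and> u < c}" by auto
  then show ?thesis using card_less_between[OF \<open>d < c\<close>] by simp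
qed

text \<open>
  The coordinates fall into blocks, \<open>{y\<^sub>i\<^sup>k. k \<le> p}\<close> and \<open>{\<theta>\<^sub>i\<^sup>l. s\<^sub>k \<le> l < s\<^sub>k\<^sub>+\<^sub>1}\<close>; \<open>hd c\<close> is the first
  coordinate of the block of \<open>c\<close>, and \<open>b c\<close> is \<open>e\<^sub>k\<close> or \<open>a\<^sub>l\<close>.
\<close>

locale block_structure =
  fixes hd :: "'N::{finite,wellorder} \<Rightarrow> 'N" and b :: "'N \<Rightarrow> 'a::{euclidean_space,real_algebra_1}"
  assumes hd_hd: "hd (hd c) = hd c" and hd_le: "hd c \<le> c"
    and b_head: "hd c = c \<Longrightarrow> b c = 1" and b_central: "b c * z = z * b c"
    and b_square: "hd d = d \<Longrightarrow> (\<Sum>c | hd c = d. b c * b c) = 0"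
begin

definition tail :: "'N \<Rightarrow> 'N set" where
  "tail d = {c. hd c = d \<and> hd c \<noteq> c}"

text \<open>The antisymmetric part couples the head of a block with each other coordinate
  \<open>c\<close> of the block: entry \<open>b c\<close> in row \<open>c\<close>, entry
  -\<open>b c\<close> in the row of the head. If \<open>c\<close> is not a head, its
  \<open>tail\<close> is empty and the last sum vanishes.\<close>

definition W :: "'N \<Rightarrow> real ^ 'N::_ \<Rightarrow> 'a" where
  "W c v = v $ c *\<^sub>R 1 + (if hd c = c then 0 else v $ hd c *\<^sub>R b c) - (\<Sum>d\<in>tail c. v $ d *\<^sub>R b d)"

lemma block_eq: "hd d = d \<Longrightarrow> {c. hd c = d} = insert d (tail d)" "d \<notin> tail d"
  by (auto simp: tail_def)

text \<open>The head contributes the square of 1, so the other coefficients act jointly like an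
  imaginary unit. Here the vanishing sums of squares enter.\<close>

lemma tail_square: "hd d = d \<Longrightarrow> (\<Sum>c\<in>tail d. b c * b c) = - 1"
  using b_square[of d] block_eq[of d] by (simp add: b_head add_eq_0_iff)

lemma tail_empty: "hd c \<noteq> c \<Longrightarrow> tail c = {}"
  using hd_hd by (auto simp: tail_def)

lemma W_tail: "hd c \<noteq> c \<Longrightarrow> W c v = v $ c *\<^sub>R 1 + v $ hd c *\<^sub>R b c"
  by (simp add: W_def tail_empty)

lemma W_head: "hd d = d \<Longrightarrow> W d v = v $ d *\<^sub>R 1 - (\<Sum>c\<in>tail d. v $ c *\<^sub>R b c)"
  by (simp add: W_def)

lemma sum_tail: "(\<Sum>d | hd d = d. \<Sum>c\<in>tail d. f c) = (\<Sum>c | hd c \<noteq> c. f c)"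
proof -
  have "(\<Sum>d | hd d = d. \<Sum>c\<in>{c\<in>{c. hd c \<noteq> c}. hd c = d}. f c) = (\<Sum>c | hd c \<noteq> c. f c)"
    by (rule sum.group) (auto simp: hd_hd)
  then show ?thesis by (simp add: tail_def conj_commute)
qed

lemma sum_heads_tails: "(\<Sum>c\<in>UNIV. f c) = (\<Sum>d | hd d = d. f d) + (\<Sum>c | hd c \<noteq> c. f c)"
  by (subst sum.union_disjoint[symmetric]) (auto intro: sum.cong)

text \<open>Multiplying a tail component by \<open>b c\<close> gives \<open>v $ c\<close> times
  \<open>b c\<close> plus \<open>v $ d\<close> times the square of \<open>b c\<close>; summed over
  the tail, the squares give -1 and the result is minus the head component.\<close>

lemma W_head_eq: "hd d = d \<Longrightarrow> W d v = - (\<Sum>c\<in>tail d. b c * W c v)"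
proof -
  assume d: "hd d = d"
  have "(\<Sum>c\<in>tail d. b c * W c v) = (\<Sum>c\<in>tail d. v $ c *\<^sub>R b c + v $ d *\<^sub>R (b c * b c))"
    by (intro sum.cong refl) (auto simp: W_tail tail_def distrib_left)
  also have "\<dots> = (\<Sum>c\<in>tail d. v $ c *\<^sub>R b c) - v $ d *\<^sub>R 1"
    by (simp add: sum.distrib scaleR_sum_right[symmetric] tail_square[OF d])
  finally show ?thesis using d by (simp add: W_head)
qed

text \<open>With \<open>F c\<close> the partial derivatives of a function, the left side is d''
  paired with the kernel and the right side is the full differential. The correction terms of a
  block add up to the term of its head by \<open>W_head_eq\<close>, once the central
  \<open>b c\<close> has been moved past \<open>F (hd c)\<close>.\<close>

lemma sum_tail_derivations:
  "(\<Sum>c | hd c \<noteq> c. (F c - b c * F (hd c)) * W c v) = (\<Sum>c\<in>UNIV. F c * W c v)"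
proof -
  have "(\<Sum>d | hd d = d. F d * W d v) = (\<Sum>d | hd d = d. \<Sum>c\<in>tail d. - (b c * F (hd c) * W c v))"
  proof (rule sum.cong)
    fix d assume "d \<in> {d. hd d = d}"
    then have "F d * W d v = (\<Sum>c\<in>tail d. - (F d * (b c * W c v)))"
      by (subst W_head_eq) (auto simp: sum_distrib_left sum_negf)
    also have "\<dots> = (\<Sum>c\<in>tail d. - (b c * F (hd c) * W c v))"
      by (intro sum.cong refl) (auto simp: tail_def b_central mult.assoc)
    finally show "F d * W d v = (\<Sum>c\<in>tail d. - (b c * F (hd c) * W c v))" .
  qed simp
  also have "\<dots> = (\<Sum>c | hd c \<noteq> c. - (b c * F (hd c) * W c v))" by (rule sum_tail)
  finally show ?thesis
    by (simp add: sum_heads_tails sum.distrib[symmetric] algebra_simps)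
qed

text \<open>The cross terms between a head and the rest of its block occur twice, with opposite
  signs.\<close>

lemma sum_coordinate_W: "(\<Sum>c\<in>UNIV. v $ c *\<^sub>R W c v) = (v \<bullet> v) *\<^sub>R 1"
proof -
  have "(\<Sum>c\<in>UNIV. v $ c *\<^sub>R W c v) = (\<Sum>d | hd d = d. v $ d *\<^sub>R W d v) + (\<Sum>c | hd c \<noteq> c. v $ c *\<^sub>R W c v)"
    by (rule sum_heads_tails)
  also have "(\<Sum>d | hd d = d. v $ d *\<^sub>R W d v) = (\<Sum>d | hd d = d. (v $ d * v $ d) *\<^sub>R 1) -
      (\<Sum>d | hd d = d. \<Sum>c\<in>tail d. (v $ hd c * v $ c) *\<^sub>R b c)"
    unfolding sum_subtractf[symmetric]
    by (intro sum.cong refl) (auto simp: W_head scaleR_right_diff_distrib scaleR_sum_right tail_def intro!: sum.cong)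
  also have "(\<Sum>d | hd d = d. \<Sum>c\<in>tail d. (v $ hd c * v $ c) *\<^sub>R b c) = (\<Sum>c | hd c \<noteq> c. (v $ hd c * v $ c) *\<^sub>R b c)"
    by (rule sum_tail)
  also have "(\<Sum>c | hd c \<noteq> c. v $ c *\<^sub>R W c v) =
      (\<Sum>c | hd c \<noteq> c. (v $ c * v $ c) *\<^sub>R 1) + (\<Sum>c | hd c \<noteq> c. (v $ hd c * v $ c) *\<^sub>R b c)"
    unfolding sum.distrib[symmetric]
    by (intro sum.cong refl) (auto simp: W_tail scaleR_right_distrib mult.commute)
  finally have "(\<Sum>c\<in>UNIV. v $ c *\<^sub>R W c v) = (\<Sum>c\<in>UNIV. (v $ c * v $ c) *\<^sub>R 1)"
    by (simp add: sum_heads_tails[of "\<lambda>c. (v $ c * v $ c) *\<^sub>R 1"])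
  then show ?thesis by (simp add: inner_vec_def scaleR_sum_left)
qed

text \<open>The antisymmetric part has zero diagonal, so the coordinate \<open>c\<close> enters
  \<open>W c\<close> through the identity part alone.\<close>

lemma W_line: "W c (v + t *\<^sub>R axis c 1) = W c v + t *\<^sub>R 1"
proof -
  have "(\<Sum>d\<in>tail c. (v + t *\<^sub>R axis c 1) $ d *\<^sub>R b d) = (\<Sum>d\<in>tail c. v $ d *\<^sub>R b d)"
    by (intro sum.cong refl) (auto simp: axis_def tail_def)
  then show ?thesis by (auto simp: W_def axis_def algebra_simps)
qed

lemma bounded_linear_W: "bounded_linear (W c)"
proof -
  have "linear (W c)"
    unfolding W_def[abs_def]
    by (intro linear_compose_sub linear_compose_add linear_compose_sum ballI linearI)
      (auto simp: linear_iff algebra_simps)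
  then show ?thesis by (simp add: linear_conv_bounded_linear)
qed

abbreviation rank_sign :: "'N \<Rightarrow> 'a" where
  "rank_sign c \<equiv> (- 1) ^ rank c"

text \<open>A form omitting \<open>d\<close> and \<open>c\<close> is completed only by
  \<open>dx d\<close>, which yields the component of \<open>c\<close>, or by \<open>dx c\<close>,
  which contributes to the component of the head. The number of coordinates after \<open>d\<close>
  up to \<open>c\<close> turns the sign of \<open>d\<close> into that of \<open>c\<close> in the
  first case. In the second case the signs leave minus that of \<open>d\<close>, and the tail sum is
  minus \<open>W d v\<close>.\<close>

lemma block_form:
  assumes d: "hd d = d"
  shows "wedge (\<lambda>S. \<Sum>c\<in>insert d (tail d). b c * dx c S)
      (\<lambda>T. \<Sum>c\<in>tail d. (- 1) ^ card {u. d < u \<and> u \<le> c} *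
        (v $ c *\<^sub>R 1 + v $ d *\<^sub>R b c) * omit2 d c T) S =
    (\<Sum>c\<in>insert d (tail d). rank_sign c * W c v * basis_form (- {c}) S)"
proof -
  let ?k = "\<lambda>c. (- 1) ^ card {u. d < u \<and> u \<le> c} * (v $ c *\<^sub>R 1 + v $ d *\<^sub>R b c)"
  let ?E = "\<lambda>c' c. wedge (dx c') (omit2 d c) S :: 'a"
  have lt: "d < c" if "c \<in> tail d" for c
    using that hd_le[of c] by (auto simp: tail_def order_less_le)
  have linear: "wedge (dx c') (\<lambda>T. \<Sum>c\<in>tail d. ?k c * omit2 d c T) S = (\<Sum>c\<in>tail d. ?k c * ?E c' c)" for c'
    using foldr_wedge_dx_linear[of "[c']" ?k "\<lambda>c. omit2 d c" "tail d" S] by simp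
  have Ed: "?E d c = rank_sign d * basis_form (- {c}) S" if "c \<in> tail d" for c
  proof -
    have "{u \<in> UNIV - {d, c}. u < d} = {u. u < d}" using lt[OF that] by auto
    moreover have "insert d (UNIV - {d, c}) = - {c}" using lt[OF that] by auto
    ultimately show ?thesis by (subst wedge_dx_basis_form_eq) simp_all
  qed
  have Ec: "b c' * (?k c * ?E c' c) = (if c' = c then - (rank_sign d * (v $ c *\<^sub>R b c + v $ d *\<^sub>R (b c * b c)) * basis_form (- {d}) S) else 0)"
    if c: "c \<in> tail d" and c': "c' \<in> tail d" for c c'
  proof (cases "c' = c")
    case True
    have "{u. u < c} = insert d {u \<in> UNIV - {d, c}. u < c}" using lt[OF c] by auto
    then have 1: "rank c = Suc (card {u \<in> UNIV - {d, c}. u < c})"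
      using lt[OF c] by simp
    let ?m = "card {u \<in> UNIV - {d, c}. u < c}" and ?l = "card {u. d < u \<and> u \<le> c}"
    have "insert c (UNIV - {d, c}) = - {d}" using lt[OF c] by auto
    then have E: "?E c c = (- 1) ^ ?m * basis_form (- {d}) S"
      by (subst wedge_dx_basis_form_eq) simp_all
    have s: "(- 1) ^ ?l * ((- 1) ^ ?m * x) = - (rank_sign d * x)" for x
    proof -
      \<comment> \<open>\<open>?m\<close> is \<open>rank c - 1\<close> and \<open>?l\<close> is
        \<open>rank c - rank d\<close>, so the sum has the parity of
        \<open>rank d + 1\<close>.\<close>
      have "even (?l + ?m) \<longleftrightarrow> odd (card {u. u < d})" using 1 rank_diff[OF lt[OF c]] by presburger
      then show ?thesis by (rule minus_one_power_parity)
    qed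
    let ?x = "v $ c *\<^sub>R 1 + v $ d *\<^sub>R b c"
    have "b c * (?k c * ?E c c) = (- 1) ^ ?l * ((- 1) ^ ?m * (b c * ?x * basis_form (- {d}) S))"
      unfolding E by (rule minus_one_power_pull)
    also have "\<dots> = - (rank_sign d * (b c * ?x) * basis_form (- {d}) S)"
      unfolding s by (simp only: mult.assoc)
    finally show ?thesis using True by (simp add: distrib_left)
  next
    case False
    then show ?thesis using lt[OF c'] by (simp add: wedge_dx_basis_form)
  qed
  have k: "?k c * (rank_sign d * basis_form (- {c}) S) = rank_sign c * W c v * basis_form (- {c}) S"
    if c: "c \<in> tail d" for c
  proof -
    have "W c v = v $ c *\<^sub>R 1 + v $ d *\<^sub>R b c" using c by (auto simp: W_tail tail_def)
    then show ?thesis unfolding rank_diff[OF lt[OF c]] by (simp only: minus_one_power_pull)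
  qed
  have "wedge (\<lambda>S. \<Sum>c\<in>insert d (tail d). b c * dx c S) (\<lambda>T. \<Sum>c\<in>tail d. ?k c * omit2 d c T) S =
      (\<Sum>c'\<in>insert d (tail d). b c' * (\<Sum>c\<in>tail d. ?k c * ?E c' c))"
    unfolding wedge_sum_left wedge_mult_left linear ..
  also have "\<dots> = (\<Sum>c\<in>tail d. ?k c * ?E d c) + (\<Sum>c'\<in>tail d. \<Sum>c\<in>tail d. b c' * (?k c * ?E c' c))"
    using block_eq(2) d by (simp add: b_head sum_distrib_left)
  also have "(\<Sum>c\<in>tail d. ?k c * ?E d c) = (\<Sum>c\<in>tail d. rank_sign c * W c v * basis_form (- {c}) S)"
    by (intro sum.cong refl) (simp only: Ed k)
  also have "(\<Sum>c'\<in>tail d. \<Sum>c\<in>tail d. b c' * (?k c * ?E c' c)) =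
      (\<Sum>c'\<in>tail d. \<Sum>c\<in>tail d. if c' = c then - (rank_sign d * (v $ c *\<^sub>R b c + v $ d *\<^sub>R (b c * b c)) * basis_form (- {d}) S) else 0)"
    by (intro sum.cong refl Ec)
  also have "\<dots> = (\<Sum>c\<in>tail d. - (rank_sign d * (v $ c *\<^sub>R b c + v $ d *\<^sub>R (b c * b c)) * basis_form (- {d}) S))"
    by (intro sum.cong refl) (simp add: sum.delta)
  also have "\<dots> = - (rank_sign d * (\<Sum>c\<in>tail d. v $ c *\<^sub>R b c + v $ d *\<^sub>R (b c * b c)) * basis_form (- {d}) S)"
    by (simp only: sum_negf sum_distrib_left sum_distrib_right)
  also have "(\<Sum>c\<in>tail d. v $ c *\<^sub>R b c + v $ d *\<^sub>R (b c * b c)) = - W d v"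
    using d by (simp add: W_head sum.distrib scaleR_sum_right[symmetric] tail_square)
  finally show ?thesis using block_eq(2) by simp
qed

lemma sum_blocks: "(\<Sum>d | hd d = d. \<Sum>c\<in>insert d (tail d). f c) = (\<Sum>c\<in>UNIV. f c)"
  using block_eq(2) by (simp add: sum.distrib sum_tail sum_heads_tails[of f])

end

section \<open>Positions of the coordinates\<close>

lemma rank_nth_index:
  assumes k: "k < CARD('N)"
  shows "rank (nth_index k :: 'N::{finite,wellorder}) = k"
proof -
  let ?xs = "sorted_list_of_set (UNIV :: 'N set)"
  have len: "length ?xs = CARD('N)" and set: "set ?xs = UNIV" and dist: "distinct ?xs"
    by simp_all
  have less: "?xs ! i < ?xs ! k \<longleftrightarrow> i < k" if "i < CARD('N)" for i
    using sorted_wrt_nth_less[OF strict_sorted_list_of_set[of "UNIV :: 'N set"]] that len k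
    by (metis linorder_neqE_nat order_less_asym order_less_irrefl)
  have "{c. c < ?xs ! k} = (!) ?xs ` {..<k}"
  proof (intro set_eqI iffI)
    fix c assume "c \<in> {c. c < ?xs ! k}"
    moreover obtain i where "i < CARD('N)" "c = ?xs ! i"
      using set len by (metis UNIV_I in_set_conv_nth)
    ultimately show "c \<in> (!) ?xs ` {..<k}" using less k by auto
  qed (use less k in auto)
  moreover have "inj_on ((!) ?xs) {..<k}"
    using dist k len by (auto intro!: inj_on_nth)
  ultimately show ?thesis by (simp add: nth_index_def card_image)
qed

lemma nth_index_rank: "nth_index (rank c) = (c :: 'N::{finite,wellorder})"
proof -
  let ?xs = "sorted_list_of_set (UNIV :: 'N set)"
  have "c \<in> set ?xs" "length ?xs = CARD('N)" by simp_all
  then obtain i where "i < CARD('N)" "c = ?xs ! i" by (metis in_set_conv_nth)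
  then show ?thesis using rank_nth_index[where ?'N = 'N, of i] by (simp add: nth_index_def)
qed

lemma rank_less_CARD: "rank (c :: 'N::{finite,wellorder}) < CARD('N)"
  by (rule psubset_card_mono) auto

lemma rank_le_imp_le: "rank c \<le> rank d \<Longrightarrow> c \<le> (d :: 'N::{finite,wellorder})"
proof (rule leI, rule notI)
  assume le: "rank c \<le> rank d" and less: "d < c"
  have "rank c = Suc (rank d + card {u. d < u \<and> u < c})" by (rule card_less_between[OF less])
  with le show False by linarith
qed

lemma rank_less_imp_less: "rank c < rank d \<Longrightarrow> c < (d :: 'N::{finite,wellorder})"
  using rank_le_imp_le[of c d] by (cases "c = d") auto

text \<open>Decoded from the position alone. In the odd part \<open>l\<close> is the upper index of
  the coordinate, counted from 1, and the maximum is the last block start not exceeding it; stepping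
  back by the difference lands on the head.\<close>

definition block_head ::
  "nat \<Rightarrow> nat \<Rightarrow> nat \<Rightarrow> nat \<Rightarrow> (nat \<Rightarrow> nat) \<Rightarrow> 'N::{finite,wellorder} \<Rightarrow> 'N" where
  "block_head n p q r s c = (if rank c < n * (p + 1) then nth_index (rank c - rank c mod (p + 1))
     else let l = (rank c - n * (p + 1)) mod q + 1
       in nth_index (rank c - (l - Max {s k |k. k \<in> {1..r} \<and> s k \<le> l})))"

definition block_coeff ::
  "nat \<Rightarrow> nat \<Rightarrow> nat \<Rightarrow> (nat \<Rightarrow> 'a) \<Rightarrow> (nat \<Rightarrow> 'a) \<Rightarrow> 'N::{finite,wellorder} \<Rightarrow> 'a" where
  "block_coeff n p q e a c = (if rank c < n * (p + 1) then e (rank c mod (p + 1))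
     else a ((rank c - n * (p + 1)) mod q + 1))"

text \<open>What the kernel draws from the superalgebra: central coefficients with vanishing sums of
  squares over each block. The \<open>itself\<close> parameter fixes the index type, which the other
  parameters do not mention.\<close>

locale super_index =
  fixes n m p q r :: nat and s :: "nat \<Rightarrow> nat" and e a :: "nat \<Rightarrow> 'a::{euclidean_space,real_algebra_1}"
    and dimension :: "'N::{finite,wellorder} itself"
  assumes card_N: "CARD('N) = n * (p + 1) + m * q"
    and e_0: "e 0 = 1" and e_square: "(\<Sum>k=0..p. e k * e k) = 0"
    and e_central: "\<And>k z. k \<le> p \<Longrightarrow> e k * z = z * e k"
    and s_1: "s 1 = 1" and s_step: "\<And>k. k \<in> {1..r} \<Longrightarrow> s k < s (k + 1)" and s_last: "s (r + 1) = q + 1"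
    and a_s: "\<And>k. k \<in> {1..r} \<Longrightarrow> a (s k) = 1"
    and a_square: "\<And>k. k \<in> {1..r} \<Longrightarrow> (\<Sum>l=s k..<s (k + 1). a l * a l) = 0"
    and a_central: "\<And>l z. l \<in> {1..q} \<Longrightarrow> a l * z = z * a l"
begin

abbreviation yc :: "nat \<Rightarrow> nat \<Rightarrow> 'N" where "yc \<equiv> ycoord p"
abbreviation tc :: "nat \<Rightarrow> nat \<Rightarrow> 'N" where "tc \<equiv> tcoord n p q"
abbreviation hd :: "'N \<Rightarrow> 'N" where "hd \<equiv> block_head n p q r s"
abbreviation b :: "'N \<Rightarrow> 'a" where "b \<equiv> block_coeff n p q e a"

lemma s_mono: "1 \<le> k \<Longrightarrow> k \<le> k' \<Longrightarrow> k' \<le> r + 1 \<Longrightarrow> s k \<le> s k'"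
proof -
  assume k: "1 \<le> k" and "k \<le> k'" "k' \<le> r + 1"
  from this(2,3) show "s k \<le> s k'"
  proof (induction k' rule: dec_induct)
    case (step i)
    then show ?case using s_step[of i] k by auto
  qed simp
qed

lemma s_range: "k \<in> {1..r} \<Longrightarrow> l \<in> {s k..<s (k + 1)} \<Longrightarrow> l \<in> {1..q}"
  using s_mono[of 1 k] s_mono[of "k + 1" "r + 1"] s_1 s_last by auto

lemma s_unique:
  assumes "k \<in> {1..r}" "l \<in> {s k..<s (k + 1)}" "k' \<in> {1..r}" "s k' \<le> l"
  shows "s k' \<le> s k" "k' \<le> k"
proof -
  show "k' \<le> k"
  proof (rule ccontr)
    assume "\<not> k' \<le> k"
    then have "s (k + 1) \<le> s k'" using assms by (intro s_mono) auto
    then show False using assms by auto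
  qed
  then show "s k' \<le> s k" using assms by (intro s_mono) auto
qed

lemma s_block:
  assumes k: "k \<in> {1..r}" "l \<in> {s k..<s (k + 1)}"
  shows "Max {s k |k. k \<in> {1..r} \<and> s k \<le> l} = s k"
proof (rule Max_eqI)
  have "{s k |k. k \<in> {1..r} \<and> s k \<le> l} \<subseteq> s ` {1..r}" by auto
  then show "finite {s k |k. k \<in> {1..r} \<and> s k \<le> l}" by (rule finite_subset) simp
  show "y \<le> s k" if "y \<in> {s k |k. k \<in> {1..r} \<and> s k \<le> l}" for y
    using that s_unique(1)[OF k] by blast
  show "s k \<in> {s k |k. k \<in> {1..r} \<and> s k \<le> l}" using k by auto
qed

lemma s_cases:
  assumes "l \<in> {1..q}"
  obtains k where "k \<in> {1..r}" "l \<in> {s k..<s (k + 1)}"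
proof -
  let ?K = "{k \<in> {1..r}. s k \<le> l}"
  \<comment> \<open>For r = 0 the two conditions on \<open>s 1\<close> force q = 0, and there is no
    \<open>l\<close>.\<close>
  have "r \<noteq> 0"
  proof
    assume "r = 0"
    then show False using s_1 s_last assms by simp
  qed
  then have ne: "1 \<in> ?K" using s_1 assms by auto
  define k where "k = Max ?K"
  have k: "k \<in> ?K" unfolding k_def using ne by (intro Max_in) auto
  have "l < s (k + 1)"
  proof (cases "k = r")
    case True then show ?thesis using s_last assms by simp
  next
    case False
    have "k + 1 \<notin> ?K"
    proof
      assume "k + 1 \<in> ?K"
      then have "k + 1 \<le> k" unfolding k_def by (intro Max_ge) auto
      then show False by simp
    qed
    then show ?thesis using k False by auto
  qed
  then show ?thesis using k by (intro that[of k]) auto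
qed

lemma position_bound: "i \<in> {1..N} \<Longrightarrow> k < P \<Longrightarrow> (i - 1) * P + k < N * (P :: nat)"
proof -
  assume *: "i \<in> {1..N}" "k < P"
  then have "(i - 1) * P + k < (i - 1) * P + P" by simp
  also have "\<dots> = i * P" using * by (cases i) auto
  also have "\<dots> \<le> N * P" using * by simp
  finally show ?thesis .
qed

lemma position_div_mod:
  assumes "k < (P :: nat)" shows "(i * P + k) div P = i" "(i * P + k) mod P = k"
proof -
  show "(i * P + k) div P = i" using assms by (subst div_mult_self3) auto
  show "(i * P + k) mod P = k" using assms by (subst mod_mult_self3) auto
qed

lemma position_inject: "i * P + k = i' * P + k' \<Longrightarrow> k < P \<Longrightarrow> k' < (P :: nat) \<Longrightarrow> i = i' \<and> k = k'"
  by (metis position_div_mod)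

lemma rank_yc: "i \<in> {1..n} \<Longrightarrow> k \<le> p \<Longrightarrow> rank (yc i k) = (i - 1) * (p + 1) + k"
  unfolding ycoord_def
proof (rule rank_nth_index)
  assume "i \<in> {1..n}" "k \<le> p"
  then have "(i - 1) * (p + 1) + k < n * (p + 1)" by (intro position_bound) auto
  then show "(i - 1) * (p + 1) + k < CARD('N)" unfolding card_N by (rule trans_less_add1)
qed

lemma rank_tc: "i \<in> {1..m} \<Longrightarrow> l \<in> {1..q} \<Longrightarrow> rank (tc i l) = n * (p + 1) + ((i - 1) * q + (l - 1))"
  unfolding tcoord_def add.assoc
proof (rule rank_nth_index)
  assume "i \<in> {1..m}" "l \<in> {1..q}"
  then have "(i - 1) * q + (l - 1) < m * q" by (intro position_bound) auto
  then show "n * (p + 1) + ((i - 1) * q + (l - 1)) < CARD('N)"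
    unfolding card_N by (rule add_strict_left_mono)
qed

lemma rank_yc_less: "i \<in> {1..n} \<Longrightarrow> k \<le> p \<Longrightarrow> rank (yc i k) < n * (p + 1)"
  unfolding rank_yc by (rule position_bound) auto

lemma rank_tc_not_less: "i \<in> {1..m} \<Longrightarrow> l \<in> {1..q} \<Longrightarrow> \<not> rank (tc i l) < n * (p + 1)"
  unfolding rank_tc not_less by (rule le_add1)

lemma yc_mod: "i \<in> {1..n} \<Longrightarrow> k \<le> p \<Longrightarrow> rank (yc i k) mod (p + 1) = k"
  unfolding rank_yc by (rule position_div_mod) simp

lemma hd_yc: "i \<in> {1..n} \<Longrightarrow> k \<le> p \<Longrightarrow> hd (yc i k) = yc i 0"
  unfolding block_head_def by (simp only: rank_yc_less yc_mod if_True) (simp only: rank_yc diff_add_inverse2, simp only: ycoord_def add_0_right)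

lemma b_yc: "i \<in> {1..n} \<Longrightarrow> k \<le> p \<Longrightarrow> b (yc i k) = e k"
  unfolding block_coeff_def by (simp only: rank_yc_less yc_mod if_True)

lemma tc_mod: "i \<in> {1..m} \<Longrightarrow> l \<in> {1..q} \<Longrightarrow> (rank (tc i l) - n * (p + 1)) mod q + 1 = l"
proof -
  assume *: "i \<in> {1..m}" "l \<in> {1..q}"
  then have mod: "((i - 1) * q + (l - 1)) mod q = l - 1" by (intro position_div_mod) auto
  show ?thesis unfolding rank_tc[OF *] diff_add_inverse mod using *(2) by simp
qed

lemma hd_tc: "i \<in> {1..m} \<Longrightarrow> k \<in> {1..r} \<Longrightarrow> l \<in> {s k..<s (k + 1)} \<Longrightarrow> hd (tc i l) = tc i (s k)"
proof -
  assume *: "i \<in> {1..m}" "k \<in> {1..r}" "l \<in> {s k..<s (k + 1)}"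
  have l: "l \<in> {1..q}" using s_range * by blast
  have "1 \<le> s k" using s_mono[of 1 k] s_1 * by auto
  then have "l - 1 = (s k - 1) + (l - s k)" using * by auto
  then have "rank (tc i l) = (n * (p + 1) + (i - 1) * q + (s k - 1)) + (l - s k)"
    unfolding rank_tc[OF *(1) l] by (simp only: add.assoc)
  then have "rank (tc i l) - (l - s k) = n * (p + 1) + (i - 1) * q + (s k - 1)"
    by (simp only: diff_add_inverse2)
  then show ?thesis
    unfolding block_head_def tc_mod[OF *(1) l] Let_def s_block[OF *(2,3)]
    using rank_tc_not_less[OF *(1) l] by (simp only: if_False tcoord_def)
qed

lemma b_tc: "i \<in> {1..m} \<Longrightarrow> l \<in> {1..q} \<Longrightarrow> b (tc i l) = a l"
  unfolding block_coeff_def by (simp only: rank_tc_not_less tc_mod if_False)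

text \<open>Division with remainder inverts the enumeration of the coordinates; in the odd part
  \<open>s_cases\<close> then finds the block.\<close>

lemma index_cases:
  obtains (y) i k where "c = yc i k" "i \<in> {1..n}" "k \<le> p"
  | (t) i k l where "c = tc i l" "i \<in> {1..m}" "k \<in> {1..r}" "l \<in> {s k..<s (k + 1)}"
proof (cases "rank c < n * (p + 1)")
  case True
  let ?i = "rank c div (p + 1)" and ?k = "rank c mod (p + 1)"
  have "?i < n" using True by (simp add: less_mult_imp_div_less)
  moreover have "?k \<le> p" using mod_less_divisor[of "p + 1" "rank c"] by simp
  moreover have "c = yc (?i + 1) ?k"
    unfolding ycoord_def add_diff_cancel_right' div_mult_mod_eq nth_index_rank ..
  ultimately show ?thesis by (intro y[of "?i + 1" ?k]) auto
next
  case False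
  let ?x = "rank c - n * (p + 1)"
  have x: "?x < m * q" using rank_less_CARD[of c] card_N False by simp
  then have q: "q > 0" by (cases q) auto
  have i: "?x div q < m" using x by (simp add: less_mult_imp_div_less)
  define z where "z = ?x mod q"
  have "z < q" unfolding z_def using q by (rule mod_less_divisor)
  then have "z + 1 \<in> {1..q}" by simp
  then have l: "?x mod q + 1 \<in> {1..q}" unfolding z_def .
  then obtain k where k: "k \<in> {1..r}" "?x mod q + 1 \<in> {s k..<s (k + 1)}" by (rule s_cases)
  have "n * (p + 1) + ?x div q * q + ?x mod q = rank c"
    unfolding add.assoc div_mult_mod_eq using False by (intro le_add_diff_inverse) (simp only: not_less)
  then have "c = tc (?x div q + 1) (?x mod q + 1)"
    unfolding tcoord_def add_diff_cancel_right' by (simp only: nth_index_rank)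
  then show ?thesis using i k by (intro t[of "?x div q + 1" "?x mod q + 1" k]) auto
qed

lemma yc_inject:
  assumes "i \<in> {1..n}" "k \<le> p" "i' \<in> {1..n}" "k' \<le> p"
  shows "yc i k = yc i' k' \<longleftrightarrow> i = i' \<and> k = k'"
proof
  assume "yc i k = yc i' k'"
  then have "(i - 1) * (p + 1) + k = (i' - 1) * (p + 1) + k'"
    using rank_yc[OF assms(1,2)] rank_yc[OF assms(3,4)] by (simp only:)
  then have "i - 1 = i' - 1 \<and> k = k'" by (rule position_inject) (use assms in auto)
  then show "i = i' \<and> k = k'" using assms by auto
qed simp

lemma tc_inject:
  assumes "i \<in> {1..m}" "l \<in> {1..q}" "i' \<in> {1..m}" "l' \<in> {1..q}"
  shows "tc i l = tc i' l' \<longleftrightarrow> i = i' \<and> l = l'"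
proof
  assume "tc i l = tc i' l'"
  then have "n * (p + 1) + ((i - 1) * q + (l - 1)) = n * (p + 1) + ((i' - 1) * q + (l' - 1))"
    using rank_tc[OF assms(1,2)] rank_tc[OF assms(3,4)] by (simp only:)
  then have "(i - 1) * q + (l - 1) = (i' - 1) * q + (l' - 1)" by (simp only: add_left_cancel)
  then have "i - 1 = i' - 1 \<and> l - 1 = l' - 1" by (rule position_inject) (use assms in auto)
  then show "i = i' \<and> l = l'" using assms by auto
qed simp

lemma yc_neq_tc: "i \<in> {1..n} \<Longrightarrow> k \<le> p \<Longrightarrow> i' \<in> {1..m} \<Longrightarrow> l \<in> {1..q} \<Longrightarrow> yc i k \<noteq> tc i' l"
  using rank_yc_less[of i k] rank_tc_not_less[of i' l] by metis

lemma s_head: "k \<in> {1..r} \<Longrightarrow> s k \<in> {s k..<s (k + 1)}"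
  using s_step by simp

lemma block_yc: "i \<in> {1..n} \<Longrightarrow> {c. hd c = yc i 0} = yc i ` {0..p}"
proof (intro set_eqI iffI)
  fix c assume i: "i \<in> {1..n}" and "c \<in> {c. hd c = yc i 0}"
  then have c: "hd c = yc i 0" by simp
  show "c \<in> yc i ` {0..p}"
  proof (cases c rule: index_cases)
    case (y i' k)
    then show ?thesis using c i hd_yc yc_inject[of i' 0 i 0] by auto
  next
    case (t i' k l)
    then show ?thesis using c i hd_tc[OF t(2-4)] yc_neq_tc[of i 0 i' "s k"] s_range[OF t(3) s_head[OF t(3)]] by auto
  qed
qed (auto simp: hd_yc)

lemma block_tc: "i \<in> {1..m} \<Longrightarrow> k \<in> {1..r} \<Longrightarrow> {c. hd c = tc i (s k)} = tc i ` {s k..<s (k + 1)}"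
proof (intro set_eqI iffI)
  fix c assume i: "i \<in> {1..m}" "k \<in> {1..r}" and "c \<in> {c. hd c = tc i (s k)}"
  then have c: "hd c = tc i (s k)" by simp
  have sk: "s k \<in> {1..q}" using s_range[OF i(2) s_head[OF i(2)]] .
  show "c \<in> tc i ` {s k..<s (k + 1)}"
  proof (cases c rule: index_cases)
    case (y i' k')
    then show ?thesis using c i hd_yc yc_neq_tc[of i' 0 i "s k"] sk by auto
  next
    case (t i' k' l)
    have sk': "s k' \<in> {1..q}" using s_range[OF t(3) s_head[OF t(3)]] .
    have "i' = i \<and> s k' = s k"
      using c t hd_tc[OF t(2-4)] tc_inject[OF t(2) sk' i(1) sk] by simp
    moreover from this have "k = k'"
      using s_unique(2)[OF i(2) s_head[OF i(2)] t(3)] s_unique(2)[OF t(3) s_head[OF t(3)] i(2)] by simp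
    ultimately show ?thesis using t by auto
  qed
qed (auto simp: hd_tc)

lemma inj_yc: "i \<in> {1..n} \<Longrightarrow> inj_on (yc i) {0..p}"
  by (rule inj_onI) (simp add: yc_inject)

lemma inj_tc: "i \<in> {1..m} \<Longrightarrow> k \<in> {1..r} \<Longrightarrow> inj_on (tc i) {s k..<s (k + 1)}"
  by (rule inj_onI) (use tc_inject s_range in blast)

sublocale block_structure hd b
proof
  fix c :: 'N
  show "hd (hd c) = hd c"
    by (cases c rule: index_cases) (auto simp: hd_yc hd_tc s_step)
  show "hd c \<le> c"
  proof (cases c rule: index_cases)
    case (y i k)
    then show ?thesis by (intro rank_le_imp_le) (simp add: hd_yc rank_yc)
  next
    case (t i k l)
    have "rank (tc i (s k)) \<le> rank (tc i l)"
      using t s_range[OF t(3,4)] s_range[OF t(3) s_head[OF t(3)]] by (simp add: rank_tc diff_le_mono)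
    then show ?thesis using t by (intro rank_le_imp_le) (simp add: hd_tc)
  qed
  show "b c * z = z * b c" for z
    by (cases c rule: index_cases) (auto simp: b_yc e_central b_tc[OF _ s_range] a_central[OF s_range])
  show "b c = 1" if "hd c = c"
  proof (cases c rule: index_cases)
    case (y i k)
    then have "k = 0" using that yc_inject[of i 0 i k] by (simp add: hd_yc)
    then show ?thesis using y by (simp add: b_yc e_0)
  next
    case (t i k l)
    have "l = s k"
      using that t tc_inject[of i "s k" i l] s_range[OF t(3,4)] s_range[OF t(3) s_head[OF t(3)]] by (simp add: hd_tc)
    then show ?thesis using t b_tc[OF t(2) s_range[OF t(3,4)]] a_s by simp
  qed
  show "(\<Sum>c | hd c = d. b c * b c) = 0" if d: "hd d = d" for d
  proof (cases d rule: index_cases)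
    case (y i k)
    then have "d = yc i 0" using d by (simp add: hd_yc)
    then show ?thesis
      using y by (simp add: block_yc sum.reindex[OF inj_yc] b_yc e_square)
  next
    case (t i k l)
    then have "d = tc i (s k)" using d by (simp add: hd_tc)
    then show ?thesis
      using t by (simp add: block_tc[OF t(2,3)] sum.reindex[OF inj_tc[OF t(2,3)]] b_tc[OF t(2) s_range[OF t(3)]] a_square del: One_nat_def)
  qed
qed

section \<open>Sums over heads and over the remaining coordinates\<close>

lemma hd_yc0: "i \<in> {1..n} \<Longrightarrow> hd (yc i 0) = yc i 0"
  by (simp add: hd_yc)

lemma hd_tcs: "i \<in> {1..m} \<Longrightarrow> k \<in> {1..r} \<Longrightarrow> hd (tc i (s k)) = tc i (s k)"
  by (rule hd_tc[OF _ _ s_head])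

lemma heads_eq: "{d. hd d = d} = (\<lambda>i. yc i 0) ` {1..n} \<union> (\<lambda>(i, k). tc i (s k)) ` ({1..m} \<times> {1..r})"
proof (intro set_eqI iffI)
  fix d assume "d \<in> {d. hd d = d}"
  then have d: "hd d = d" by simp
  show "d \<in> (\<lambda>i. yc i 0) ` {1..n} \<union> (\<lambda>(i, k). tc i (s k)) ` ({1..m} \<times> {1..r})"
  proof (cases d rule: index_cases)
    case (y i k)
    then have "d = yc i 0" using d hd_yc[OF y(2,3)] by simp
    then show ?thesis using y(2) by blast
  next
    case (t i k l)
    then have "d = tc i (s k)" using d hd_tc[OF t(2-4)] by simp
    then show ?thesis using t by auto
  qed
qed (auto simp: hd_yc0 hd_tcs)

lemma sum_heads:
  "(\<Sum>d | hd d = d. f d) = (\<Sum>i=1..n. f (yc i 0)) + (\<Sum>i=1..m. \<Sum>k=1..r. f (tc i (s k)))"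
proof -
  have sk: "s k \<in> {1..q}" if "k \<in> {1..r}" for k using s_range[OF that s_head[OF that]] .
  have inj: "inj_on (\<lambda>(i, k). tc i (s k)) ({1..m} \<times> {1..r})"
  proof (rule inj_onI, clarify)
    fix i k i' k' assume *: "i \<in> {1..m}" "k \<in> {1..r}" "i' \<in> {1..m}" "k' \<in> {1..r}" "tc i (s k) = tc i' (s k')"
    then have "i = i'" "s k = s k'" using tc_inject[OF *(1) sk[OF *(2)] *(3) sk[OF *(4)]] by auto
    then show "i = i' \<and> k = k'"
      using s_unique(2)[OF *(2) s_head[OF *(2)] *(4)] s_unique(2)[OF *(4) s_head[OF *(4)] *(2)] by auto
  qed
  have "(\<Sum>d | hd d = d. f d) = (\<Sum>d\<in>(\<lambda>i. yc i 0) ` {1..n}. f d) +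
      (\<Sum>d\<in>(\<lambda>(i, k). tc i (s k)) ` ({1..m} \<times> {1..r}). f d)"
    unfolding heads_eq by (rule sum.union_disjoint) (use yc_neq_tc sk in fastforce)+
  also have "(\<Sum>d\<in>(\<lambda>i. yc i 0) ` {1..n}. f d) = (\<Sum>i=1..n. f (yc i 0))"
    by (subst sum.reindex) (auto intro!: inj_onI simp: yc_inject)
  also have "(\<Sum>d\<in>(\<lambda>(i, k). tc i (s k)) ` ({1..m} \<times> {1..r}). f d) = (\<Sum>i=1..m. \<Sum>k=1..r. f (tc i (s k)))"
    by (subst sum.reindex[OF inj]) (simp add: o_def split_beta sum.cartesian_product)
  finally show ?thesis .
qed

lemma insert_tail_yc: "i \<in> {1..n} \<Longrightarrow> insert (yc i 0) (tail (yc i 0)) = yc i ` {0..p}"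
  by (subst block_eq(1)[symmetric]) (simp_all only: hd_yc0 block_yc)

lemma insert_tail_tc:
  "i \<in> {1..m} \<Longrightarrow> k \<in> {1..r} \<Longrightarrow> insert (tc i (s k)) (tail (tc i (s k))) = tc i ` {s k..<s (k + 1)}"
  by (subst block_eq(1)[symmetric]) (simp_all only: hd_tcs block_tc)

lemma tail_yc: "i \<in> {1..n} \<Longrightarrow> tail (yc i 0) = yc i ` {1..p}"
proof -
  assume i: "i \<in> {1..n}"
  have "tail (yc i 0) = yc i ` {0..p} - yc i ` {0}"
    using insert_tail_yc[OF i] block_eq(2)[of "yc i 0"] by auto
  also have "\<dots> = yc i ` ({0..p} - {0})"
    by (rule inj_on_image_set_diff[OF inj_yc[OF i], symmetric]) auto
  also have "{0..p} - {0} = {1..p}" by auto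
  finally show ?thesis .
qed

lemma tail_tc: "i \<in> {1..m} \<Longrightarrow> k \<in> {1..r} \<Longrightarrow> tail (tc i (s k)) = tc i ` {s k + 1..<s (k + 1)}"
proof -
  assume i: "i \<in> {1..m}" "k \<in> {1..r}"
  have "tail (tc i (s k)) = tc i ` {s k..<s (k + 1)} - tc i ` {s k}"
    using insert_tail_tc[OF i] block_eq(2)[of "tc i (s k)"] by auto
  also have "\<dots> = tc i ` ({s k..<s (k + 1)} - {s k})"
    by (rule inj_on_image_set_diff[OF inj_tc[OF i], symmetric]) (use s_step i in auto)
  also have "{s k..<s (k + 1)} - {s k} = {s k + 1..<s (k + 1)}" by auto
  finally show ?thesis .
qed

lemma sum_tail_yc: "i \<in> {1..n} \<Longrightarrow> (\<Sum>c\<in>tail (yc i 0). f c) = (\<Sum>j=1..p. f (yc i j))"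
  unfolding tail_yc by (subst sum.reindex) (auto intro: inj_on_subset[OF inj_yc])

lemma sum_tail_tc:
  "i \<in> {1..m} \<Longrightarrow> k \<in> {1..r} \<Longrightarrow> (\<Sum>c\<in>tail (tc i (s k)). f c) = (\<Sum>l=s k + 1..<s (k + 1). f (tc i l))"
  unfolding tail_tc by (subst sum.reindex) (auto intro: inj_on_subset[OF inj_tc])

lemma sum_non_heads:
  "(\<Sum>c | hd c \<noteq> c. f c) = (\<Sum>i=1..n. \<Sum>j=1..p. f (yc i j)) +
     (\<Sum>i=1..m. \<Sum>k=1..r. \<Sum>l=s k + 1..<s (k + 1). f (tc i l))"
proof -
  have "(\<Sum>c | hd c \<noteq> c. f c) = (\<Sum>i=1..n. \<Sum>c\<in>tail (yc i 0). f c) + (\<Sum>i=1..m. \<Sum>k=1..r. \<Sum>c\<in>tail (tc i (s k)). f c)"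
    unfolding sum_tail[symmetric] by (rule sum_heads)
  also have "\<dots> = (\<Sum>i=1..n. \<Sum>j=1..p. f (yc i j)) +
     (\<Sum>i=1..m. \<Sum>k=1..r. \<Sum>l=s k + 1..<s (k + 1). f (tc i l))"
    by (intro arg_cong2[where f = "(+)"] sum.cong refl sum_tail_yc sum_tail_tc)
  finally show ?thesis .
qed

section \<open>Kernel and d'' in real coordinates\<close>

abbreviation kernel_scale :: "real ^ 'N::_ \<Rightarrow> real" where
  "kernel_scale v \<equiv> 1 / (real CARD('N) * measure lborel (ball (0 :: real ^ 'N::_) 1) * norm v ^ CARD('N))"

text \<open>Every bracket of the kernel is one block of \<open>block_form\<close>: the exponents
  \<open>j\<close> and \<open>l - s k\<close> are the numbers of coordinates after the head up to
  the second omitted one.\<close>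

lemma Omega_eq_flux_form: "Omega n m p q r e s a v = flux_form (\<lambda>c. kernel_scale v *\<^sub>R W c v)"
proof
  fix S :: "'N set"
  let ?f = "\<lambda>c. rank_sign c * W c v * basis_form (- {c}) S"
  have y: "wedge (dY p e i) (\<lambda>T. \<Sum>j=1..p. (- 1) ^ j *
      ((v $ yc i j) *\<^sub>R e 0 + (v $ yc i 0) *\<^sub>R e j) * omit2 (yc i 0) (yc i j) T) S =
      (\<Sum>c\<in>insert (yc i 0) (tail (yc i 0)). ?f c)" if i: "i \<in> {1..n}" for i
  proof -
    have 1: "dY p e i = (\<lambda>S. \<Sum>c\<in>insert (yc i 0) (tail (yc i 0)). b c * dx c S)"
      unfolding dY_def insert_tail_yc[OF i] using i
      by (intro ext) (simp add: sum.reindex[OF inj_yc] b_yc)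
    have 2: "(- 1) ^ j * ((v $ yc i j) *\<^sub>R e 0 + (v $ yc i 0) *\<^sub>R e j) * omit2 (yc i 0) (yc i j) T =
      (- 1) ^ card {u. yc i 0 < u \<and> u \<le> yc i j} * ((v $ yc i j) *\<^sub>R 1 + (v $ yc i 0) *\<^sub>R b (yc i j)) *
        omit2 (yc i 0) (yc i j) T" if j: "j \<in> {1..p}" for j T
    proof -
      have "yc i 0 < yc i j"
        using i j by (intro rank_less_imp_less) (auto simp: rank_yc)
      then have "card {u. yc i 0 < u \<and> u \<le> yc i j} = j"
        using rank_diff[of "yc i 0" "yc i j"] i j by (auto simp: rank_yc)
      then show ?thesis using i j by (simp add: b_yc e_0)
    qed
    show ?thesis
      unfolding block_form[OF hd_yc0[OF i], symmetric] 1 sum_tail_yc[OF i]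
      by (intro arg_cong2[where f = "\<lambda>\<alpha> \<beta>. wedge \<alpha> \<beta> S"] refl ext sum.cong 2)
  qed
  have t: "wedge (dZ n p q s a k i) (\<lambda>T. \<Sum>l=s k + 1..<s (k + 1). (- 1) ^ (l - s k) *
      ((v $ tc i l) *\<^sub>R e 0 + (v $ tc i (s k)) *\<^sub>R a l) * omit2 (tc i (s k)) (tc i l) T) S =
      (\<Sum>c\<in>insert (tc i (s k)) (tail (tc i (s k))). ?f c)" if i: "i \<in> {1..m}" and k: "k \<in> {1..r}" for i k
  proof -
    have bl: "b (tc i l) = a l" if "l \<in> {s k..<s (k + 1)}" for l
      using that by (intro b_tc[OF i s_range[OF k]])
    have 1: "dZ n p q s a k i = (\<lambda>S. \<Sum>c\<in>insert (tc i (s k)) (tail (tc i (s k))). b c * dx c S)"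
      unfolding dZ_def insert_tail_tc[OF i k] sum.reindex[OF inj_tc[OF i k]] o_def
      by (intro ext sum.cong refl) (simp only: bl)
    have 2: "(- 1) ^ (l - s k) * ((v $ tc i l) *\<^sub>R e 0 + (v $ tc i (s k)) *\<^sub>R a l) * omit2 (tc i (s k)) (tc i l) T =
      (- 1) ^ card {u. tc i (s k) < u \<and> u \<le> tc i l} * ((v $ tc i l) *\<^sub>R 1 + (v $ tc i (s k)) *\<^sub>R b (tc i l)) *
        omit2 (tc i (s k)) (tc i l) T" if l: "l \<in> {s k + 1..<s (k + 1)}" for l T
    proof -
      have lq: "l \<in> {1..q}" "s k \<in> {1..q}" using l s_range[OF k, of l] s_range[OF k s_head[OF k]] by auto
      have "tc i (s k) < tc i l"
        unfolding atLeastLessThan_iff using lq l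
        by (intro rank_less_imp_less) (auto simp: rank_tc[OF i lq(1)] rank_tc[OF i lq(2)])
      then have "card {u. tc i (s k) < u \<and> u \<le> tc i l} = l - s k"
        using rank_diff[of "tc i (s k)" "tc i l"] lq l by (simp add: rank_tc[OF i lq(1)] rank_tc[OF i lq(2)])
      then show ?thesis using l by (simp add: bl e_0)
    qed
    show ?thesis
      unfolding block_form[OF hd_tcs[OF i k], symmetric] 1 sum_tail_tc[OF i k]
      by (intro arg_cong2[where f = "\<lambda>\<alpha> \<beta>. wedge \<alpha> \<beta> S"] refl ext sum.cong 2)
  qed
  have "Omega n m p q r e s a v S = kernel_scale v *\<^sub>R
     ((\<Sum>i=1..n. \<Sum>c\<in>insert (yc i 0) (tail (yc i 0)). ?f c) +
      (\<Sum>i=1..m. \<Sum>k=1..r. \<Sum>c\<in>insert (tc i (s k)) (tail (tc i (s k))). ?f c))"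
    unfolding Omega_def by (intro arg_cong2[where f = scaleR] arg_cong2[where f = "(+)"] refl sum.cong y t)
  also have "\<dots> = kernel_scale v *\<^sub>R (\<Sum>c\<in>UNIV. ?f c)"
    unfolding sum_heads[of "\<lambda>d. \<Sum>c\<in>insert d (tail d). ?f c", symmetric] sum_blocks ..
  also have "\<dots> = flux_form (\<lambda>c. kernel_scale v *\<^sub>R W c v) S"
    by (simp add: flux_form_def scaleR_sum_right)
  finally show "Omega n m p q r e s a v S = flux_form (\<lambda>c. kernel_scale v *\<^sub>R W c v) S" .
qed

lemma super_kernel_eq_flux_form:
  "super_kernel n m p q r e s a x u = flux_form (\<lambda>c. kernel_scale (u - x) *\<^sub>R W c (u - x))"
  unfolding super_kernel_def pullback_translation Omega_eq_flux_form ..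

lemma d''_zero_form:
  fixes F :: "real ^ 'N::_ \<Rightarrow> 'a"
  shows "d'' n m p q r e s a (zero_form F) u =
    (\<lambda>S. \<Sum>c | hd c \<noteq> c. (partial c F u - b c * partial (hd c) F u) * dx c S)"
proof
  fix S :: "'N set"
  have p: "partial c (\<lambda>v. zero_form F v T) u = partial c F u * basis_form {} T" for c :: 'N and T
    by (cases "T = {}") (simp_all add: zero_form_def mult_form_def basis_form_def partial_def)
  have w: "wedge (dx c) (\<lambda>T. k * basis_form {} T) S = k * dx c S" for c :: 'N and k :: 'a
    using foldr_wedge_dx_linear[of "[c]" "\<lambda>_. k" "\<lambda>_. basis_form {}" "{()}" S]
    by (simp add: wedge_dx_basis_form_eq)
  let ?f = "\<lambda>c. (partial c F u - b c * partial (hd c) F u) * dx c S"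
  have y: "wedge (dx (yc i j)) (\<lambda>T. partial (yc i j) (\<lambda>v. zero_form F v T) u -
      e j * partial (yc i 0) (\<lambda>v. zero_form F v T) u) S = ?f (yc i j)"
    if "i \<in> {1..n}" "j \<in> {1..p}" for i j
    using that unfolding p mult.assoc[symmetric] left_diff_distrib[symmetric] w by (simp add: b_yc hd_yc)
  have t: "wedge (dx (tc i l)) (\<lambda>T. partial (tc i l) (\<lambda>v. zero_form F v T) u -
      a l * partial (tc i (s k)) (\<lambda>v. zero_form F v T) u) S = ?f (tc i l)"
    if "i \<in> {1..m}" "k \<in> {1..r}" "l \<in> {s k + 1..<s (k + 1)}" for i k l
  proof -
    have l: "l \<in> {s k..<s (k + 1)}" using that by auto
    show ?thesis unfolding p mult.assoc[symmetric] left_diff_distrib[symmetric] w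
      by (simp only: hd_tc[OF that(1,2) l] b_tc[OF that(1) s_range[OF that(2) l]])
  qed
  show "d'' n m p q r e s a (zero_form F) u S = (\<Sum>c | hd c \<noteq> c. ?f c)"
    unfolding d''_def sum_non_heads by (intro arg_cong2[where f = "(+)"] sum.cong refl y t)
qed

lemma wedge_d''_super_kernel:
  fixes F :: "real ^ 'N::_ \<Rightarrow> 'a"
  shows "wedge (d'' n m p q r e s a (zero_form F) u) (super_kernel n m p q r e s a x u) UNIV =
    (\<Sum>c\<in>UNIV. partial c F u * (kernel_scale (u - x) *\<^sub>R W c (u - x)))"
proof -
  have "wedge (d'' n m p q r e s a (zero_form F) u) (super_kernel n m p q r e s a x u) UNIV =
      kernel_scale (u - x) *\<^sub>R (\<Sum>c | hd c \<noteq> c. (partial c F u - b c * partial (hd c) F u) * W c (u - x))"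
    unfolding d''_zero_form super_kernel_eq_flux_form wedge_one_form_flux_form
    by (simp only: mult_scaleR_right scaleR_sum_right)
  also have "\<dots> = kernel_scale (u - x) *\<^sub>R (\<Sum>c\<in>UNIV. partial c F u * W c (u - x))"
    unfolding sum_tail_derivations[of "\<lambda>c. partial c F u"] ..
  finally show ?thesis by (simp only: mult_scaleR_right scaleR_sum_right)
qed

end

section \<open>The singularity of the kernel\<close>

lemma integral_indicator_ball:
  "(\<integral>u. indicator (ball x r) u *\<^sub>R c \<partial>lborel) = measure lborel (ball (x::'c::euclidean_space) r) *\<^sub>R (c::'b::euclidean_space)"
proof -
  have "integrable lborel (indicator (ball x r) :: 'c \<Rightarrow> real)"
    by (intro integrable_real_indicator emeasure_lborel_ball_finite) auto
  then show ?thesis by (subst integral_scaleR_left) auto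
qed

text \<open>On the dyadic shell between \<rho> and 2 \<rho> the function is at most 2 \<rho> /
  \<rho>^N, and the ball of radius 2 \<rho> has volume of order \<rho>^N. The integrals of the
  majorants are thus of order \<rho> and form a geometric series. Supporting the majorants on whole
  balls instead of shells costs only a constant.\<close>

lemma integrable_norm_power_singularity:
  fixes x :: "real ^ 'N::finite"
  assumes R: "R > 0"
  shows "integrable lborel (\<lambda>u. indicator (ball x R) u * (norm (u - x) / norm (u - x) ^ CARD('N)))"
proof -
  let ?N = "CARD('N)"
  let ?V = "measure lborel (ball (0 :: real ^ 'N) 1)"
  define \<rho> where "\<rho> k = R / 2 ^ Suc k" for k :: nat
  have \<rho>: "\<rho> k > 0" for k using R by (simp add: \<rho>_def)
  define f where "f k u = indicator (ball x (2 * \<rho> k)) u * (2 * \<rho> k / \<rho> k ^ ?N)" for k u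
  have f_nonneg: "0 \<le> f k u" for k u using \<rho>[of k] by (simp add: f_def less_imp_le)
  have f_int: "integrable lborel (f k)" for k
    unfolding f_def[abs_def] by (intro integrable_mult_left integrable_real_indicator emeasure_lborel_ball_finite) auto
  have "integral\<^sup>L lborel (f k) = (2 ^ ?N * 2 * ?V * R / 2) * (1 / 2) ^ k" for k
  proof -
    have "integral\<^sup>L lborel (f k) = measure lborel (ball x (2 * \<rho> k)) * (2 * \<rho> k / \<rho> k ^ ?N)"
      unfolding f_def[abs_def]
      using integral_indicator_ball[of x "2 * \<rho> k" "2 * \<rho> k / \<rho> k ^ ?N"] by (simp only: real_scaleR_def)
    also have "measure lborel (ball x (2 * \<rho> k)) = (2 * \<rho> k) ^ ?N * ?V"
      using content_ball_conv_unit_ball[of "2 * \<rho> k" x] \<rho>[of k] by simp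
    also have "(2 * \<rho> k) ^ ?N * ?V * (2 * \<rho> k / \<rho> k ^ ?N) = 2 ^ ?N * 2 * ?V * \<rho> k"
      using \<rho>[of k] by (simp add: power_mult_distrib)
    finally show ?thesis by (simp add: \<rho>_def power_divide)
  qed
  then have sum_int: "summable (\<lambda>k. integral\<^sup>L lborel (f k))"
    by (simp add: summable_mult summable_geometric)
  have eventually_zero: "\<exists>n. \<forall>k\<ge>n. f k u = 0" if ux: "u \<noteq> x" for u
  proof -
    obtain n where n: "(1 / 2) ^ n < norm (u - x) / R"
      using real_arch_pow_inv[of "norm (u - x) / R" "1 / 2"] ux R by auto
    have "f k u = 0" if "k \<ge> n" for k
    proof -
      have "(1 / 2 :: real) ^ k \<le> (1 / 2) ^ n" using that by (rule power_decreasing) auto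
      then have "(1 / 2) ^ k \<le> norm (u - x) / R" using n by (rule order_trans[OF _ less_imp_le])
      then have "R * (1 / 2) ^ k \<le> R * (norm (u - x) / R)" using R by (intro mult_left_mono) auto
      then have "2 * \<rho> k \<le> norm (u - x)" using R by (simp add: \<rho>_def power_divide)
      then show ?thesis by (simp add: f_def dist_norm norm_minus_commute)
    qed
    then show ?thesis by blast
  qed
  have summable: "summable (\<lambda>k. f k u)" if "u \<noteq> x" for u
  proof -
    obtain n where "\<forall>k\<ge>n. f k u = 0" using eventually_zero[OF \<open>u \<noteq> x\<close>] by blast
    then show ?thesis by (intro summable_finite[of "{..<n}"]) auto
  qed
  \<comment> \<open>At \<open>u = x\<close> all balls contain the point and the series diverges; a
    single point is a null set.\<close>
  have "integrable lborel (\<lambda>u. \<Sum>k. f k u)"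
    by (rule integrable_suminf[OF f_int])
      (use AE_lborel_singleton[of x] summable sum_int f_nonneg in \<open>auto elim: eventually_mono\<close>)
  then show ?thesis
  proof (rule Bochner_Integration.integrable_bound)
    show "(\<lambda>u. indicator (ball x R) u * (norm (u - x) / norm (u - x) ^ ?N)) \<in> borel_measurable lborel"
      by (intro borel_measurable_times borel_measurable_divide borel_measurable_power borel_measurable_norm
          borel_measurable_diff borel_measurable_indicator) auto
    show "AE u in lborel. norm (indicator (ball x R) u * (norm (u - x) / norm (u - x) ^ ?N)) \<le> norm (\<Sum>k. f k u)"
      using AE_lborel_singleton[of x]
    proof eventually_elim
      fix u assume u: "u \<noteq> x"
      show "norm (indicator (ball x R) u * (norm (u - x) / norm (u - x) ^ ?N)) \<le> norm (\<Sum>k. f k u)"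
      proof (cases "u \<in> ball x R")
        case True
        let ?v = "norm (u - x)"
        have v: "0 < ?v" "?v < R" using u True by (auto simp: dist_norm norm_minus_commute)
        obtain n0 where n0: "(1 / 2) ^ n0 < ?v / R"
          using real_arch_pow_inv[of "?v / R" "1 / 2"] v R by auto
        \<comment> \<open>The first dyadic radius not exceeding the norm determines the shell of
          \<open>u\<close>; \<open>P 0\<close> fails because \<open>u\<close> lies in the open ball
          of radius \<open>R\<close>.\<close>
        define P where "P n \<longleftrightarrow> R / 2 ^ n \<le> ?v" for n
        have "R * (1 / 2) ^ n0 \<le> R * (?v / R)" using n0 R by (intro mult_left_mono) auto
        then have "P n0" using R by (simp add: P_def power_divide)
        moreover have "\<not> P 0" using v by (simp add: P_def)
        ultimately obtain k where k: "\<not> P k" "P (Suc k)" using ex_least_nat_less[of P n0] by auto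
        then have kk: "\<rho> k \<le> ?v" "?v < 2 * \<rho> k" by (simp_all add: P_def \<rho>_def field_simps)
        have "?v / ?v ^ ?N \<le> 2 * \<rho> k / \<rho> k ^ ?N"
          using kk v \<rho>[of k] by (intro frac_le power_mono) auto
        also have "\<dots> = f k u" using kk by (simp add: f_def dist_norm norm_minus_commute)
        also have "\<dots> \<le> (\<Sum>k. f k u)"
          using sum_le_suminf[OF summable[OF u], of "{k}"] f_nonneg by simp
        finally show ?thesis using True by simp
      qed simp
    qed
  qed
qed

lemma integral_average_tendsto:
  fixes F :: "real ^ 'N::finite \<Rightarrow> 'b::euclidean_space" and \<epsilon> :: "nat \<Rightarrow> real"
  assumes G: "open G" "x \<in> G" and F: "continuous_on G F" and \<epsilon>: "\<epsilon> \<longlonglongrightarrow> 0" "\<And>n. \<epsilon> n > 0"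
    and sub: "\<And>n. ball x (\<epsilon> n) \<subseteq> G"
    and int: "\<And>n. integrable lborel (\<lambda>u. indicator (ball x (\<epsilon> n)) u *\<^sub>R F u)"
  shows "(\<lambda>n. (1 / measure lborel (ball x (\<epsilon> n))) *\<^sub>R (\<integral>u. indicator (ball x (\<epsilon> n)) u *\<^sub>R F u \<partial>lborel)) \<longlonglongrightarrow> F x"
proof (rule metric_LIMSEQ_I)
  fix r :: real assume r: "r > 0"
  have "isCont F x" using G F continuous_on_eq_continuous_at by blast
  then obtain d where d: "d > 0" "\<And>u. dist u x < d \<Longrightarrow> dist (F u) (F x) < r / 2"
    unfolding continuous_at_eps_delta using r half_gt_zero by blast
  obtain n0 where n0: "\<And>n. n \<ge> n0 \<Longrightarrow> \<epsilon> n < d"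
    using order_tendstoD(2)[OF \<epsilon>(1) d(1)] unfolding eventually_sequentially by blast
  have "dist ((1 / measure lborel (ball x (\<epsilon> n))) *\<^sub>R (\<integral>u. indicator (ball x (\<epsilon> n)) u *\<^sub>R F u \<partial>lborel)) (F x) < r"
    if n: "n \<ge> n0" for n
  proof -
    let ?B = "ball x (\<epsilon> n)" and ?m = "measure lborel (ball x (\<epsilon> n))"
    have m: "?m > 0" using \<epsilon>(2)[of n] by simp
    have fin: "emeasure lborel ?B < \<infinity>" by (rule emeasure_lborel_ball_finite)
    have cint: "integrable lborel (\<lambda>u. indicator ?B u *\<^sub>R c)" for c :: 'b
      using fin by (intro integrable_scaleR_left) simp
    have rint: "integrable lborel (\<lambda>u. indicator ?B u * c)" for c :: real
      using fin by (intro integrable_mult_left) simp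
    have "(\<integral>u. indicator ?B u *\<^sub>R F u \<partial>lborel) - ?m *\<^sub>R F x =
        (\<integral>u. indicator ?B u *\<^sub>R F u \<partial>lborel) - (\<integral>u. indicator ?B u *\<^sub>R F x \<partial>lborel)"
      unfolding integral_indicator_ball ..
    also have "\<dots> = (\<integral>u. indicator ?B u *\<^sub>R F u - indicator ?B u *\<^sub>R F x \<partial>lborel)"
      by (rule Bochner_Integration.integral_diff[OF int cint, symmetric])
    finally have eq: "(\<integral>u. indicator ?B u *\<^sub>R F u \<partial>lborel) - ?m *\<^sub>R F x =
      (\<integral>u. indicator ?B u *\<^sub>R F u - indicator ?B u *\<^sub>R F x \<partial>lborel)" .
    have "norm ((\<integral>u. indicator ?B u *\<^sub>R F u \<partial>lborel) - ?m *\<^sub>R F x) \<le> (\<integral>u. indicator ?B u * (r / 2) \<partial>lborel)"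
      unfolding eq
    proof (rule order_trans[OF integral_norm_bound integral_mono'[OF rint]])
      fix u show "norm (indicator ?B u *\<^sub>R F u - indicator ?B u *\<^sub>R F x) \<le> indicator ?B u * (r / 2)"
        using d(2)[of u] n0[OF n] by (auto simp: indicator_def dist_norm norm_minus_commute)
    qed (use r in auto)
    also have "\<dots> = ?m * (r / 2)" using integral_indicator_ball[of x "\<epsilon> n" "r / 2"] by simp
    finally have bound: "norm ((\<integral>u. indicator ?B u *\<^sub>R F u \<partial>lborel) - ?m *\<^sub>R F x) \<le> ?m * (r / 2)" .
    have "(1 / ?m) *\<^sub>R (\<integral>u. indicator ?B u *\<^sub>R F u \<partial>lborel) - F x =
        (1 / ?m) *\<^sub>R ((\<integral>u. indicator ?B u *\<^sub>R F u \<partial>lborel) - ?m *\<^sub>R F x)"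
      using m by (simp add: scaleR_right_diff_distrib)
    then have "dist ((1 / ?m) *\<^sub>R (\<integral>u. indicator ?B u *\<^sub>R F u \<partial>lborel)) (F x) =
        (1 / ?m) * norm ((\<integral>u. indicator ?B u *\<^sub>R F u \<partial>lborel) - ?m *\<^sub>R F x)"
      using m by (simp add: dist_norm)
    also have "\<dots> \<le> (1 / ?m) * (?m * (r / 2))" using m by (intro mult_left_mono bound) simp
    also have "\<dots> = r / 2" using m by simp
    finally show ?thesis using r by simp
  qed
  then show "\<exists>n0. \<forall>n\<ge>n0. dist ((1 / measure lborel (ball x (\<epsilon> n))) *\<^sub>R
      (\<integral>u. indicator (ball x (\<epsilon> n)) u *\<^sub>R F u \<partial>lborel)) (F x) < r" by blast
qed

text \<open>On a coordinate line the equation of the sphere is a monic quadratic in the line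
  parameter, with at most two solutions.\<close>

lemma finite_line_sphere:
  fixes u x :: "real ^ 'N::finite"
  shows "finite {t. u + t *\<^sub>R axis c 1 \<in> sphere x \<epsilon>}"
proof -
  let ?v = "u - x"
  have "{t. u + t *\<^sub>R axis c 1 \<in> sphere x \<epsilon>} \<subseteq>
    {- ?v $ c + sqrt (\<epsilon>\<^sup>2 - ?v \<bullet> ?v + (?v $ c)\<^sup>2), - ?v $ c - sqrt (\<epsilon>\<^sup>2 - ?v \<bullet> ?v + (?v $ c)\<^sup>2)}"
  proof
    fix t assume "t \<in> {t. u + t *\<^sub>R axis c 1 \<in> sphere x \<epsilon>}"
    then have "norm (?v + t *\<^sub>R axis c 1) = \<epsilon>"
      by (simp add: dist_norm norm_minus_commute algebra_simps)
    then have "(?v + t *\<^sub>R axis c 1) \<bullet> (?v + t *\<^sub>R axis c 1) = \<epsilon>\<^sup>2"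
      by (simp add: power2_norm_eq_inner[symmetric])
    moreover have "(?v + t *\<^sub>R axis c 1) \<bullet> (?v + t *\<^sub>R axis c 1) = ?v \<bullet> ?v + 2 * t * ?v $ c + t\<^sup>2"
      unfolding inner_add_left inner_add_right
      by (simp add: inner_axis inner_commute[of "axis c 1"] inner_axis_axis power2_eq_square)
    ultimately have "(t + ?v $ c)\<^sup>2 = \<epsilon>\<^sup>2 - ?v \<bullet> ?v + (?v $ c)\<^sup>2"
      by (simp add: power2_eq_square algebra_simps)
    then have "sqrt (\<epsilon>\<^sup>2 - ?v \<bullet> ?v + (?v $ c)\<^sup>2) = \<bar>t + ?v $ c\<bar>" by (metis real_sqrt_abs)
    then show "t \<in> {- ?v $ c + sqrt (\<epsilon>\<^sup>2 - ?v \<bullet> ?v + (?v $ c)\<^sup>2), - ?v $ c - sqrt (\<epsilon>\<^sup>2 - ?v \<bullet> ?v + (?v $ c)\<^sup>2)}"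
      by (auto simp: abs_if)
  qed
  then show ?thesis by (rule finite_subset) simp
qed

text \<open>Truncating at radius \<open>\<epsilon>\<close> replaces \<open>\<parallel>v\<parallel>\<^sup>-\<^sup>N\<close> by a Lipschitz function that is constant near the pole.\<close>

definition truncated_scale :: "real \<Rightarrow> real ^ 'N::finite \<Rightarrow> real" where
  "truncated_scale \<epsilon> v = 1 / (real CARD('N) * measure lborel (ball (0 :: real ^ 'N) 1) * max (norm v) \<epsilon> ^ CARD('N))"

text \<open>The derivative of |v|^-N along the coordinate \<open>c\<close> is -N v_c / |v|^(N + 2),
  and its factor N cancels the N of the scale. Inside the ball the scale is constant. On the sphere,
  where the scale has a kink, the value from outside is taken.\<close>

definition truncated_scale' :: "real \<Rightarrow> 'N \<Rightarrow> real ^ 'N::finite \<Rightarrow> real" where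
  "truncated_scale' \<epsilon> c v = (if norm v < \<epsilon> then 0 else
     - v $ c / (measure lborel (ball (0 :: real ^ 'N) 1) * max (norm v) \<epsilon> ^ (CARD('N) + 2)))"

lemma continuous_truncated_scale:
  assumes "\<epsilon> > 0" shows "continuous_on UNIV (truncated_scale \<epsilon> :: real ^ 'N::finite \<Rightarrow> real)"
proof -
  have "max (norm v) \<epsilon> \<noteq> 0" for v :: "real ^ 'N" using assms by (auto simp: max_def)
  moreover have "measure lborel (ball (0 :: real ^ 'N) 1) \<noteq> 0" by simp
  ultimately show ?thesis
    unfolding truncated_scale_def[abs_def] by (intro continuous_intros) auto
qed

lemma truncated_scale_line:
  fixes v :: "real ^ 'N::finite"
  assumes \<epsilon>: "\<epsilon> > 0" and v: "norm v \<noteq> \<epsilon>"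
  shows "((\<lambda>t. truncated_scale \<epsilon> (v + t *\<^sub>R axis c 1)) has_real_derivative truncated_scale' \<epsilon> c v) (at 0)"
proof (cases "norm v < \<epsilon>")
  case True
  have "((\<lambda>t. truncated_scale \<epsilon> (v + t *\<^sub>R axis c 1)) has_vector_derivative 0) (at 0)"
    by (rule has_vector_derivative_line_cong[of "\<lambda>_. 1 / (real CARD('N) * measure lborel (ball (0 :: real ^ 'N) 1) * \<epsilon> ^ CARD('N))" _ _ _ "ball 0 \<epsilon>"])
      (use True in \<open>auto simp: truncated_scale_def max_def\<close>)
  then show ?thesis using True by (simp add: truncated_scale'_def has_real_derivative_iff_has_vector_derivative)
next
  case False
  then have gt: "norm v > \<epsilon>" using v by simp
  then have nz: "v \<noteq> 0" using \<epsilon> by auto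
  let ?N = "CARD('N)" and ?V = "measure lborel (ball (0 :: real ^ 'N) 1)"
  have V: "?V > 0" by simp
  have "(norm has_derivative (\<lambda>h. h \<bullet> sgn v)) (at v)"
    using has_derivative_norm[OF nz] by simp
  from has_derivative_imp_line_derivative[OF this, of "axis c 1"]
  have "((\<lambda>t. norm (v + t *\<^sub>R axis c 1)) has_real_derivative v $ c / norm v) (at 0)"
    by (simp add: has_real_derivative_iff_has_vector_derivative inner_axis' sgn_div_norm divide_inverse mult.commute)
  note norm_deriv = this
  obtain M where M: "?N = Suc M" using zero_less_card_finite[where 'a = 'N] by (cases ?N) auto
  have pow: "norm v ^ ?N = norm v * norm v ^ M" "?N - Suc 0 = M" "norm v ^ (?N + 2) = norm v * norm v * norm v * norm v ^ M"
    using M by simp_all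
  have "((\<lambda>t. 1 / (real ?N * ?V) * inverse (norm (v + t *\<^sub>R axis c 1) ^ ?N)) has_real_derivative truncated_scale' \<epsilon> c v) (at 0)"
  proof (rule DERIV_cong[OF DERIV_cmult[OF DERIV_inverse_fun[OF DERIV_power[OF norm_deriv]]]])
    show "norm (v + 0 *\<^sub>R axis c 1) ^ ?N \<noteq> 0" using nz by simp
    have tr: "truncated_scale' \<epsilon> c v = - v $ c / (?V * (norm v * norm v * norm v * norm v ^ M))"
      unfolding truncated_scale'_def pow(3)[symmetric] using gt by (simp add: max_def)
    \<comment> \<open>With K = N, B the unit volume, y the norm and z its power N - 1, the chain
      rule reduces to this identity of rational functions.\<close>
    have val: "1 / (K * B) * - (K * (w / y * z) * inverse ((y * z) ^ Suc (Suc 0))) = - w / (B * (y * y * y * z))"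
      if "K \<noteq> 0" "B \<noteq> 0" "y \<noteq> 0" "z \<noteq> 0" for K B y z w :: real
      using that by (simp add: field_simps)
    show "1 / (real ?N * ?V) * - (real ?N * (v $ c / norm v * norm (v + 0 *\<^sub>R axis c 1) ^ (?N - Suc 0)) *
        inverse ((norm (v + 0 *\<^sub>R axis c 1) ^ ?N) ^ Suc (Suc 0))) = truncated_scale' \<epsilon> c v"
      unfolding tr scaleR_zero_left add_0_right pow(1,2) by (rule val) (use nz V in auto)
  qed
  then have D': "((\<lambda>t. 1 / (real ?N * ?V) * inverse (norm (v + t *\<^sub>R axis c 1) ^ ?N)) has_vector_derivative truncated_scale' \<epsilon> c v) (at 0)"
    by (simp only: has_real_derivative_iff_has_vector_derivative)
  have "((\<lambda>t. truncated_scale \<epsilon> (v + t *\<^sub>R axis c 1)) has_vector_derivative truncated_scale' \<epsilon> c v) (at 0)"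
  proof (rule has_vector_derivative_line_cong[OF D', of "- cball 0 \<epsilon>"])
    show "v \<in> - cball 0 \<epsilon>" using gt by simp
    show "1 / (real ?N * ?V) * inverse (norm w ^ ?N) = truncated_scale \<epsilon> w" if "w \<in> - cball 0 \<epsilon>" for w :: "real ^ 'N"
      using that by (simp add: truncated_scale_def max_def divide_inverse)
  qed auto
  then show ?thesis by (simp only: has_real_derivative_iff_has_vector_derivative)
qed

lemma truncated_scale'_bounded:
  fixes v :: "real ^ 'N::finite"
  assumes "\<epsilon> > 0"
  shows "\<bar>truncated_scale' \<epsilon> c v\<bar> \<le> 1 / (measure lborel (ball (0 :: real ^ 'N) 1) * \<epsilon> ^ (CARD('N) + 1))"
proof (cases "norm v < \<epsilon>")
  case True
  then show ?thesis using assms by (simp add: truncated_scale'_def)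
next
  case False
  let ?N = "CARD('N)" and ?V = "measure lborel (ball (0 :: real ^ 'N) 1)"
  have V: "?V > 0" by simp
  have n: "norm v \<ge> \<epsilon>" "norm v > 0" using False assms by auto
  have "\<bar>truncated_scale' \<epsilon> c v\<bar> = \<bar>v $ c\<bar> / (?V * norm v ^ (?N + 2))"
    using False V by (simp add: truncated_scale'_def max_def abs_mult)
  also have "\<dots> \<le> norm v / (?V * norm v ^ (?N + 2))"
    using V n component_le_norm_cart[of v c] by (intro divide_right_mono) auto
  also have "\<dots> = 1 / (?V * norm v ^ (?N + 1))" using n by simp
  also have "\<dots> \<le> 1 / (?V * \<epsilon> ^ (?N + 1))"
    using V n assms by (intro divide_left_mono mult_left_mono power_mono mult_pos_pos) auto
  finally show ?thesis .
qed

lemma truncated_scale'_measurable: "(\<lambda>v. truncated_scale' \<epsilon> c v) \<in> borel_measurable borel"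
proof -
  have [measurable]: "(\<lambda>v :: real ^ 'a. v $ c) \<in> borel_measurable borel"
    by (intro borel_measurable_continuous_onI continuous_intros)
  show ?thesis unfolding truncated_scale'_def by measurable
qed

text \<open>A bilinear map on finite-dimensional spaces is bounded, whatever the relation between
  norm and product.\<close>

lemma bounded_bilinear_times:
  "bounded_bilinear ((*) :: 'a::{euclidean_space,real_algebra_1} \<Rightarrow> 'a \<Rightarrow> 'a)"
  unfolding bilinear_conv_bounded_bilinear[symmetric] bilinear_def
  by (auto intro!: linearI simp: distrib_left distrib_right)

section \<open>The integral representation\<close>

lemma partial_eq_of_indep:
  assumes "\<And>u v. (\<And>c. c \<noteq> j \<Longrightarrow> u $ c = v $ c) \<Longrightarrow> g u = g v" "\<And>c. c \<noteq> j \<Longrightarrow> u $ c = v $ c"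
  shows "partial c g u = partial c g v"
proof -
  have "(\<lambda>t. g (u + t *\<^sub>R axis c 1)) = (\<lambda>t. g (v + t *\<^sub>R axis c 1))"
    by (rule ext, rule assms(1)) (simp add: assms(2))
  then show ?thesis unfolding partial_def by simp
qed

lemma of_real_times_eq_scaleR: "of_real r * y = r *\<^sub>R (y :: 'a::real_algebra_1)"
  by (simp add: of_real_def)

lemma minus_one_power_times_eq_scaleR: "(- 1) ^ k * y = (- 1) ^ k *\<^sub>R (y :: 'a::real_algebra_1)"
  by (cases "even k") auto

lemma truncated_scale'_outside:
  fixes v :: "real ^ 'N::finite"
  shows "\<not> norm v < \<epsilon> \<Longrightarrow> truncated_scale' \<epsilon> c v =
    - 1 / (measure lborel (ball (0 :: real ^ 'N) 1) * norm v ^ (CARD('N) + 2)) * v $ c"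
  by (simp add: truncated_scale'_def max_def)

context super_index
begin

definition pole_field :: "real \<Rightarrow> real ^ 'N::_ \<Rightarrow> (real ^ 'N::_ \<Rightarrow> 'a) \<Rightarrow> 'N \<Rightarrow> real ^ 'N::_ \<Rightarrow> 'a" where
  "pole_field \<epsilon> x F c u = F u * (truncated_scale \<epsilon> (u - x) *\<^sub>R W c (u - x))"

definition pole_field' ::
  "real \<Rightarrow> real ^ 'N::_ \<Rightarrow> (real ^ 'N::_ \<Rightarrow> 'a) \<Rightarrow> (real ^ 'N::_ \<Rightarrow> (real ^ 'N::_) \<Rightarrow>\<^sub>L 'a) \<Rightarrow> 'N \<Rightarrow> real ^ 'N::_ \<Rightarrow> 'a" where
  "pole_field' \<epsilon> x F F' c u =
     blinfun_apply (F' u) (axis c 1) * (truncated_scale \<epsilon> (u - x) *\<^sub>R W c (u - x)) +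
     F u * (truncated_scale' \<epsilon> c (u - x) *\<^sub>R W c (u - x) + truncated_scale \<epsilon> (u - x) *\<^sub>R 1)"

lemma continuous_W: "continuous_on S (\<lambda>u. W c (u - x))"
  by (intro bounded_linear.continuous_on[OF bounded_linear_W] continuous_intros)

lemma continuous_scaled_W:
  "\<epsilon> > 0 \<Longrightarrow> continuous_on S (\<lambda>u. truncated_scale \<epsilon> (u - x) *\<^sub>R W c (u - x))"
  by (intro continuous_on_scaleR continuous_W
      continuous_on_compose2[OF continuous_truncated_scale[of \<epsilon>]] continuous_intros) auto

text \<open>The derivative of the scale jumps at radius \<epsilon>, so the sphere of that radius is
  the exceptional set.\<close>

lemma stokes_field_pole_field:
  assumes \<epsilon>: "\<epsilon> > 0" and G: "open G" "bounded G"
    and F: "continuous_on (closure G) F" "continuous_on (closure G) F'"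
    and deriv: "\<And>u. u \<in> G \<Longrightarrow> (F has_derivative blinfun_apply (F' u)) (at u)"
  shows "stokes_field G (sphere x \<epsilon>) (pole_field \<epsilon> x F) (pole_field' \<epsilon> x F F')"
  unfolding stokes_field_def
proof (intro allI conjI ballI)
  interpret mult: bounded_bilinear "(*) :: 'a \<Rightarrow> 'a \<Rightarrow> 'a" by (rule bounded_bilinear_times)
  fix c
  let ?D = "\<lambda>u. blinfun_apply (F' u) (axis c 1)"
  let ?A = "\<lambda>u. truncated_scale \<epsilon> (u - x) *\<^sub>R W c (u - x)"
  let ?B = "\<lambda>u. truncated_scale' \<epsilon> c (u - x) *\<^sub>R W c (u - x) + truncated_scale \<epsilon> (u - x) *\<^sub>R 1"
  have A: "continuous_on S ?A" for S by (rule continuous_scaled_W[OF \<epsilon>])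
  have D: "continuous_on (closure G) ?D"
    by (rule bounded_linear.continuous_on[OF blinfun.bounded_linear_left F(2)])
  have scale: "continuous_on S (\<lambda>u. truncated_scale \<epsilon> (u - x))" for S
    by (intro continuous_on_compose2[OF continuous_truncated_scale[OF \<epsilon>]] continuous_intros) auto
  show "continuous_on (closure G) (pole_field \<epsilon> x F c)"
    unfolding pole_field_def by (intro mult.continuous_on F A)
  have GB: "G \<in> sets borel" using G by auto
  have meas_mult: "(\<lambda>u. f u * g u) \<in> borel_measurable borel"
    if "f \<in> borel_measurable borel" "g \<in> borel_measurable borel" for f g :: "real ^ 'N::_ \<Rightarrow> 'a"
    using that by (rule borel_measurable_continuous_Pair) (intro mult.continuous_on continuous_intros)
  have B_meas: "?B \<in> borel_measurable borel"
    by (intro borel_measurable_add borel_measurable_scaleR borel_measurable_const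
        borel_measurable_continuous_onI[OF continuous_W] borel_measurable_continuous_onI[OF scale]
        measurable_compose[OF _ truncated_scale'_measurable]) measurable
  have "(\<lambda>u. (indicator G u *\<^sub>R ?D u) * ?A u + (indicator G u *\<^sub>R F u) * ?B u) \<in> borel_measurable borel"
    by (intro borel_measurable_add meas_mult B_meas borel_measurable_continuous_onI[OF A]
        borel_measurable_continuous_on_indicator GB continuous_on_subset[OF D closure_subset]
        continuous_on_subset[OF F(1) closure_subset])
  moreover have "(\<lambda>u. (indicator G u *\<^sub>R ?D u) * ?A u + (indicator G u *\<^sub>R F u) * ?B u) =
      (\<lambda>u. indicator G u *\<^sub>R pole_field' \<epsilon> x F F' c u)"
    unfolding pole_field'_def by (simp only: scaleR_add_right mult_scaleR_left)
  ultimately show "(\<lambda>u. indicator G u *\<^sub>R pole_field' \<epsilon> x F F' c u) \<in> borel_measurable borel" by simp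
  have cmp: "compact (closure G)" using G by (simp add: compact_closure)
  have bdd: "\<exists>C. \<forall>u\<in>closure G. norm (h u) \<le> C" if "continuous_on (closure G) h"
    for h :: "real ^ 'N::_ \<Rightarrow> 'b::real_normed_vector"
    using compact_imp_bounded[OF compact_continuous_image[OF that cmp]] unfolding bounded_iff by auto
  obtain C1 where C1: "\<forall>u\<in>closure G. norm (?D u * ?A u) \<le> C1" using bdd[OF mult.continuous_on[OF D A]] ..
  obtain C2 where C2: "\<forall>u\<in>closure G. norm (F u) \<le> C2" using bdd[OF F(1)] ..
  obtain C3 where C3: "\<forall>u\<in>closure G. norm (W c (u - x)) \<le> C3" using bdd[OF continuous_W] ..
  obtain C4 where C4: "\<forall>u\<in>closure G. norm (truncated_scale \<epsilon> (u - x) *\<^sub>R (1 :: 'a)) \<le> C4"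
    using bdd[OF continuous_on_scaleR[OF scale continuous_on_const]] by blast
  obtain K where K: "K > 0" "\<And>y z :: 'a. norm (y * z) \<le> norm y * norm z * K" using mult.pos_bounded by blast
  let ?L = "1 / (measure lborel (ball (0 :: real ^ 'N::_) 1) * \<epsilon> ^ (CARD('N) + 1))"
  have "norm (pole_field' \<epsilon> x F F' c u) \<le> C1 + C2 * (?L * C3 + C4) * K" if "u \<in> G" for u
  proof -
    have u: "u \<in> closure G" using that closure_subset by blast
    have b: "norm (?D u * ?A u) \<le> C1" "norm (F u) \<le> C2" "norm (W c (u - x)) \<le> C3"
      "norm (truncated_scale \<epsilon> (u - x) *\<^sub>R (1 :: 'a)) \<le> C4"
      using C1 C2 C3 C4 u by auto
    have L: "\<bar>truncated_scale' \<epsilon> c (u - x)\<bar> \<le> ?L" by (rule truncated_scale'_bounded[OF \<epsilon>])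
    have "norm (truncated_scale' \<epsilon> c (u - x) *\<^sub>R W c (u - x)) \<le> ?L * C3"
      unfolding norm_scaleR by (rule mult_mono[OF L b(3) order_trans[OF abs_ge_zero L] norm_ge_zero])
    then have B: "norm (?B u) \<le> ?L * C3 + C4" by (rule norm_triangle_mono[OF _ b(4)])
    have "norm (F u * ?B u) \<le> norm (F u) * norm (?B u) * K" by (rule K(2))
    also have "\<dots> \<le> C2 * (?L * C3 + C4) * K"
      by (intro mult_right_mono mult_mono b(2) B order_trans[OF norm_ge_zero b(2)] norm_ge_zero less_imp_le[OF K(1)])
    finally show ?thesis unfolding pole_field'_def by (rule norm_triangle_mono[OF b(1)])
  qed
  then show "bounded (pole_field' \<epsilon> x F F' c ` G)" unfolding bounded_iff by blast
  show "finite {t. u + t *\<^sub>R axis c 1 \<in> sphere x \<epsilon>}" for u by (rule finite_line_sphere)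
  fix u assume u: "u \<in> G - sphere x \<epsilon>"
  then have v: "norm (u - x) \<noteq> \<epsilon>" by (auto simp: dist_norm norm_minus_commute)
  have shift: "u + t *\<^sub>R axis c 1 - x = (u - x) + t *\<^sub>R axis c 1" for t by simp
  have W: "((\<lambda>t. W c ((u - x) + t *\<^sub>R axis c 1)) has_vector_derivative 1) (at 0)"
    unfolding W_line by (auto intro!: derivative_eq_intros)
  have "((\<lambda>t. truncated_scale \<epsilon> ((u - x) + t *\<^sub>R axis c 1) *\<^sub>R W c ((u - x) + t *\<^sub>R axis c 1))
      has_vector_derivative ?B u) (at 0)"
    using has_vector_derivative_scaleR[OF truncated_scale_line[OF \<epsilon> v, of c] W] by (simp add: add.commute)
  from mult.has_vector_derivative[OF has_derivative_imp_line_derivative[OF deriv[of u], of "axis c 1"] this]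
  show "((\<lambda>t. pole_field \<epsilon> x F c (u + t *\<^sub>R axis c 1)) has_vector_derivative pole_field' \<epsilon> x F F' c u) (at 0)"
    using u unfolding pole_field_def pole_field'_def shift by (simp add: add.commute)
qed

text \<open>The truncated kernel field has as divergence the normalised indicator of the ball.
  Inside, the scale is constant and each of the N components of W contributes it once. Outside, the
  derivative of the scale contributes -1 / (V |v|^N) by \<open>sum_coordinate_W\<close>, which
  cancels those N terms.\<close>

lemma sum_pole_field':
  assumes \<epsilon>: "\<epsilon> > 0"
  shows "(\<Sum>c\<in>UNIV. pole_field' \<epsilon> x F F' c u) =
    (\<Sum>c\<in>UNIV. blinfun_apply (F' u) (axis c 1) * (truncated_scale \<epsilon> (u - x) *\<^sub>R W c (u - x))) +
    (1 / measure lborel (ball x \<epsilon>)) *\<^sub>R (indicator (ball x \<epsilon>) u *\<^sub>R F u)"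
proof -
  let ?v = "u - x" and ?V = "measure lborel (ball (0 :: real ^ 'N::_) 1)" and ?N = "CARD('N)"
  have V: "?V > 0" by simp
  have ball: "measure lborel (ball x \<epsilon>) = \<epsilon> ^ ?N * ?V"
    using content_ball_conv_unit_ball[of \<epsilon> x] \<epsilon> by simp
  have N_scale: "real ?N * truncated_scale \<epsilon> ?v = 1 / (?V * max (norm ?v) \<epsilon> ^ ?N)"
    by (simp add: truncated_scale_def)
  have "(\<Sum>c\<in>UNIV. truncated_scale' \<epsilon> c ?v *\<^sub>R W c ?v) + (\<Sum>c\<in>(UNIV :: 'N set). truncated_scale \<epsilon> ?v *\<^sub>R (1 :: 'a)) =
      (indicator (ball x \<epsilon>) u / measure lborel (ball x \<epsilon>)) *\<^sub>R 1"
  proof (cases "norm ?v < \<epsilon>")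
    case True
    then have "u \<in> ball x \<epsilon>" by (simp add: dist_norm norm_minus_commute)
    moreover have "(\<Sum>c\<in>(UNIV :: 'N set). truncated_scale \<epsilon> ?v *\<^sub>R (1 :: 'a)) = (real ?N * truncated_scale \<epsilon> ?v) *\<^sub>R 1"
      by (simp only: sum_constant_scaleR scaleR_scaleR)
    ultimately show ?thesis using True unfolding N_scale
      by (simp add: truncated_scale'_def ball max_def mult.commute)
  next
    case False
    then have n: "norm ?v \<ge> \<epsilon>" "norm ?v > 0" "u \<notin> ball x \<epsilon>" using \<epsilon> by (auto simp: dist_norm norm_minus_commute)
    have "(\<Sum>c\<in>UNIV. truncated_scale' \<epsilon> c ?v *\<^sub>R W c ?v) =
        (\<Sum>c\<in>UNIV. (- 1 / (?V * norm ?v ^ (?N + 2))) *\<^sub>R (?v $ c *\<^sub>R W c ?v))"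
      by (intro sum.cong refl) (simp only: truncated_scale'_outside[OF False] scaleR_scaleR)
    also have "\<dots> = (- 1 / (?V * norm ?v ^ (?N + 2))) *\<^sub>R ((?v \<bullet> ?v) *\<^sub>R 1)"
      unfolding scaleR_sum_right[symmetric] sum_coordinate_W ..
    also have "\<dots> = (- (1 / (?V * norm ?v ^ ?N))) *\<^sub>R 1"
      using n by (simp add: power2_norm_eq_inner[symmetric] power2_eq_square)
    finally have 1: "(\<Sum>c\<in>UNIV. truncated_scale' \<epsilon> c ?v *\<^sub>R W c ?v) = (- (1 / (?V * norm ?v ^ ?N))) *\<^sub>R 1" .
    have "(\<Sum>c\<in>(UNIV :: 'N set). truncated_scale \<epsilon> ?v *\<^sub>R (1 :: 'a)) = (real ?N * truncated_scale \<epsilon> ?v) *\<^sub>R 1"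
      by (simp only: sum_constant_scaleR scaleR_scaleR)
    also have "\<dots> = (1 / (?V * norm ?v ^ ?N)) *\<^sub>R 1"
      unfolding N_scale using n by (simp add: max_def)
    finally show ?thesis using n unfolding 1 by simp
  qed
  then have *: "(\<Sum>c\<in>UNIV. F u * (truncated_scale' \<epsilon> c ?v *\<^sub>R W c ?v + truncated_scale \<epsilon> ?v *\<^sub>R 1)) =
      F u * ((indicator (ball x \<epsilon>) u / measure lborel (ball x \<epsilon>)) *\<^sub>R 1)"
    unfolding sum_distrib_left[symmetric] sum.distrib by simp
  show ?thesis
    unfolding pole_field'_def sum.distrib[of "\<lambda>c. _ c * _ c"] * by (simp add: sum.distrib *)
qed

text \<open>The frontier does not meet the ball of truncation, so true and truncated kernel agree
  wherever the partition function is non-zero on the graph. The factor on the right is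
  \<open>graph_sign j \<sigma>\<close>, its own inverse; it disappears when the oriented charts are
  summed.\<close>

lemma graph_integrand_eq:
  assumes G: "open G" and ch: "oriented_chart G U j \<sigma> g \<rho>" and \<epsilon>: "\<epsilon> > 0" "ball x \<epsilon> \<subseteq> G"
  shows "graph_integrand j g \<rho> (mult_form F (super_kernel n m p q r e s a x)) t =
    ((- 1) ^ card {c. c < j} * \<sigma>) *\<^sub>R chart_flux j \<sigma> g \<rho> (pole_field \<epsilon> x F) t"
proof -
  let ?z = "insert_zero j t" and ?u = "graph_map j g (insert_zero j t)"
  let ?w = "\<lambda>u c. F u * (kernel_scale (u - x) *\<^sub>R W c (u - x))"
  have ch: "graph_chart G U j \<sigma> g" "closure {u. \<rho> u \<noteq> 0} \<subseteq> U" using ch unfolding oriented_chart_def by auto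
  have \<sigma>: "\<sigma> * \<sigma> = 1" and indep: "\<And>u v. (\<And>c. c \<noteq> j \<Longrightarrow> u $ c = v $ c) \<Longrightarrow> g u = g v"
    using ch(1) unfolding graph_chart_def by auto
  \<comment> \<open>\<open>pullback\<close> differentiates at the parameter point,
    \<open>chart_flux\<close> at the point on the graph; they differ in the coordinate
    \<open>j\<close> only.\<close>
  have p: "partial c g ?z = partial c g ?u" for c
    by (rule partial_eq_of_indep[OF indep]) (auto simp: graph_map_def)
  have form: "mult_form F (super_kernel n m p q r e s a x) = (\<lambda>u. flux_form (?w u))"
    by (intro ext) (simp only: mult_form_def super_kernel_eq_flux_form flux_form_mult)
  have pb: "pullback (graph_map j g) (mult_form F (super_kernel n m p q r e s a x)) ?z (- {j}) =
      (- 1) ^ card {c. c < j} *\<^sub>R (?w ?u j - (\<Sum>c\<in>-{j}. partial c g ?u *\<^sub>R ?w ?u c))"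
    unfolding form pullback_graph_flux_form minus_one_power_times_eq_scaleR of_real_times_eq_scaleR p ..
  show ?thesis
  proof (cases "\<rho> ?u = 0")
    case True
    then show ?thesis by (simp add: graph_integrand_def chart_flux_def Let_def)
  next
    case False
    then have "?u \<in> U" using ch(2) closure_subset[of "{u. \<rho> u \<noteq> 0}"] by blast
    then have "?u \<in> frontier G" by (rule graph_point_in_frontier[OF G ch(1)])
    then have "?u \<notin> ball x \<epsilon>" using \<epsilon>(2) G by (auto simp: frontier_def interior_open)
    then have "norm (?u - x) \<ge> \<epsilon>" by (simp add: dist_norm norm_minus_commute)
    then have "?w ?u c = pole_field \<epsilon> x F c ?u" for c
      by (simp add: pole_field_def truncated_scale_def max_def)
    then show ?thesis
      unfolding graph_integrand_def chart_flux_def Let_def pb using \<sigma>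
      by (simp only: scaleR_scaleR) (simp add: mult.assoc mult.left_commute[of \<sigma>])
  qed
qed

text \<open>The equivalence yields existence and uniqueness of the boundary integral together:
  uniqueness from \<open>divergence_theorem\<close> for arbitrary admissible charts, existence from
  \<open>exists_partition_of_unity\<close>.\<close>

lemma has_boundary_integral_iff:
  assumes G: "open G" "bounded G" "C1_boundary G"
    and field: "stokes_field G E (pole_field \<epsilon> x F) w'" and \<epsilon>: "\<epsilon> > 0" "ball x \<epsilon> \<subseteq> G"
  shows "has_boundary_integral G (mult_form F (super_kernel n m p q r e s a x)) I \<longleftrightarrow>
    I = (\<integral>u. indicator G u *\<^sub>R (\<Sum>c\<in>UNIV. w' c u) \<partial>lborel)"
proof -
  let ?\<omega> = "mult_form F (super_kernel n m p q r e s a x)"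
  let ?D = "\<integral>u. indicator G u *\<^sub>R (\<Sum>c\<in>UNIV. w' c u) \<partial>lborel"
  have eq: "graph_integrand j g \<rho> ?\<omega> = (\<lambda>t. ((- 1) ^ card {c. c < j} * \<sigma>) *\<^sub>R chart_flux j \<sigma> g \<rho> (pole_field \<epsilon> x F) t)"
    if "oriented_chart G U j \<sigma> g \<rho>" for U j \<sigma> g \<rho>
    using graph_integrand_eq[OF G(1) that \<epsilon>] by blast
  have int: "integrable (\<Pi>\<^sub>M c\<in>-{j}. lborel) (graph_integrand j g \<rho> ?\<omega>)"
    if "oriented_chart G U j \<sigma> g \<rho>" for U j \<sigma> g \<rho>
    unfolding eq[OF that] by (intro integrable_scaleR_right chart_flux_divergence(1)[OF G(1,2) that field])
  have val: "graph_sign j \<sigma> *\<^sub>R (\<integral>t. graph_integrand j g \<rho> ?\<omega> t \<partial>(\<Pi>\<^sub>M c\<in>-{j}. lborel)) =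
      (\<integral>t. chart_flux j \<sigma> g \<rho> (pole_field \<epsilon> x F) t \<partial>(\<Pi>\<^sub>M c\<in>-{j}. lborel))"
    if ch: "oriented_chart G U j \<sigma> g \<rho>" for U j \<sigma> g \<rho>
  proof -
    have "\<sigma> * \<sigma> = 1" using ch unfolding oriented_chart_def graph_chart_def by auto
    then have "graph_sign j \<sigma> * ((- 1) ^ card {c. c < j} * \<sigma>) = 1"
      unfolding graph_sign_def by (cases "even (card {c. c < j})") auto
    then show ?thesis unfolding eq[OF ch] by (simp add: mult.assoc)
  qed
  have sum: "(\<Sum>i<M. graph_sign (j i) (\<sigma> i) *\<^sub>R
      (\<integral>t. graph_integrand (j i) (g i) (\<rho> i) ?\<omega> t \<partial>(\<Pi>\<^sub>M c\<in>-{j i}. lborel))) = ?D"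
    if ch: "\<And>i. i < M \<Longrightarrow> oriented_chart G (U i) (j i) (\<sigma> i) (g i) (\<rho> i)"
      and one: "\<And>u. u \<in> frontier G \<Longrightarrow> (\<Sum>i<M. \<rho> i u) = 1" for M :: nat and U j \<sigma> g \<rho>
  proof -
    have "(\<Sum>i<M. graph_sign (j i) (\<sigma> i) *\<^sub>R
      (\<integral>t. graph_integrand (j i) (g i) (\<rho> i) ?\<omega> t \<partial>(\<Pi>\<^sub>M c\<in>-{j i}. lborel))) =
      charts_flux M j \<sigma> g \<rho> (pole_field \<epsilon> x F)"
      by (intro sum.cong refl val[OF ch]) simp
    then show ?thesis using divergence_theorem[OF G field ch one] by simp
  qed
  show ?thesis
  proof
    assume "has_boundary_integral G ?\<omega> I"
    then obtain M :: nat and U j \<sigma> g \<rho> where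
      *: "\<forall>i<M. graph_chart G (U i) (j i) (\<sigma> i) (g i) \<and> C1 (\<rho> i) \<and> (\<forall>u. 0 \<le> \<rho> i u) \<and>
               compact (closure {u. \<rho> i u \<noteq> 0}) \<and> closure {u. \<rho> i u \<noteq> 0} \<subseteq> U i \<and>
               integrable (\<Pi>\<^sub>M c\<in>- {j i}. lborel) (graph_integrand (j i) (g i) (\<rho> i) ?\<omega>)"
        "\<forall>u\<in>frontier G. (\<Sum>i<M. \<rho> i u) = 1"
        "I = (\<Sum>i<M. graph_sign (j i) (\<sigma> i) *\<^sub>R
               (\<integral>t. graph_integrand (j i) (g i) (\<rho> i) ?\<omega> t \<partial>(\<Pi>\<^sub>M c\<in>- {j i}. lborel)))"
      unfolding has_boundary_integral_def by (elim exE conjE)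
    have "oriented_chart G (U i) (j i) (\<sigma> i) (g i) (\<rho> i)" if "i < M" for i
      using *(1) that unfolding oriented_chart_def by simp
    from sum[OF this] *(2,3) show "I = ?D" by simp
  next
    assume I: "I = ?D"
    obtain M :: nat and U j \<sigma> g \<rho> V where
      ch: "\<And>i. i < M \<Longrightarrow> oriented_chart G (U i) (j i) (\<sigma> i) (g i) (\<rho> i)"
      and V: "open V" "frontier G \<subseteq> V" "\<And>u. u \<in> V \<Longrightarrow> (\<Sum>i<M. \<rho> i u) = 1"
      using exists_partition_of_unity[OF G(2,3)] by metis
    have one: "\<And>u. u \<in> frontier G \<Longrightarrow> (\<Sum>i<M. \<rho> i u) = 1" using V by blast
    have "\<forall>i<M. graph_chart G (U i) (j i) (\<sigma> i) (g i) \<and> C1 (\<rho> i) \<and> (\<forall>u. 0 \<le> \<rho> i u) \<and>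
               compact (closure {u. \<rho> i u \<noteq> 0}) \<and> closure {u. \<rho> i u \<noteq> 0} \<subseteq> U i \<and>
               integrable (\<Pi>\<^sub>M c\<in>- {j i}. lborel) (graph_integrand (j i) (g i) (\<rho> i) ?\<omega>)"
      using ch int[OF ch] unfolding oriented_chart_def by simp
    then show "has_boundary_integral G ?\<omega> I"
      unfolding has_boundary_integral_def using one I sum[OF ch one]
      by (intro exI[of _ M] exI[of _ U] exI[of _ j] exI[of _ \<sigma>] exI[of _ g] exI[of _ \<rho>] conjI) simp_all
  qed
qed

text \<open>Truncation only decreases the scale and \<open>W\<close> is linear, so the bound is
  uniform in \<epsilon>. It supplies the majorant for the limit of vanishing \<epsilon>.\<close>

lemma singular_integrand_bound:
  fixes F' :: "real ^ 'N::_ \<Rightarrow> (real ^ 'N::_) \<Rightarrow>\<^sub>L 'a"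
  assumes F': "continuous_on (closure G) F'" and G: "bounded G"
  obtains C where "C \<ge> 0" "\<And>u. u \<in> G \<Longrightarrow> \<forall>\<epsilon>>0.
    norm (\<Sum>c\<in>UNIV. blinfun_apply (F' u) (axis c 1) * (truncated_scale \<epsilon> (u - x) *\<^sub>R W c (u - x))) \<le>
      C * (norm (u - x) / norm (u - x) ^ CARD('N))"
proof -
  interpret mult: bounded_bilinear "(*) :: 'a \<Rightarrow> 'a \<Rightarrow> 'a" by (rule bounded_bilinear_times)
  obtain K where K: "K > 0" "\<And>y z :: 'a. norm (y * z) \<le> norm y * norm z * K" using mult.pos_bounded by blast
  have "\<forall>c. \<exists>B. B > 0 \<and> (\<forall>v. norm (W c v) \<le> norm v * B)"
    using bounded_linear.pos_bounded[OF bounded_linear_W] by blast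
  then obtain B where B: "\<And>c. B c > 0" "\<And>c v. norm (W c v) \<le> norm v * B c" by metis
  have "compact (closure G)" using G by (simp add: compact_closure)
  then obtain A where A: "\<And>u. u \<in> closure G \<Longrightarrow> norm (F' u) \<le> A"
    using compact_imp_bounded[OF compact_continuous_image[OF F']] unfolding bounded_iff by auto
  let ?V = "measure lborel (ball (0 :: real ^ 'N::_) 1)" and ?N = "CARD('N)"
  have V: "?V > 0" by simp
  let ?C = "\<lambda>c. max 0 A * (B c / (real ?N * ?V)) * K"
  have C: "?C c \<ge> 0" for c using B(1)[of c] K(1) by (intro mult_nonneg_nonneg) (auto simp: less_imp_le)
  show ?thesis
  proof (rule that[of "\<Sum>c\<in>UNIV. ?C c"])
    show "(\<Sum>c\<in>UNIV. ?C c) \<ge> 0" by (intro sum_nonneg C)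
    fix u assume "u \<in> G"
    then have u: "u \<in> closure G" using closure_subset by blast
    show "\<forall>\<epsilon>>0. norm (\<Sum>c\<in>UNIV. blinfun_apply (F' u) (axis c 1) * (truncated_scale \<epsilon> (u - x) *\<^sub>R W c (u - x))) \<le>
      (\<Sum>c\<in>UNIV. ?C c) * (norm (u - x) / norm (u - x) ^ ?N)"
    proof (intro allI impI)
      fix \<epsilon> :: real assume \<epsilon>: "\<epsilon> > 0"
      let ?v = "u - x"
      show "norm (\<Sum>c\<in>UNIV. blinfun_apply (F' u) (axis c 1) * (truncated_scale \<epsilon> ?v *\<^sub>R W c ?v)) \<le>
        (\<Sum>c\<in>UNIV. ?C c) * (norm ?v / norm ?v ^ ?N)"
        unfolding sum_distrib_right
      proof (rule sum_norm_le)
        fix c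
        have 1: "norm (blinfun_apply (F' u) (axis c 1)) \<le> max 0 A"
          using norm_blinfun[of "F' u" "axis c 1"] A[OF u] by simp
        have 2: "norm (truncated_scale \<epsilon> ?v *\<^sub>R W c ?v) \<le> B c / (real ?N * ?V) * (norm ?v / norm ?v ^ ?N)"
        proof (cases "?v = 0")
          case True
          \<comment> \<open>At the pole both sides are 0, the right one because division by 0 gives
            0.\<close>
          have "W c 0 = 0" using linear_0[OF bounded_linear.linear[OF bounded_linear_W]] .
          then show ?thesis using True by simp
        next
          case False
          have pos: "norm ?v > 0" using False by simp
          have "\<bar>truncated_scale \<epsilon> ?v\<bar> \<le> 1 / (real ?N * ?V * norm ?v ^ ?N)"
          proof -
            have "\<bar>truncated_scale \<epsilon> ?v\<bar> = 1 / (real ?N * ?V * max (norm ?v) \<epsilon> ^ ?N)"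
              using V \<epsilon> by (simp add: truncated_scale_def abs_mult)
            also have "\<dots> \<le> 1 / (real ?N * ?V * norm ?v ^ ?N)"
              using V pos \<epsilon> by (intro divide_left_mono mult_left_mono power_mono mult_pos_pos) auto
            finally show ?thesis .
          qed
          then have "norm (truncated_scale \<epsilon> ?v *\<^sub>R W c ?v) \<le> 1 / (real ?N * ?V * norm ?v ^ ?N) * (norm ?v * B c)"
            unfolding norm_scaleR by (intro mult_mono B(2)) (use V pos in auto)
          also have "\<dots> = B c / (real ?N * ?V) * (norm ?v / norm ?v ^ ?N)" by simp
          finally show ?thesis .
        qed
        have "norm (blinfun_apply (F' u) (axis c 1) * (truncated_scale \<epsilon> ?v *\<^sub>R W c ?v)) \<le>
            norm (blinfun_apply (F' u) (axis c 1)) * norm (truncated_scale \<epsilon> ?v *\<^sub>R W c ?v) * K" by (rule K(2))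
        also have "\<dots> \<le> max 0 A * (B c / (real ?N * ?V) * (norm ?v / norm ?v ^ ?N)) * K"
          using K(1) by (intro mult_right_mono mult_mono 1 2) auto
        also have "\<dots> = ?C c * (norm ?v / norm ?v ^ ?N)" by simp
        finally show "norm (blinfun_apply (F' u) (axis c 1) * (truncated_scale \<epsilon> ?v *\<^sub>R W c ?v)) \<le>
            ?C c * (norm ?v / norm ?v ^ ?N)" .
      qed
    qed
  qed
qed

end

section \<open>The limit of vanishing truncation radius\<close>

context super_index
begin

theorem integral_representation:
  fixes F :: "real ^ 'N::_ \<Rightarrow> 'a" and x :: "real ^ 'N::_"
  assumes G: "open G" "bounded G" "C1_boundary G" and F: "C1_closure G F" and x: "x \<in> G"
  defines "\<omega> \<equiv> mult_form F (super_kernel n m p q r e s a x)"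
    and "\<eta> \<equiv> \<lambda>u. wedge (d'' n m p q r e s a (zero_form F) u) (super_kernel n m p q r e s a x u)"
  shows "boundary_integrable G \<omega> \<and> domain_integrable G \<eta> \<and>
    F x = boundary_integral G \<omega> - domain_integral G \<eta>"
proof -
  have F_cont: "continuous_on (closure G) F"
    and ex: "\<exists>F'. (\<forall>u\<in>G. (F has_derivative blinfun_apply (F' u)) (at u)) \<and> continuous_on (closure G) F'"
    using F unfolding C1_closure_def by simp_all
  from ex obtain F' where "(\<forall>u\<in>G. (F has_derivative blinfun_apply (F' u)) (at u)) \<and> continuous_on (closure G) F'" ..
  then have deriv: "\<And>u. u \<in> G \<Longrightarrow> (F has_derivative blinfun_apply (F' u)) (at u)"
    and F'_cont: "continuous_on (closure G) F'" by simp_all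
  obtain r0 where r0: "r0 > 0" "ball x r0 \<subseteq> G" using G(1) x open_contains_ball by blast
  \<comment> \<open>The radii never exceed r0, so every ball of truncation lies in
    \<open>G\<close>.\<close>
  define \<epsilon> where "\<epsilon> k = r0 / real (Suc k)" for k
  have \<epsilon>_pos: "\<epsilon> k > 0" for k using r0 by (simp add: \<epsilon>_def)
  have "\<epsilon> k \<le> r0" for k using r0 by (simp add: \<epsilon>_def field_simps)
  then have \<epsilon>_ball: "ball x (\<epsilon> k) \<subseteq> G" for k by (rule order_trans[OF subset_ball r0(2)])
  have \<epsilon>_lim: "\<epsilon> \<longlonglongrightarrow> 0"
    unfolding \<epsilon>_def[abs_def] using LIMSEQ_Suc[OF lim_const_over_n[of r0]] by simp
  let ?S = "\<lambda>k u. \<Sum>c\<in>UNIV. blinfun_apply (F' u) (axis c 1) * (truncated_scale (\<epsilon> k) (u - x) *\<^sub>R W c (u - x))"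
  let ?T = "\<lambda>u. \<Sum>c\<in>UNIV. blinfun_apply (F' u) (axis c 1) * (kernel_scale (u - x) *\<^sub>R W c (u - x))"
  let ?w' = "\<lambda>k. pole_field' (\<epsilon> k) x F F'"
  define D where "D k = (\<integral>u. indicator G u *\<^sub>R (\<Sum>c\<in>UNIV. ?w' k c u) \<partial>lborel)" for k
  have field: "stokes_field G (sphere x (\<epsilon> k)) (pole_field (\<epsilon> k) x F) (?w' k)" for k
    by (rule stokes_field_pole_field[OF \<epsilon>_pos G(1,2) F_cont F'_cont deriv])
  have bi: "has_boundary_integral G \<omega> I \<longleftrightarrow> I = D k" for I k
    unfolding \<omega>_def D_def by (rule has_boundary_integral_iff[OF G field \<epsilon>_pos \<epsilon>_ball])
  \<comment> \<open>All \<open>D k\<close> are values of the same boundary integral, whose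
    definition does not involve the truncation.\<close>
  have D_const: "D k = D 0" for k using bi[of "D k" k] bi[of "D k" 0] by blast
  have bint: "boundary_integrable G \<omega>" "boundary_integral G \<omega> = D 0"
    unfolding boundary_integrable_def boundary_integral_def bi[of _ 0] by auto

  have cmp: "compact (closure G)" using G by (simp add: compact_closure)
  obtain B where B: "\<And>u. u \<in> closure G \<Longrightarrow> norm (F u) \<le> B"
    using compact_imp_bounded[OF compact_continuous_image[OF F_cont cmp]] unfolding bounded_iff by auto
  have ball_int: "integrable lborel (\<lambda>u. indicator (ball x (\<epsilon> k)) u *\<^sub>R F u)" for k
  proof (rule integrable_lborel_bounded[of _ "max 0 B" "ball x (\<epsilon> k)"])
    have "ball x (\<epsilon> k) \<subseteq> closure G" using \<epsilon>_ball closure_subset by blast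
    then show "(\<lambda>u. indicator (ball x (\<epsilon> k)) u *\<^sub>R F u) \<in> borel_measurable borel"
      using continuous_on_subset[OF F_cont] by (intro borel_measurable_continuous_on_indicator) auto
    show "norm (indicator (ball x (\<epsilon> k)) u *\<^sub>R F u) \<le> max 0 B" for u
    proof (cases "u \<in> ball x (\<epsilon> k)")
      case True
      then have "u \<in> closure G" using \<epsilon>_ball closure_subset by blast
      then show ?thesis using B[of u] True by (simp add: le_max_iff_disj)
    qed simp
  qed (auto simp: indicator_def split: if_splits)
  have w'_int: "integrable lborel (\<lambda>u. indicator G u *\<^sub>R (\<Sum>c\<in>UNIV. ?w' k c u))" for k
    unfolding scaleR_sum_right
    by (intro Bochner_Integration.integrable_sum stokes_field_integrable[OF G(2) field])
  let ?A = "\<lambda>k u. (1 / measure lborel (ball x (\<epsilon> k))) *\<^sub>R (indicator (ball x (\<epsilon> k)) u *\<^sub>R F u)"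
  have A_int: "integrable lborel (?A k)" for k by (intro integrable_scaleR_right ball_int)
  have split: "indicator G u *\<^sub>R ?S k u = indicator G u *\<^sub>R (\<Sum>c\<in>UNIV. ?w' k c u) - ?A k u" for k u
    unfolding sum_pole_field'[OF \<epsilon>_pos] using \<epsilon>_ball[of k] by (auto simp: indicator_def)
  have S_int: "integrable lborel (\<lambda>u. indicator G u *\<^sub>R ?S k u)" for k
    unfolding split by (intro Bochner_Integration.integrable_diff w'_int A_int)
  have S_val: "(\<integral>u. indicator G u *\<^sub>R ?S k u \<partial>lborel) = D k - integral\<^sup>L lborel (?A k)" for k
    unfolding split D_def by (rule Bochner_Integration.integral_diff[OF w'_int A_int])
  have A_val: "integral\<^sup>L lborel (?A k) =
      (1 / measure lborel (ball x (\<epsilon> k))) *\<^sub>R (\<integral>u. indicator (ball x (\<epsilon> k)) u *\<^sub>R F u \<partial>lborel)" for k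
    by (rule integral_scaleR_right)
  have D_eq: "D k = (\<integral>u. indicator G u *\<^sub>R ?S k u \<partial>lborel) +
      (1 / measure lborel (ball x (\<epsilon> k))) *\<^sub>R (\<integral>u. indicator (ball x (\<epsilon> k)) u *\<^sub>R F u \<partial>lborel)" for k
    unfolding S_val A_val by (simp only: diff_add_cancel)
  have avg: "(\<lambda>k. (1 / measure lborel (ball x (\<epsilon> k))) *\<^sub>R (\<integral>u. indicator (ball x (\<epsilon> k)) u *\<^sub>R F u \<partial>lborel)) \<longlonglongrightarrow> F x"
    by (rule integral_average_tendsto[OF G(1) x continuous_on_subset[OF F_cont closure_subset] \<epsilon>_lim \<epsilon>_pos \<epsilon>_ball ball_int])

  obtain C where C: "C \<ge> 0" "\<And>u. u \<in> G \<Longrightarrow> \<forall>\<epsilon>>0.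
    norm (\<Sum>c\<in>UNIV. blinfun_apply (F' u) (axis c 1) * (truncated_scale \<epsilon> (u - x) *\<^sub>R W c (u - x))) \<le>
      C * (norm (u - x) / norm (u - x) ^ CARD('N))"
    using singular_integrand_bound[OF F'_cont G(2), of x] by blast
  obtain R where R: "R > 0" "G \<subseteq> ball x R" using bounded_subset_ballD[OF G(2), of x] by blast
  let ?M = "\<lambda>u. C * (indicator (ball x R) u * (norm (u - x) / norm (u - x) ^ CARD('N)))"
  have M_int: "integrable lborel ?M"
    by (intro integrable_mult_right integrable_norm_power_singularity R)
  have bound: "norm (indicator G u *\<^sub>R ?S k u) \<le> ?M u" for k u
    using C(1) C(2)[of u] R(2) \<epsilon>_pos[of k] by (cases "u \<in> G") auto
  have ptw: "(\<lambda>k. indicator G u *\<^sub>R ?S k u) \<longlonglongrightarrow> indicator G u *\<^sub>R ?T u" for u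
  proof (cases "u = x")
    case True
    \<comment> \<open>At the pole truncated and true integrands both vanish with \<open>W\<close>,
      so the pointwise limit holds there too.\<close>
    have "W c 0 = 0" for c using linear_0[OF bounded_linear.linear[OF bounded_linear_W]] .
    then show ?thesis using True by simp
  next
    case False
    then have "0 < norm (u - x)" by simp
    from order_tendstoD(2)[OF \<epsilon>_lim this]
    have "\<forall>\<^sub>F k in sequentially. indicator G u *\<^sub>R ?T u = indicator G u *\<^sub>R ?S k u"
    proof eventually_elim
      case (elim k)
      then have "truncated_scale (\<epsilon> k) (u - x) = kernel_scale (u - x)"
        by (simp add: truncated_scale_def max_def)
      then show ?case by simp
    qed
    then show ?thesis by (rule Lim_transform_eventually[OF tendsto_const])
  qed
  have S_meas: "(\<lambda>u. indicator G u *\<^sub>R ?S k u) \<in> borel_measurable lborel" for k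
    using S_int by (rule borel_measurable_integrable)
  have T_meas: "(\<lambda>u. indicator G u *\<^sub>R ?T u) \<in> borel_measurable lborel"
    by (rule borel_measurable_LIMSEQ_metric[OF S_meas ptw])
  note dom = T_meas S_meas M_int AE_I2[OF ptw] AE_I2[OF bound]
  have T_int: "integrable lborel (\<lambda>u. indicator G u *\<^sub>R ?T u)"
    by (rule integrable_dominated_convergence[OF dom])
  have lim: "(\<lambda>k. \<integral>u. indicator G u *\<^sub>R ?S k u \<partial>lborel) \<longlonglongrightarrow> (\<integral>u. indicator G u *\<^sub>R ?T u \<partial>lborel)"
    by (rule integral_dominated_convergence[OF dom])
  have D_lim: "(\<lambda>k. D k) \<longlonglongrightarrow> (\<integral>u. indicator G u *\<^sub>R ?T u \<partial>lborel) + F x"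
    unfolding D_eq by (rule tendsto_add[OF lim avg])
  have "(\<lambda>k::nat. D 0) \<longlonglongrightarrow> (\<integral>u. indicator G u *\<^sub>R ?T u \<partial>lborel) + F x"
    by (rule Lim_transform_eventually[OF D_lim always_eventually]) (intro allI D_const)
  then have rep: "D 0 = (\<integral>u. indicator G u *\<^sub>R ?T u \<partial>lborel) + F x"
    by (rule LIMSEQ_unique[OF tendsto_const])

  \<comment> \<open>Outside \<open>G\<close> the partial derivatives of \<open>F\<close> are
    unrelated to \<open>F'\<close>; the indicator removes these points.\<close>
  have \<eta>: "(\<lambda>u. indicator G u *\<^sub>R \<eta> u UNIV) = (\<lambda>u. indicator G u *\<^sub>R ?T u)"
  proof
    fix u show "indicator G u *\<^sub>R \<eta> u UNIV = indicator G u *\<^sub>R ?T u"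
    proof (cases "u \<in> G")
      case True
      then show ?thesis
        unfolding \<eta>_def wedge_d''_super_kernel has_derivative_imp_partial[OF deriv[OF True]] by simp
    qed simp
  qed
  have dom_int: "domain_integrable G \<eta>" "domain_integral G \<eta> = (\<integral>u. indicator G u *\<^sub>R ?T u \<partial>lborel)"
    unfolding domain_integrable_def domain_integral_def set_integrable_def set_lebesgue_integral_def \<eta>
    using T_int by (simp_all only:)
  show ?thesis
  proof (intro conjI bint(1) dom_int(1))
    show "F x = boundary_integral G \<omega> - domain_integral G \<eta>"
      unfolding bint(2) rep dom_int(2) by (simp only: add_diff_cancel_left')
  qed
qed

end

section \<open>From the superalgebra to real coordinates\<close>

lemma comm_superalgebra_even_central:
  assumes "comm_superalgebra \<Lambda>" "y \<in> \<Lambda> 0"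
  shows "y * z = z * y"
proof -
  note axioms = assms(1)[unfolded comm_superalgebra_def, THEN conjunct2, THEN conjunct2, THEN conjunct2]
  note split = axioms[THEN conjunct1] and mult = axioms[THEN conjunct2]
  have comm: "a * b = (- 1) ^ (i * j) * (b * a)"
    if "i \<in> {0, 1}" "j \<in> {0, 1}" "a \<in> \<Lambda> i" "b \<in> \<Lambda> j" for i j a b
    using mult[THEN bspec, OF that(1), THEN bspec, OF that(2), THEN bspec, OF that(3), THEN bspec, OF that(4)] ..
  obtain z0 z1 where z: "z0 \<in> \<Lambda> 0" "z1 \<in> \<Lambda> 1" "z = z0 + z1"
    using split[rule_format, of z] by (elim bexE)
  \<comment> \<open>For an even factor the exponent \<open>i * j\<close> is 0, so no sign arises
    with either part of \<open>z\<close>.\<close>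
  have "y * z0 = z0 * y" using comm[of 0 0 y z0] assms(2) z by simp
  moreover have "y * z1 = z1 * y" using comm[of 0 1 y z1] assms(2) z by simp
  ultimately show ?thesis by (simp add: z(3) distrib_left distrib_right)
qed

theorem mainTheorem1:
  fixes \<Lambda> :: "nat \<Rightarrow> 'a::{euclidean_space,real_algebra_1} set"
    and n m p q r :: nat and s :: "nat \<Rightarrow> nat"
    and e \<epsilon> a :: "nat \<Rightarrow> 'a"
    and D :: "'a spoint set" and f :: "'a spoint \<Rightarrow> 'a"
    and X :: "real ^ 'N::{finite,wellorder} \<Rightarrow> 'a spoint"
    and x :: "real ^ 'N::_"
  defines "X \<equiv> of_coords n m p q e \<epsilon>"
  assumes "comm_superalgebra \<Lambda>"
    and "condition_A0 \<Lambda> p e"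
    and "condition_A1 \<Lambda> q \<epsilon> r s a"
    and "CARD('N) = n * (p + 1) + m * q"
    and "D \<subseteq> superspace \<Lambda> n m"
    and "open (X -` D)" and "bounded (X -` D)" and "C1_boundary (X -` D)"
    and "C1_closure (X -` D) (\<lambda>u. f (X u))"
    and "X x \<in> D"
  shows "boundary_integrable (X -` D) (mult_form (\<lambda>u. f (X u)) (super_kernel n m p q r e s a x)) \<and>
         domain_integrable (X -` D)
           (\<lambda>u. wedge (d'' n m p q r e s a (zero_form (\<lambda>v. f (X v))) u) (super_kernel n m p q r e s a x u)) \<and>
         f (X x) =
           boundary_integral (X -` D) (mult_form (\<lambda>u. f (X u)) (super_kernel n m p q r e s a x)) -
           domain_integral (X -` D)
             (\<lambda>u. wedge (d'' n m p q r e s a (zero_form (\<lambda>v. f (X v))) u) (super_kernel n m p q r e s a x u))"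
proof -
  note A0 = assms(3)[unfolded condition_A0_def is_basis_def]
  note A1 = assms(4)[unfolded condition_A1_def]
  interpret super_index n m p q r s e a "TYPE('N)"
  proof
    show "CARD('N) = n * (p + 1) + m * q" by fact
    show "e 0 = 1" using A0 by blast
    show "(\<Sum>k=0..p. e k * e k) = 0" using A0 by (simp add: power2_eq_square)
    show "e k * z = z * e k" if "k \<le> p" for k z
    proof (rule comm_superalgebra_even_central[OF assms(2)])
      have "e k \<in> e ` {0..p}" using that by simp
      then have "e k \<in> span (e ` {0..p})" by (rule span_base)
      then show "e k \<in> \<Lambda> 0" using A0 by simp
    qed
    show "s 1 = 1" "s (r + 1) = q + 1" using A1 by blast+
    show "s k < s (k + 1)" "a (s k) = 1" if "k \<in> {1..r}" for k using A1 that by blast+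
    show "(\<Sum>l=s k..<s (k + 1). a l * a l) = 0" if "k \<in> {1..r}" for k
      using A1 that by (simp add: power2_eq_square)
    show "a l * z = z * a l" if "l \<in> {1..q}" for l z
      using A1 that by (intro comm_superalgebra_even_central[OF assms(2)]) blast
  qed
  show ?thesis
    by (rule integral_representation[of "X -` D" "\<lambda>u. f (X u)" x]) (use assms in auto)
qed

end
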